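(* Consider the stochastic non-convex bilevel problem $\min_{\mathbf{x}\in\mathbb{R}^d}F(\mathbf{x})=f(\mathbf{x},\mathbf{y}^*(\mathbf{x}))$ subject to $\mathbf{y}^*(\mathbf{x})=\arg\min_{\mathbf{y}\in\mathcal{Y}}g(\mathbf{x},\mathbf{y})$, where $\mathcal{Y}\subseteq\mathbb{R}^{d'}$ is convex. Let $F(\mathbf{x}_0)-F_*\le\Delta_F$, where $F_*=\min_{\mathbf{x}}F(\mathbf{x})$, and suppose: (i) $g(\mathbf{x},\cdot)$ is $\lambda$-strongly convex with respect to $\mathbf{y}$ for any fixed $\mathbf{x}$; (ii) $\nabla_xf(\mathbf{x},\mathbf{y})$ is $L_{fx}$-Lipschitz continuous, $\nabla_yf(\mathbf{x},\mathbf{y})$ is $L_{fy}$-Lipschitz continuous, $\nabla_yg(\mathbf{x},\mathbf{y})$ is $L_{gy}$-Lipschitz continuous, $\nabla^2_{xy}g(\mathbf{x},\mathbf{y})$ is $L_{gxy}$-Lipschitz continuous, and $\nabla^2_{yy}g(\mathbf{x},\mathbf{y})$ is $L_{gyy}$-Lipschitz continuous, all with respect to $(\mathbf{x},\mathbf{y})$; (iii) $\mathcal{O}_{fx},\mathcal{O}_{fy},\mathcal{O}_{gy},\mathcal{O}_{gxy},\mathcal{O}_{gyy}$ are unbiased stochastic oracles of $\nabla_xf,\nabla_yf,\nabla_yg,\nabla^2_{xy}g,\nabla^2_{yy}g$ respectively, their variances are bounded by $\sigma^2$, and $0\preceq\mathcal{O}_{gyy}(\mathbf{x},\mathbf{y})\preceq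 C_{gyy}I$; (iv) $\|\nabla_yf(\mathbf{x},\mathbf{y})\|^2\le C_{fy}^2$ and $\|\nabla^2_{xy}g(\mathbf{x},\mathbf{y})\|^2\le C_{gxy}^2$. Run the algorithm SMB described in the context and let $\Delta_t=\|\mathbf{z}_{t+1}-\nabla F(\mathbf{x}_t)\|^2$. By setting $1-\beta=\gamma=O\big(\frac{1}{\sqrt{T}}\big)$, $\eta_x=O\big(\frac{1}{\sqrt{T}}\big)$, $\eta_y=O\big(\frac{1}{\sqrt{T}}\big)$, and $k_t=O(\ln T)$, we have $$\mathrm{E}\Big[\frac{1}{T+1}\sum_{t=0}^T\|\nabla F(\mathbf{x}_t)\|^2\Big]\le O\Big(\frac{1}{\sqrt{T}}\Big),\qquad \mathrm{E}\Big[\frac{1}{T+1}\sum_{t=0}^T\Delta_t\Big]\le O\Big(\frac{1}{\sqrt{T}}\Big).$$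
   Context: Algorithm SMB (Stochastic Momentum method for Bilevel optimization). Inputs: $\mathbf{x}_0\in\mathbb{R}^d$, $\mathbf{y}_0\in\mathbb{R}^{d'}$, momentum parameter $\beta$, step sizes $\eta_x,\eta_y$, and positive integers $k_t$. Initialize $h_0=\frac{k_0}{C_{gyy}}\prod_{i=1}^p\big(I-\frac{1}{C_{gyy}}\mathcal{O}_{gyy,i}(\mathbf{x}_0,\mathbf{y}_0)\big)$, where $p$ is uniformly sampled from $1,\dots,k_0$, and $\mathbf{z}_0=\mathcal{O}_{fx}(\mathbf{x}_0,\mathbf{y}_0)-\mathcal{O}_{gxy}(\mathbf{x}_0,\mathbf{y}_0)\,h_0\,\mathcal{O}_{fy}(\mathbf{x}_0,\mathbf{y}_0)$. For $t=0,1,\dots,T$: uniformly sample $p$ from $1,\dots,k_t$ and set $$h_{t+1}=\frac{k_t}{C_{gyy}}\prod_{i=1}^p\Big(I-\frac{1}{C_{gyy}}\mathcal{O}_{gyy,i}(\mathbf{x}_t,\mathbf{y}_t)\Big),$$ $$\mathbf{z}_{t+1}=\beta\mathbf{z}_t+(1-\beta)\big(\mathcal{O}_{fx}(\mathbf{x}_t,\mathbf{y}_t)-\mathcal{O}_{gxy}(\mathbf{x}_t,\mathbf{y}_t)\,h_{t+1}\,\mathcal{O}_{fy}(\mathbf{x}_t,\mathbf{y}_t)\big),$$ $$\mathbf{x}_{t+1}=\mathbf{x}_t-\eta_x\mathbf{z}_{t+1},\qquad \mathbf{y}_{t+1}=\Pi_{\mathcal{Y}}[\mathbf{y}_t+\eta_y\mathcal{O}_{gy}(\mathbf{x}_t,\mathbf{y}_t)].$$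 Here $\mathcal{O}_{gyy,i}$ denotes the $i$-th call of the stochastic oracle $\mathcal{O}_{gyy}$, and $\Pi_{\mathcal{Y}}$ is the projection onto the convex set $\mathcal{Y}$. $\|\cdot\|$ is the Euclidean norm of a vector or the spectral norm of a matrix. The $O(\cdot)$ notation refers to the dependence on $T$.
   Formalization: The y-update is a descent step (minus sign); p is uniform on 0,…,k_t−1; the constraint is assumed inactive, ∇_y g(x,y*(x))=0 for all x; Y is closed and nonempty; both bounds are O(ln T/√T) instead of O(1/√T). *)

theory Defs
  imports "HOL-Probability.Probability"
begin

definition grad :: "('a::real_inner \<Rightarrow> real) \<Rightarrow> 'a \<Rightarrow> 'a" where
  "grad F x = (THE D. GDERIV F x :> D)"

definition strongly_convex :: "real \<Rightarrow> ('a::real_inner \<Rightarrow> real) \<Rightarrow> bool" where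
  "strongly_convex \<mu> \<phi> \<longleftrightarrow>
     (\<forall>u v. \<forall>t\<in>{0..1}. \<phi> ((1 - t) *\<^sub>R u + t *\<^sub>R v)
        \<le> (1 - t) * \<phi> u + t * \<phi> v - \<mu> / 2 * t * (1 - t) * (norm (u - v))\<^sup>2)"

(* The library norm on real^'n^'m is the Frobenius norm. *)
definition spectral_norm :: "real^'n^'m \<Rightarrow> real" where
  "spectral_norm A = onorm ((*v) A)"

definition spectral_lipschitz ::
  "real \<Rightarrow> ('x::metric_space \<Rightarrow> 'y::metric_space \<Rightarrow> real^'n^'m) \<Rightarrow> bool" where
  "spectral_lipschitz L G \<longleftrightarrow>
     0 \<le> L \<and> (\<forall>x y x' y'. spectral_norm (G x y - G x' y') \<le> L * dist (x, y) (x', y'))"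

definition psd :: "real^'n^'n \<Rightarrow> bool" where
  "psd A \<longleftrightarrow> transpose A = A \<and> (\<forall>v. 0 \<le> v \<bullet> (A *v v))"

definition lower_argmin :: "('x \<Rightarrow> 'y \<Rightarrow> real) \<Rightarrow> 'y set \<Rightarrow> 'x \<Rightarrow> 'y" where
  "lower_argmin g Y x = arg_min_on (g x) Y"

definition bilevel_objective ::
  "('x \<Rightarrow> 'y \<Rightarrow> real) \<Rightarrow> ('x \<Rightarrow> 'y \<Rightarrow> real) \<Rightarrow> 'y set \<Rightarrow> 'x \<Rightarrow> real" where
  "bilevel_objective f g Y x = f x (lower_argmin g Y x)"

(* An oracle maps a random seed (with law S) and a query point to its answer.  The argument
   nrm is the norm in which the variance is measured: norm for vectors, spectral_norm for
   matrices. *)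
definition unbiased_oracle ::
  "('b \<Rightarrow> real) \<Rightarrow> 's measure \<Rightarrow> real
     \<Rightarrow> ('s \<Rightarrow> 'x::euclidean_space \<Rightarrow> 'y::euclidean_space \<Rightarrow> 'b::euclidean_space)
     \<Rightarrow> ('x \<Rightarrow> 'y \<Rightarrow> 'b) \<Rightarrow> bool" where
  "unbiased_oracle nrm S \<sigma> Orc G \<longleftrightarrow>
     (\<lambda>(s, x, y). Orc s x y) \<in> borel_measurable (S \<Otimes>\<^sub>M borel \<Otimes>\<^sub>M borel) \<and>
     (\<forall>x y. integrable S (\<lambda>s. Orc s x y) \<and>
            (LINT s|S. Orc s x y) = G x y \<and>
            integrable S (\<lambda>s. (nrm (Orc s x y - G x y))\<^sup>2) \<and>
            (LINT s|S. (nrm (Orc s x y - G x y))\<^sup>2) \<le> \<sigma>\<^sup>2)"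

record ('s, 'd, 'e) oracles =
  O_fx  :: "'s \<Rightarrow> real^'d \<Rightarrow> real^'e \<Rightarrow> real^'d"
  O_fy  :: "'s \<Rightarrow> real^'d \<Rightarrow> real^'e \<Rightarrow> real^'e"
  O_gy  :: "'s \<Rightarrow> real^'d \<Rightarrow> real^'e \<Rightarrow> real^'e"
  O_gxy :: "'s \<Rightarrow> real^'d \<Rightarrow> real^'e \<Rightarrow> real^'e^'d"
  O_gyy :: "'s \<Rightarrow> real^'d \<Rightarrow> real^'e \<Rightarrow> real^'e^'e"

(* One constructor instance per oracle call.  The first argument is the round: round 0 is the
   initialisation, round (Suc t) is iteration t.  In Call_gyy the second argument is i. *)
datatype oracle_call =
    Call_fx nat | Call_fy nat | Call_gy nat | Call_gxy nat | Call_gyy nat nat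

primrec neumann_prod :: "real \<Rightarrow> (nat \<Rightarrow> real^'e^'e) \<Rightarrow> nat \<Rightarrow> real^'e^'e" where
  "neumann_prod C A 0 = mat 1"
| "neumann_prod C A (Suc n) = neumann_prod C A n ** (mat 1 - (1 / C) *\<^sub>R A (Suc n))"

definition smb_h ::
  "('s, 'd::finite, 'e::finite) oracles \<Rightarrow> real \<Rightarrow> nat \<Rightarrow> (oracle_call \<Rightarrow> 's) \<Rightarrow> (nat \<Rightarrow> nat) \<Rightarrow> nat
     \<Rightarrow> real^'d \<Rightarrow> real^'e \<Rightarrow> real^'e^'e" where
  "smb_h Orc C kr \<xi> p r x y =
     (real kr / C) *\<^sub>R neumann_prod C (\<lambda>i. O_gyy Orc (\<xi> (Call_gyy r i)) x y) (p r)"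

definition smb_estimate ::
  "('s, 'd::finite, 'e::finite) oracles \<Rightarrow> real \<Rightarrow> nat \<Rightarrow> (oracle_call \<Rightarrow> 's) \<Rightarrow> (nat \<Rightarrow> nat) \<Rightarrow> nat
     \<Rightarrow> real^'d \<Rightarrow> real^'e \<Rightarrow> real^'d" where
  "smb_estimate Orc C kr \<xi> p r x y =
     O_fx Orc (\<xi> (Call_fx r)) x y
     - O_gxy Orc (\<xi> (Call_gxy r)) x y
         *v (smb_h Orc C kr \<xi> p r x y *v O_fy Orc (\<xi> (Call_fy r)) x y)"

(* The triple (x_t, y_t, z_t) for one outcome of the seeds \<xi> and of the sampled p.
   The lower-level variable takes a projected stochastic gradient DESCENT step on g. *)
primrec smb ::
  "('s, 'd::finite, 'e::finite) oracles \<Rightarrow> real \<Rightarrow> (real^'e) set \<Rightarrow> real \<Rightarrow> real \<Rightarrow> real \<Rightarrow> (nat \<Rightarrow> nat)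
     \<Rightarrow> real^'d \<Rightarrow> real^'e \<Rightarrow> (oracle_call \<Rightarrow> 's) \<Rightarrow> (nat \<Rightarrow> nat) \<Rightarrow> nat
     \<Rightarrow> (real^'d) \<times> (real^'e) \<times> (real^'d)" where
  "smb Orc C Y \<beta> \<eta>x \<eta>y k x0 y0 \<xi> p 0 = (x0, y0, smb_estimate Orc C (k 0) \<xi> p 0 x0 y0)"
| "smb Orc C Y \<beta> \<eta>x \<eta>y k x0 y0 \<xi> p (Suc t) =
     (let (x, y, z) = smb Orc C Y \<beta> \<eta>x \<eta>y k x0 y0 \<xi> p t;
          z' = \<beta> *\<^sub>R z + (1 - \<beta>) *\<^sub>R smb_estimate Orc C (k t) \<xi> p (Suc t) x y
      in (x - \<eta>x *\<^sub>R z',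
          closest_point Y (y - \<eta>y *\<^sub>R O_gy Orc (\<xi> (Call_gy (Suc t))) x y),
          z'))"

definition smb_x where
  "smb_x Orc C Y \<beta> \<eta>x \<eta>y k x0 y0 \<xi> p t = fst (smb Orc C Y \<beta> \<eta>x \<eta>y k x0 y0 \<xi> p t)"

definition smb_z where
  "smb_z Orc C Y \<beta> \<eta>x \<eta>y k x0 y0 \<xi> p t = snd (snd (smb Orc C Y \<beta> \<eta>x \<eta>y k x0 y0 \<xi> p t))"

(* All seeds and all sampled p are mutually independent.  The parameter k_t governs round Suc t,
   and k_0 also governs round 0; hence k (r - 1) with truncated subtraction.  The law of p is
   uniform on the k values {0, ..., k - 1}, p = 0 giving the empty product: then the mean of
   smb_h is the Neumann sum (1/C) * (\<Sum>p<k. (I - H/C)^p), which tends to the inverse of H.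
   Sampling from {1, ..., k} would shift this mean by approximately -(1/C) * I for every k. *)
definition smb_sampling ::
  "'w measure \<Rightarrow> 's measure \<Rightarrow> (nat \<Rightarrow> nat) \<Rightarrow> (oracle_call \<Rightarrow> 'w \<Rightarrow> 's) \<Rightarrow> (nat \<Rightarrow> 'w \<Rightarrow> nat) \<Rightarrow> bool"
where
  "smb_sampling M S k \<xi> p \<longleftrightarrow>
     prob_space M \<and>
     (\<forall>c. \<xi> c \<in> measurable M S \<and> distr M S (\<xi> c) = S) \<and>
     (\<forall>r. p r \<in> measurable M (count_space UNIV) \<and>
          distr M (count_space UNIV) (p r) = measure_pmf (pmf_of_set {0..<k (r - 1)})) \<and>
     prob_space.indep_sets M
       (case_sum (\<lambda>c. {\<xi> c -` A \<inter> space M | A. A \<in> sets S})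
                 (\<lambda>r. {p r -` A \<inter> space M | A. A \<in> UNIV})) UNIV"

end

theory Submission
  imports Defs
begin

text \<open>
  The lower minimizer solves \<open>gy x (y\<^sup>* x) = 0\<close>, so implicit differentiation gives
  \<open>\<nabla>F x = \<Phi> x (y\<^sup>* x)\<close> with \<open>\<Phi> = fx - gxy gyy\<inverse> fy\<close>, and \<open>\<Phi>\<close>, \<open>y\<^sup>*\<close> and \<open>\<nabla>F\<close> are Lipschitz.
  The random factors \<open>B\<^sub>i = I - O\<^sub>i / C\<close> of the Neumann product satisfy
  \<open>\<parallel>B\<^sub>i v\<parallel>\<^sup>2 \<le> v \<bullet> B\<^sub>i v\<close>, so by independence a product of \<open>n\<close> of them has mean square at most
  \<open>\<rho>\<^sup>n\<close> with \<open>\<rho> = 1 - lam / C\<close>. Averaged over the random length, the estimator of the hypergradient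
  has a squared bias of order \<open>\<rho>\<^sup>k\<close>, hence of order \<open>1 / T\<close> when \<open>k \<ge> (C / lam) ln T\<close>, and a variance
  of order \<open>k\<close>, which is the source of the factor \<open>ln T\<close>. With all step sizes proportional to
  \<open>s = 1 / \<surd>T\<close>, a potential combining the objective gap, the tracking error
  \<open>\<parallel>z\<^sub>t\<^sub>+\<^sub>1 - \<nabla>F x\<^sub>t\<parallel>\<^sup>2\<close> and the lower-level error \<open>\<parallel>y\<^sub>t - y\<^sup>* x\<^sub>t\<parallel>\<^sup>2\<close> decreases in mean by
  \<open>s\<close> times the quantities to be bounded, up to an additive error of order \<open>s\<^sup>2 ln T\<close>.
\<close>

section \<open>Matrices\<close>

text \<open>Only partial derivatives of \<open>f\<close> and \<open>gy\<close> are assumed, so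
  neither a joint chain rule nor the implicit function theorem is at hand. \<open>F\<close> is
  expanded through the intermediate point \<open>(x, ystar x')\<close>, and one quadratic remainder
  bound both identifies the gradient and serves as smoothness estimate. The inverse Hessian never
  appears as a matrix, only as the solution of a linear system. On the random side, the estimator
  composes independent random objects, and it is evaluated at iterates that depend on earlier draws.
  Both dependences are handled by one device: freeze one part, average the other, and obtain
  integrability along the way, since nothing bounds the iterates a priori. The movement of the
  reference points \<open>DF (xs t w)\<close> and \<open>ystar (xs t w)\<close> costs a multiple of
  the squared momentum, with a factor quadratic in the ratio of \<open>\<eta>x\<close> to
  \<open>s\<close>. A small but fixed ratio lets the descent of \<open>F\<close> absorb this cost,
  so a single time scale suffices.\<close>

lemma norm_mult_vec_le_spectral: "norm (A *v x) \<le> spectral_norm A * norm x"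
  for A :: "real^'n^'m"
  unfolding spectral_norm_def by (rule onorm) simp

lemma spectral_norm_nonneg: "0 \<le> spectral_norm (A :: real^'n^'m)"
  unfolding spectral_norm_def by (rule onorm_pos_le) simp

lemma inner_transpose_mult: "u \<bullet> (A *v v) = (transpose A *v u) \<bullet> v"
  for A :: "real^'n^'m"
  by (simp add: dot_lmul_matrix)

text \<open>Testing \<open>transpose A *v v\<close> against itself moves the transpose to the other
  side. It is needed because the rows of \<open>gxy\<close> are indexed by the upper variable, while
  the derivative of \<open>gy\<close> in \<open>x\<close> is its transpose.\<close>

lemma norm_transpose_mult_le: "norm (transpose A *v v) \<le> spectral_norm A * norm v"
  for A :: "real^'n^'m"
proof (cases "transpose A *v v = 0")
  case False
  let ?w = "transpose A *v v"
  have "norm ?w * norm ?w = v \<bullet> (A *v ?w)"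
    by (simp only: inner_transpose_mult power2_norm_eq_inner[symmetric] power2_eq_square)
  also have "\<dots> \<le> norm v * norm (A *v ?w)" by (rule norm_cauchy_schwarz)
  also have "\<dots> \<le> norm v * (spectral_norm A * norm ?w)"
    by (intro mult_left_mono norm_mult_vec_le_spectral) simp
  finally have "norm ?w * norm ?w \<le> (spectral_norm A * norm v) * norm ?w"
    by (simp only: mult_ac)
  then show ?thesis using False by (simp only: mult_le_cancel_right zero_less_norm_iff) simp
qed (simp add: spectral_norm_nonneg)

lemma norm_mult_vec_le:
  fixes A :: "real^'n^'m"
  assumes "spectral_norm A \<le> c" "norm v \<le> d"
  shows "norm (A *v v) \<le> c * d"
proof -
  have "norm (A *v v) \<le> spectral_norm A * norm v" by (rule norm_mult_vec_le_spectral)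
  also have "\<dots> \<le> c * d"
    using assms spectral_norm_nonneg[of A] norm_ge_zero[of v] by (intro mult_mono) linarith+
  finally show ?thesis .
qed

lemma bounded_bilinear_mult_vec: "bounded_bilinear (\<lambda>(A :: real^'n^'m) v. A *v v)"
  by (rule bilinear_conv_bounded_bilinear[THEN iffD1])
     (simp add: bilinear_def linear_iff matrix_vector_mult_add_rdistrib
        matrix_vector_right_distrib scaleR_matrix_vector_assoc matrix_vector_mult_scaleR)

lemma measurable_mult_vec[measurable]:
  fixes A :: "'a \<Rightarrow> real^'n^'m"
  assumes "A \<in> borel_measurable M" "v \<in> borel_measurable M"
  shows "(\<lambda>w. A w *v v w) \<in> borel_measurable M"
  using assms
  by (rule borel_measurable_continuous_Pair)
     (rule bounded_bilinear.continuous_on[OF bounded_bilinear_mult_vec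
        continuous_on_fst[OF continuous_on_id] continuous_on_snd[OF continuous_on_id]])

lemma psd_contraction:
  fixes A :: "real^'n^'n"
  assumes "psd A" "psd (mat 1 - A)"
  shows "(norm (A *v v))\<^sup>2 \<le> v \<bullet> (A *v v)"
proof -
  let ?B = "mat 1 - A"
  have B: "?B *v u = u - A *v u" for u
    by (simp add: matrix_vector_mult_diff_rdistrib)
  have sym: "u \<bullet> (A *v w) = (A *v u) \<bullet> w" for u w
    using inner_transpose_mult[of u A w] assms(1) unfolding psd_def by metis
  have "0 \<le> (A *v v) \<bullet> (?B *v (A *v v)) + (?B *v v) \<bullet> (A *v (?B *v v))"
    using assms by (simp add: psd_def)
  \<comment> \<open>\<open>A - A\<^sup>2 = A (1 - A) A + (1 - A) A (1 - A)\<close>\<close>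
  also have "\<dots> = v \<bullet> (A *v v) - (A *v v) \<bullet> (A *v v)"
    unfolding B matrix_vector_mult_diff_distrib inner_add_left[symmetric]
    by (simp add: inner_diff_right sym)
  finally show ?thesis by (simp add: power2_norm_eq_inner)
qed

section \<open>Inequalities for squared norms\<close>

lemma norm_add_sq_le: "(norm (a + b))\<^sup>2 \<le> 2 * (norm a)\<^sup>2 + 2 * (norm b)\<^sup>2"
  for a b :: "'a::real_inner"
proof -
  have "0 \<le> (norm (a - b))\<^sup>2" by simp
  thus ?thesis by (simp add: power2_norm_eq_inner inner_commute algebra_simps)
qed

lemma norm_add_sq_young:
  fixes a b :: "'a::real_inner"
  assumes "0 < \<theta>"
  shows "(norm (a + b))\<^sup>2 \<le> (1 + \<theta>) * (norm a)\<^sup>2 + (1 + 1 / \<theta>) * (norm b)\<^sup>2"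
proof -
  have "0 \<le> (norm (\<theta> *\<^sub>R a - b))\<^sup>2 / \<theta>" using assms by simp
  also have "\<dots> = \<theta> * (norm a)\<^sup>2 - 2 * (a \<bullet> b) + (norm b)\<^sup>2 / \<theta>"
    using assms
    by (simp add: power2_norm_eq_inner inner_diff_left inner_diff_right inner_commute field_simps)
  finally show ?thesis by (simp add: power2_norm_eq_inner inner_commute algebra_simps)
qed

lemma norm_convex_combination_sq_le:
  fixes a b :: "'a::real_inner"
  assumes "0 \<le> \<gamma>" "\<gamma> \<le> 1"
  shows "(norm ((1 - \<gamma>) *\<^sub>R a + \<gamma> *\<^sub>R b))\<^sup>2 \<le> (1 - \<gamma>) * (norm a)\<^sup>2 + \<gamma> * (norm b)\<^sup>2"
proof -
  have "0 \<le> \<gamma> * (1 - \<gamma>) * (norm (a - b))\<^sup>2" using assms by simp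
  also have "\<dots> = (1 - \<gamma>) * (norm a)\<^sup>2 + \<gamma> * (norm b)\<^sup>2 - (norm ((1 - \<gamma>) *\<^sub>R a + \<gamma> *\<^sub>R b))\<^sup>2"
    by (simp add: power2_norm_eq_inner inner_commute algebra_simps)
  finally show ?thesis by simp
qed

section \<open>Differentiability\<close>

lemma GDERIV_unique: "GDERIV F x :> D \<Longrightarrow> GDERIV F x :> D' \<Longrightarrow> D = D'"
proof -
  assume "GDERIV F x :> D" "GDERIV F x :> D'"
  then have "(\<lambda>h. h \<bullet> D) = (\<lambda>h. h \<bullet> D')"
    unfolding gderiv_def by (rule has_derivative_unique)
  then have "(D - D') \<bullet> D = (D - D') \<bullet> D'" by metis
  then have "(D - D') \<bullet> (D - D') = 0" by (simp add: inner_diff_right)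
  then show "D = D'" by simp
qed

lemma grad_eqI: "GDERIV F x :> D \<Longrightarrow> grad F x = D"
  unfolding grad_def using GDERIV_unique by blast

text \<open>The mean value inequality is applied to the linearization error on the segment; this
  costs \<open>L\<close> where integration along it would give \<open>L / 2\<close>. Only the
  variation of \<open>\<phi>'\<close> relative to its value at the base point \<open>a\<close>
  enters.\<close>

lemma lipschitz_derivative_remainder:
  fixes \<phi> :: "'a::real_normed_vector \<Rightarrow> 'b::real_normed_vector"
  assumes der: "\<And>x. (\<phi> has_derivative \<phi>' x) (at x)"
    and lip: "\<And>x h. norm (\<phi>' x h - \<phi>' a h) \<le> L * norm (x - a) * norm h"
    and L: "0 \<le> L"
  shows "norm (\<phi> b - \<phi> a - \<phi>' a (b - a)) \<le> L * (norm (b - a))\<^sup>2"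
proof -
  have "norm (\<phi> b - \<phi> a - \<phi>' a (b - a)) \<le> norm (b - a) * (L * norm (b - a))"
  proof (rule differentiable_bound_linearization[where S = "closed_segment a b" and f' = \<phi>'])
    show "a + t *\<^sub>R (b - a) \<in> closed_segment a b" if "t \<in> {0..1}" for t
      using that by (auto simp: in_segment algebra_simps intro!: exI[of _ t])
    show "(\<phi> has_derivative \<phi>' x) (at x within closed_segment a b)" for x
      using der has_derivative_at_withinI by blast
    show "onorm (\<phi>' x - \<phi>' a) \<le> L * norm (b - a)" if x: "x \<in> closed_segment a b" for x
    proof (rule onorm_bound, unfold minus_apply)
      show "0 \<le> L * norm (b - a)" using L by simp
      fix h
      have "norm (\<phi>' x h - \<phi>' a h) \<le> L * norm (x - a) * norm h" by (rule lip)
      also have "\<dots> \<le> L * norm (b - a) * norm h"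
        using segment_bound1[OF x] L by (intro mult_right_mono mult_left_mono) auto
      finally show "norm (\<phi>' x h - \<phi>' a h) \<le> L * norm (b - a) * norm h" .
    qed
    show "a \<in> closed_segment a b" by simp
  qed
  then show ?thesis by (simp add: power2_eq_square algebra_simps)
qed

lemma lipschitz_gradient_remainder:
  assumes der: "\<And>x. GDERIV \<phi> x :> G x"
    and lip: "\<And>x. norm (G x - G a) \<le> L * norm (x - a)"
    and L: "0 \<le> L"
  shows "\<bar>\<phi> b - \<phi> a - (b - a) \<bullet> G a\<bar> \<le> L * (norm (b - a))\<^sup>2"
proof -
  have "norm (\<phi> b - \<phi> a - (b - a) \<bullet> G a) \<le> L * (norm (b - a))\<^sup>2"
  proof (rule lipschitz_derivative_remainder)
    show "(\<phi> has_derivative (\<lambda>h. h \<bullet> G x)) (at x)" for x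
      using der by (simp add: gderiv_def)
    show "norm (h \<bullet> G x - h \<bullet> G a) \<le> L * norm (x - a) * norm h" for x h
    proof -
      have "norm (h \<bullet> G x - h \<bullet> G a) = \<bar>h \<bullet> (G x - G a)\<bar>" by (simp add: inner_diff_right)
      also have "\<dots> \<le> norm h * norm (G x - G a)" by (rule Cauchy_Schwarz_ineq2)
      also have "\<dots> \<le> norm h * (L * norm (x - a))" by (intro mult_left_mono lip) simp
      finally show ?thesis by (simp add: algebra_simps)
    qed
  qed (rule L)
  then show ?thesis by simp
qed

text \<open>After division by the distance the remainder is at most \<open>K\<close> times the
  distance. This is how the objective gets a gradient without differentiating the solution
  map.\<close>

lemma GDERIV_of_quadratic_remainder:
  fixes F :: "'a::real_inner \<Rightarrow> real"
  assumes "\<And>x'. \<bar>F x' - F x - (x' - x) \<bullet> D\<bar> \<le> K * (norm (x' - x))\<^sup>2"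
  shows "GDERIV F x :> D"
  unfolding gderiv_def has_derivative_at2
proof (intro conjI)
  show "bounded_linear (\<lambda>h. h \<bullet> D)" by (rule bounded_linear_inner_left)
  have "((\<lambda>y. K * norm (y - x)) \<longlongrightarrow> K * norm (x - x)) (at x)"
    by (intro tendsto_intros)
  then have lim: "((\<lambda>y. K * norm (y - x)) \<longlongrightarrow> 0) (at x)" by simp
  show "(\<lambda>y. (1 / norm (y - x)) *\<^sub>R (F y - (F x + (y - x) \<bullet> D))) \<midarrow>x\<rightarrow> 0"
  proof (rule Lim_null_comparison[OF _ lim])
    show "\<forall>\<^sub>F y in at x. norm ((1 / norm (y - x)) *\<^sub>R (F y - (F x + (y - x) \<bullet> D))) \<le> K * norm (y - x)"
      unfolding eventually_at_filter
    proof (intro always_eventually allI impI)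
      fix y assume "y \<noteq> x"
      have "\<bar>F y - (F x + (y - x) \<bullet> D)\<bar> \<le> K * norm (y - x) * norm (y - x)"
        using assms[of y] by (simp add: power2_eq_square algebra_simps)
      then show "norm ((1 / norm (y - x)) *\<^sub>R (F y - (F x + (y - x) \<bullet> D))) \<le> K * norm (y - x)"
        using \<open>y \<noteq> x\<close> by (simp add: divide_le_eq)
    qed
  qed
qed

text \<open>The defining inequality at \<open>u + t *\<^sub>R (v - u)\<close>, divided by
  \<open>t\<close>, has the directional derivative as its limit when \<open>t\<close> tends to 0
  from the right.\<close>

lemma strongly_convex_gradient_bound:
  assumes sc: "strongly_convex \<mu> \<phi>" and der: "GDERIV \<phi> u :> G"
  shows "\<phi> u + (v - u) \<bullet> G + \<mu> / 2 * (norm (v - u))\<^sup>2 \<le> \<phi> v"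
proof -
  let ?q = "\<lambda>t. (\<phi> (u + t *\<^sub>R (v - u)) - \<phi> u) / t"
  have "((\<lambda>t. \<phi> (u + t *\<^sub>R (v - u))) has_derivative (\<lambda>t. (t *\<^sub>R (v - u)) \<bullet> G)) (at 0)"
    by (rule has_derivative_compose[where f = "\<lambda>t. u + t *\<^sub>R (v - u)" and g = \<phi>])
       (use der in \<open>auto simp: gderiv_def intro!: derivative_eq_intros\<close>)
  then have "((\<lambda>t. \<phi> (u + t *\<^sub>R (v - u))) has_field_derivative ((v - u) \<bullet> G)) (at 0)"
    by (simp add: has_field_derivative_def mult_commute_abs)
  then have lim: "(?q \<longlongrightarrow> (v - u) \<bullet> G) (at_right 0)"
    unfolding has_field_derivative_iff by (auto intro: tendsto_within_subset)
  have lim2: "((\<lambda>t. \<phi> v - \<phi> u - \<mu> / 2 * (1 - t) * (norm (v - u))\<^sup>2)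
      \<longlongrightarrow> \<phi> v - \<phi> u - \<mu> / 2 * (1 - 0) * (norm (v - u))\<^sup>2) (at_right 0)"
    by (intro tendsto_intros)
  have "(v - u) \<bullet> G \<le> \<phi> v - \<phi> u - \<mu> / 2 * (1 - 0) * (norm (v - u))\<^sup>2"
  proof (rule tendsto_le[OF _ lim2 lim])
    show "\<forall>\<^sub>F t in at_right 0. ?q t \<le> \<phi> v - \<phi> u - \<mu> / 2 * (1 - t) * (norm (v - u))\<^sup>2"
      using eventually_at_right_less[of "0::real"] eventually_at_right_real[of 0 1, simplified]
    proof eventually_elim
      case (elim t)
      have "(1 - t) *\<^sub>R u + t *\<^sub>R v = u + t *\<^sub>R (v - u)" by (simp add: algebra_simps)
      then have "\<phi> (u + t *\<^sub>R (v - u))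
          \<le> (1 - t) * \<phi> u + t * \<phi> v - \<mu> / 2 * t * (1 - t) * (norm (v - u))\<^sup>2"
        using sc[unfolded strongly_convex_def, rule_format, of t u v] elim
        by (simp add: norm_minus_commute)
      then have "\<phi> (u + t *\<^sub>R (v - u)) - \<phi> u
          \<le> (\<phi> v - \<phi> u - \<mu> / 2 * (1 - t) * (norm (v - u))\<^sup>2) * t"
        by (simp add: algebra_simps)
      then show ?case using elim by (simp only: divide_le_eq) simp
    qed
  qed simp
  then show ?thesis by simp
qed

lemma strongly_convex_monotone_gradient:
  assumes sc: "strongly_convex \<mu> \<phi>" and "GDERIV \<phi> u :> G" "GDERIV \<phi> v :> H"
  shows "\<mu> * (norm (v - u))\<^sup>2 \<le> (v - u) \<bullet> (H - G)"
  using strongly_convex_gradient_bound[OF sc assms(2), of v]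
    strongly_convex_gradient_bound[OF sc assms(3), of u]
  by (simp add: norm_minus_commute inner_diff_left inner_diff_right)

text \<open>Strong monotonicity between \<open>y\<close> and \<open>y + t *\<^sub>R v\<close> scales
  like the square of \<open>t\<close>; dividing by it and letting \<open>t\<close> tend to 0 leaves
  coercivity of the derivative. Strong convexity thus bounds the Hessian below with no second-order
  expansion.\<close>

lemma monotone_derivative_bound:
  fixes \<phi> :: "'a::real_inner \<Rightarrow> 'a"
  assumes der: "(\<phi> has_derivative D) (at y)"
    and mono: "\<And>z. \<mu> * (norm (z - y))\<^sup>2 \<le> (z - y) \<bullet> (\<phi> z - \<phi> y)"
  shows "\<mu> * (norm v)\<^sup>2 \<le> v \<bullet> D v"
proof -
  have lin: "linear D" using der has_derivative_linear by blast
  have "((\<lambda>t. v \<bullet> \<phi> (y + t *\<^sub>R v)) has_derivative (\<lambda>t. v \<bullet> D (t *\<^sub>R v))) (at 0)"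
    by (rule has_derivative_inner_right, rule has_derivative_compose[where f = "\<lambda>t. y
        + t *\<^sub>R v" and g = \<phi>])
       (use der in \<open>auto intro!: derivative_eq_intros\<close>)
  then have "((\<lambda>t. v \<bullet> \<phi> (y + t *\<^sub>R v)) has_field_derivative (v \<bullet> D v)) (at 0)"
    by (simp add: has_field_derivative_def linear_scale[OF lin] mult_commute_abs)
  then have lim: "((\<lambda>t. (v \<bullet> \<phi> (y + t *\<^sub>R v) - v \<bullet> \<phi> y) / t) \<longlongrightarrow> v \<bullet> D v) (at_right 0)"
    unfolding has_field_derivative_iff by (auto intro: tendsto_within_subset)
  show ?thesis
  proof (rule tendsto_lowerbound[OF lim])
    show "\<forall>\<^sub>F t in at_right 0. \<mu> * (norm v)\<^sup>2 \<le> (v \<bullet> \<phi> (y + t *\<^sub>R v) - v \<bullet> \<phi> y) / t"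
      using eventually_at_right_less[of "0::real"]
    proof eventually_elim
      case (elim t)
      have "t * (t * (\<mu> * (norm v)\<^sup>2)) \<le> t * (v \<bullet> \<phi> (y + t *\<^sub>R v) - v \<bullet> \<phi> y)"
        using mono[of "y + t *\<^sub>R v"] elim
            by (simp add: power_mult_distrib power2_eq_square inner_diff_right algebra_simps)
      then show ?case using elim by (simp add: le_divide_eq mult.commute)
    qed
  qed simp
qed

section \<open>The hypergradient\<close>

lemma strongly_convex_attains_inf:
  fixes \<phi> :: "'a::euclidean_space \<Rightarrow> real"
  assumes sc: "strongly_convex \<mu> \<phi>" and \<mu>: "0 < \<mu>" and der: "\<And>y. GDERIV \<phi> y :> G y"
    and Y: "closed Y" "Y \<noteq> {}"
  shows "\<exists>y\<in>Y. \<forall>z\<in>Y. \<phi> y \<le> \<phi> z"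
proof -
  obtain y0 where y0: "y0 \<in> Y" using Y by blast
  \<comment> \<open>Beyond this radius the quadratic term of the strong convexity bound outweighs
    the linear one, so \<open>\<phi> y0\<close> is a lower bound there and only a compact set
    remains.\<close>
  let ?r = "2 * norm (G y0) / \<mu>"
  have cont: "continuous_on A \<phi>" for A
    using der unfolding gderiv_def
    by (meson continuous_at_imp_continuous_on has_derivative_continuous)
  have "\<exists>y\<in>Y \<inter> cball y0 ?r. \<forall>z\<in>Y \<inter> cball y0 ?r. \<phi> y \<le> \<phi> z"
    using Y y0 \<mu> by (intro continuous_attains_inf cont) (auto intro!: closed_Int_compact)
  then obtain y where y: "y \<in> Y" "\<And>z. z \<in> Y \<inter> cball y0 ?r \<Longrightarrow> \<phi> y \<le> \<phi> z" by blast
  have "\<phi> y \<le> \<phi> z" if z: "z \<in> Y" for z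
  proof (cases "dist y0 z \<le> ?r")
    case False
    then have "?r < norm (z - y0)" by (simp add: dist_norm norm_minus_commute)
    then have "2 * norm (G y0) \<le> \<mu> * norm (z - y0)"
      using \<mu> by (simp add: divide_less_eq mult.commute)
    then have "norm (z - y0) * (2 * norm (G y0)) \<le> norm (z - y0) * (\<mu> * norm (z - y0))"
      by (intro mult_left_mono) simp_all
    moreover have "- (norm (z - y0) * norm (G y0)) \<le> (z - y0) \<bullet> G y0"
      using Cauchy_Schwarz_ineq2[of "z - y0" "G y0"] by linarith
    ultimately have "0 \<le> (z - y0) \<bullet> G y0 + \<mu> / 2 * (norm (z - y0))\<^sup>2"
      by (simp add: power2_eq_square algebra_simps)
    then have "\<phi> y0 \<le> \<phi> z" using strongly_convex_gradient_bound[OF sc der, of y0 z] by linarith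
    moreover have "\<phi> y \<le> \<phi> y0" using y(2)[of y0] y0 \<mu> by simp
    ultimately show ?thesis by simp
  qed (use y z in auto)
  then show ?thesis using y by blast
qed

text \<open>\<open>inactive\<close> says that the lower minimizer is a stationary point, so the
  solution map obeys an equation instead of a variational inequality. Symmetry of \<open>gyy\<close>
  is an assumption here and is later obtained from its oracle.\<close>

locale bilevel =
  fixes f g :: "real^'d \<Rightarrow> real^'e \<Rightarrow> real"
    and Y :: "(real^'e) set"
    and fx :: "real^'d \<Rightarrow> real^'e \<Rightarrow> real^'d"
    and fy gy :: "real^'d \<Rightarrow> real^'e \<Rightarrow> real^'e"
    and gxy :: "real^'d \<Rightarrow> real^'e \<Rightarrow> real^'e^'d"
    and gyy :: "real^'d \<Rightarrow> real^'e \<Rightarrow> real^'e^'e"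
    and lam Lfx Lfy Lgy Lgxy Lgyy Cfy Cgxy :: real
  assumes Y: "convex Y" "closed Y" "Y \<noteq> {}"
    and lam_pos: "0 < lam" and strong: "\<And>x. strongly_convex lam (g x)"
    and grad_fx: "\<And>x y. GDERIV (\<lambda>x. f x y) x :> fx x y"
    and grad_fy: "\<And>x y. GDERIV (\<lambda>y. f x y) y :> fy x y"
    and grad_gy: "\<And>x y. GDERIV (\<lambda>y. g x y) y :> gy x y"
    and hess_gxy: "\<And>x y. ((\<lambda>x. gy x y) has_derivative (*v) (transpose (gxy x y))) (at x)"
    and hess_gyy: "\<And>x y. ((\<lambda>y. gy x y) has_derivative (*v) (gyy x y)) (at y)"
    and inactive: "\<And>x. gy x (lower_argmin g Y x) = 0"
    and lip_fx: "Lfx-lipschitz_on UNIV (\<lambda>(x, y). fx x y)"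
    and lip_fy: "Lfy-lipschitz_on UNIV (\<lambda>(x, y). fy x y)"
    and lip_gy: "Lgy-lipschitz_on UNIV (\<lambda>(x, y). gy x y)"
    and lip_gxy: "spectral_lipschitz Lgxy gxy"
    and lip_gyy: "spectral_lipschitz Lgyy gyy"
    and gyy_sym: "\<And>x y. transpose (gyy x y) = gyy x y"
    and bound_fy: "\<And>x y. norm (fy x y) \<le> Cfy"
    and bound_gxy: "\<And>x y. spectral_norm (gxy x y) \<le> Cgxy"
begin

abbreviation "ystar \<equiv> lower_argmin g Y"

section \<open>Regularity of the lower-level solution map\<close>

lemma constants_nonneg:
  "0 \<le> Lfx" "0 \<le> Lfy" "0 \<le> Lgy" "0 \<le> Lgxy" "0 \<le> Lgyy" "0 \<le> Cfy" "0 \<le> Cgxy"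
  using lip_fx lip_fy lip_gy lip_gxy lip_gyy
    order_trans[OF norm_ge_zero bound_fy] order_trans[OF spectral_norm_nonneg bound_gxy]
  by (auto simp: lipschitz_on_def spectral_lipschitz_def)

lemma fx_lipschitz: "norm (fx x y - fx x' y') \<le> Lfx * dist (x, y) (x', y')"
  using lipschitz_onD[OF lip_fx, of "(x, y)" "(x', y')"] by (simp add: dist_norm)

lemma fy_lipschitz: "norm (fy x y - fy x' y') \<le> Lfy * dist (x, y) (x', y')"
  using lipschitz_onD[OF lip_fy, of "(x, y)" "(x', y')"] by (simp add: dist_norm)

lemma gy_lipschitz: "norm (gy x y - gy x' y') \<le> Lgy * dist (x, y) (x', y')"
  using lipschitz_onD[OF lip_gy, of "(x, y)" "(x', y')"] by (simp add: dist_norm)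

lemma gxy_lipschitz: "spectral_norm (gxy x y - gxy x' y') \<le> Lgxy * dist (x, y) (x', y')"
  using lip_gxy by (simp add: spectral_lipschitz_def)

lemma gyy_lipschitz: "spectral_norm (gyy x y - gyy x' y') \<le> Lgyy * dist (x, y) (x', y')"
  using lip_gyy by (simp add: spectral_lipschitz_def)

lemma dist_Pair_same [simp]:
  "dist (x, y) (x, y') = norm (y - y')" "dist (x, y) (x', y) = norm (x - x')"
  for x x' :: "'p::real_normed_vector" and y y' :: "'q::real_normed_vector"
  by (simp_all add: dist_prod_def dist_norm)

lemma gy_monotone: "lam * (norm (y' - y))\<^sup>2 \<le> (y' - y) \<bullet> (gy x y' - gy x y)"
  using strongly_convex_monotone_gradient[OF strong grad_gy grad_gy] .

lemma gyy_lower: "lam * (norm v)\<^sup>2 \<le> v \<bullet> (gyy x y *v v)"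
  using monotone_derivative_bound[OF hess_gyy gy_monotone] .

text \<open>Strong monotonicity and the Lipschitz bound are compared along one unit vector. The use
  is that \<open>Lgy\<close> is positive, so the lower step size may be defined by dividing by
  \<open>Lgy\<^sup>2\<close>.\<close>

lemma lam_le_Lgy: "lam \<le> Lgy"
proof -
  obtain v :: "real^'e" where v: "norm v = 1" using norm_Basis SOME_Basis by blast
  have "lam * (norm v)\<^sup>2 \<le> v \<bullet> (gy 0 v - gy 0 0)" using gy_monotone[of v 0] by simp
  also have "\<dots> \<le> norm v * norm (gy 0 v - gy 0 0)" by (rule norm_cauchy_schwarz)
  also have "\<dots> \<le> Lgy" using gy_lipschitz[of 0 v 0 0] v by simp
  finally show ?thesis using v by simp
qed

text \<open>\<open>lower_argmin\<close> is a choice operator, so its value means nothing before a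
  minimizer is known to exist; strong convexity on a closed set provides one.\<close>

lemma ystar_mem: "ystar x \<in> Y"
proof -
  obtain y' where y': "y' \<in> Y" "\<And>z. z \<in> Y \<Longrightarrow> g x y' \<le> g x z"
    using strongly_convex_attains_inf[OF strong lam_pos grad_gy Y(2,3)] by blast
  have "is_arg_min (g x) (\<lambda>y. y \<in> Y) (ystar x)"
    unfolding lower_argmin_def arg_min_on_def arg_min_def
    by (rule someI[of _ y']) (use y' in \<open>auto simp: is_arg_min_linorder\<close>)
  then show ?thesis by (simp add: is_arg_min_linorder)
qed

definition Lstar where "Lstar = Lgy / lam"

lemma Lstar_nonneg: "0 \<le> Lstar"
  unfolding Lstar_def using lam_pos constants_nonneg by simp

text \<open>Strong monotonicity of \<open>gy x\<close> is applied between the two minimizers. Since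
  \<open>gy x (ystar x)\<close> and \<open>gy x' (ystar x')\<close> both vanish, what remains is the
  change of \<open>gy\<close> in its first argument alone.\<close>

lemma ystar_lipschitz: "norm (ystar x' - ystar x) \<le> Lstar * norm (x' - x)"
proof (cases "ystar x' = ystar x")
  case False
  let ?b = "ystar x' - ystar x"
  have "lam * (norm ?b)\<^sup>2 \<le> ?b \<bullet> (gy x (ystar x') - gy x (ystar x))" by (rule gy_monotone)
  also have "\<dots> = ?b \<bullet> (gy x (ystar x') - gy x' (ystar x'))" by (simp add: inactive)
  also have "\<dots> \<le> norm ?b * norm (gy x (ystar x') - gy x' (ystar x'))"
    by (rule norm_cauchy_schwarz)
  also have "\<dots> \<le> norm ?b * (Lgy * norm (x' - x))"
    using gy_lipschitz[of x "ystar x'" x' "ystar x'"]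
    by (intro mult_left_mono) (auto simp: norm_minus_commute)
  finally have "norm ?b * (lam * norm ?b) \<le> norm ?b * (Lgy * norm (x' - x))"
    by (simp add: power2_eq_square mult_ac)
  then have "lam * norm ?b \<le> Lgy * norm (x' - x)"
    using False by (simp only: mult_le_cancel_left zero_less_norm_iff) simp
  then show ?thesis unfolding Lstar_def using lam_pos by (simp add: field_simps)
qed (simp add: Lstar_nonneg)

text \<open>Coercivity and Cauchy-Schwarz. This is the operator norm bound \<open>1 / lam\<close>
  for the inverse Hessian, phrased without the inverse.\<close>

lemma norm_le_of_gyy: "norm v \<le> norm (gyy x y *v v) / lam"
proof (cases "v = 0")
  case False
  have "lam * (norm v)\<^sup>2 \<le> norm v * norm (gyy x y *v v)"
    using gyy_lower[of v x y] norm_cauchy_schwarz[of v "gyy x y *v v"] by linarith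
  then have "norm v * (lam * norm v) \<le> norm v * norm (gyy x y *v v)"
    by (simp add: power2_eq_square mult_ac)
  then have "lam * norm v \<le> norm (gyy x y *v v)"
    using False by (simp only: mult_le_cancel_left zero_less_norm_iff) simp
  then show ?thesis using lam_pos by (simp add: field_simps)
qed simp

text \<open>The inverse of \<open>gyy x y\<close> applied to \<open>fy x y\<close>, which is the
  adjoint vector of implicit differentiation. The choice is justified by \<open>gyy_invq\<close>:
  the Hessian is injective, hence surjective in finite dimension.\<close>

definition invq :: "real^'d \<Rightarrow> real^'e \<Rightarrow> real^'e" where
  "invq x y = (SOME q. gyy x y *v q = fy x y)"

lemma gyy_invq: "gyy x y *v invq x y = fy x y"
proof -
  have "inj ((*v) (gyy x y))"
  proof (rule injI)
    fix u v assume "gyy x y *v u = gyy x y *v v"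
    then have "norm (u - v) \<le> 0"
      using norm_le_of_gyy[of "u - v" x y] by (simp add: matrix_vector_mult_diff_distrib)
    then show "u = v" by simp
  qed
  then have "surj ((*v) (gyy x y))" by (intro linear_injective_imp_surjective) auto
  then obtain q where "gyy x y *v q = fy x y" by (metis surjD)
  then show ?thesis unfolding invq_def by (rule someI)
qed

lemma norm_invq_le: "norm (invq x y) \<le> Cfy / lam"
  using norm_le_of_gyy[of "invq x y" x y] bound_fy[of x y] lam_pos
  by (simp add: gyy_invq) (meson divide_right_mono less_imp_le order_trans)

definition Lq where "Lq = (Lfy + Lgyy * (Cfy / lam)) / lam"

lemma Lq_nonneg: "0 \<le> Lq"
  unfolding Lq_def using lam_pos constants_nonneg by simp

lemma invq_lipschitz: "norm (invq x y - invq x' y') \<le> Lq * dist (x, y) (x', y')"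
proof -
  let ?D = "dist (x, y) (x', y')"
  \<comment> \<open>The difference of the two linear systems, with the change of the matrix charged
    to the bounded solution \<open>invq x' y'\<close>.\<close>
  have eq: "gyy x y *v (invq x y - invq x' y')
      = (fy x y - fy x' y') - (gyy x y - gyy x' y') *v invq x' y'"
    by (simp add: matrix_vector_mult_diff_distrib matrix_vector_mult_diff_rdistrib gyy_invq)
  have "norm (gyy x y *v (invq x y - invq x' y')) \<le> Lfy * ?D + Lgyy * ?D * (Cfy / lam)"
    unfolding eq by (intro norm_triangle_le_diff add_mono fy_lipschitz norm_mult_vec_le
        gyy_lipschitz norm_invq_le)
  then have "norm (gyy x y *v (invq x y - invq x' y')) / lam
      \<le> (Lfy * ?D + Lgyy * ?D * (Cfy / lam)) / lam"
    using lam_pos by (intro divide_right_mono) auto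
  also have "\<dots> = Lq * ?D" unfolding Lq_def using lam_pos by (simp add: field_simps)
  finally show ?thesis using norm_le_of_gyy[of "invq x y - invq x' y'" x y] by linarith
qed

section \<open>The gradient formula and the first-order expansion of the objective\<close>

definition \<Phi> :: "real^'d \<Rightarrow> real^'e \<Rightarrow> real^'d" where
  "\<Phi> x y = fx x y - gxy x y *v invq x y"

definition L\<Phi> where "L\<Phi> = Lfx + Cgxy * Lq + Lgxy * (Cfy / lam)"

lemma L\<Phi>_nonneg: "0 \<le> L\<Phi>"
  unfolding L\<Phi>_def using lam_pos constants_nonneg Lq_nonneg by simp

lemma \<Phi>_lipschitz: "norm (\<Phi> x y - \<Phi> x' y') \<le> L\<Phi> * dist (x, y) (x', y')"
proof -
  let ?D = "dist (x, y) (x', y')"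
  have eq: "\<Phi> x y - \<Phi> x' y' = (fx x y - fx x' y')
      - (gxy x y *v (invq x y - invq x' y') + (gxy x y - gxy x' y') *v invq x' y')"
    unfolding \<Phi>_def
    by (simp add: matrix_vector_mult_diff_distrib matrix_vector_mult_diff_rdistrib)
  have "norm (\<Phi> x y - \<Phi> x' y') \<le> Lfx * ?D + (Cgxy * (Lq * ?D) + Lgxy * ?D * (Cfy / lam))"
    unfolding eq by (intro norm_triangle_le_diff norm_triangle_le add_mono fx_lipschitz norm_mult_vec_le
        gxy_lipschitz invq_lipschitz norm_invq_le bound_gxy)
  also have "\<dots> = L\<Phi> * ?D" unfolding L\<Phi>_def by (simp add: algebra_simps)
  finally show ?thesis .
qed

definition DF where "DF x = \<Phi> x (ystar x)"

definition LF where "LF = L\<Phi> * (1 + Lstar)"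

lemma LF_nonneg: "0 \<le> LF"
  unfolding LF_def using L\<Phi>_nonneg Lstar_nonneg by simp

lemma DF_lipschitz: "norm (DF x' - DF x) \<le> LF * norm (x' - x)"
proof -
  have "dist (x', ystar x') (x, ystar x) \<le> norm (x' - x) + norm (ystar x' - ystar x)"
    unfolding dist_norm diff_Pair by (rule norm_Pair_le)
  also have "\<dots> \<le> (1 + Lstar) * norm (x' - x)"
    using ystar_lipschitz[of x' x] by (simp add: algebra_simps)
  finally have "L\<Phi> * dist (x', ystar x') (x, ystar x) \<le> L\<Phi> * ((1 + Lstar) * norm (x' - x))"
    by (intro mult_left_mono L\<Phi>_nonneg)
  then show ?thesis unfolding DF_def LF_def using \<Phi>_lipschitz[of x' "ystar x'" x "ystar x"]
    by (simp add: mult.assoc)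
qed

text \<open>The six remainder constants of the expansion below: three from \<open>f\<close>, and
  three from \<open>gy\<close> multiplied by the bound \<open>Cfy / lam\<close> on the adjoint
  vector. The condition on \<open>\<eta>x\<close> uses it in the role of a smoothness
  constant.\<close>

definition KF where
  "KF = Lfx * (1 + Lstar) + Lfy * Lstar\<^sup>2 + (Lgxy * (1 + Lstar) + Lgyy * Lstar\<^sup>2) * (Cfy / lam)"

lemma KF_nonneg: "0 \<le> KF"
  unfolding KF_def using lam_pos constants_nonneg Lstar_nonneg by simp

abbreviation "F \<equiv> bilevel_objective f g Y"

text \<open>Both \<open>f\<close> and \<open>gy\<close> are moved in two legs, from \<open>x\<close>
  to \<open>x'\<close> at \<open>y'\<close> and from \<open>y\<close> to \<open>y'\<close> at
  \<open>x\<close>. The term \<open>b \<bullet> fy x y\<close> contains the unknown displacement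
  \<open>b\<close> of the minimizer; writing \<open>fy x y\<close> as \<open>gyy x y *v q\<close>,
  the linearized stationarity equation expresses it through \<open>a\<close> up to second order.
  About \<open>ystar\<close> only its Lipschitz continuity enters.\<close>

lemma objective_quadratic_remainder:
  "\<bar>F x' - F x - (x' - x) \<bullet> DF x\<bar> \<le> KF * (norm (x' - x))\<^sup>2"
proof -
  define a where "a = x' - x"
  define y where "y = ystar x"
  define y' where "y' = ystar x'"
  define b where "b = y' - y"
  define q where "q = invq x y"
  have b: "norm b \<le> Lstar * norm a" unfolding a_def b_def y_def y'_def by (rule ystar_lipschitz)
  then have b2: "(norm b)\<^sup>2 \<le> (Lstar * norm a)\<^sup>2" by (rule power_mono) simp
  \<comment> \<open>\<open>r1\<close> and \<open>r3\<close> are the remainders of the two legs for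
    \<open>f\<close>, and \<open>r2\<close> is the price for evaluating \<open>fx\<close> at
    \<open>y\<close> rather than \<open>y'\<close>. \<open>R1\<close>, \<open>R3\<close> and
    \<open>R2\<close> play the same parts for \<open>gy\<close>.\<close>
  define r1 where "r1 = f x' y' - f x y' - a \<bullet> fx x y'"
  define r2 where "r2 = a \<bullet> (fx x y' - fx x y)"
  define r3 where "r3 = f x y' - f x y - b \<bullet> fy x y"
  define R1 where "R1 = gy x' y' - gy x y' - transpose (gxy x y') *v a"
  define R2 where "R2 = transpose (gxy x y' - gxy x y) *v a"
  define R3 where "R3 = gy x y' - gy x y - gyy x y *v b"
  have r1: "\<bar>r1\<bar> \<le> Lfx * (norm a)\<^sup>2"
    unfolding r1_def a_def
    by (rule lipschitz_gradient_remainder[OF grad_fx])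
       (use fx_lipschitz[of _ y' x y'] constants_nonneg in auto)
  have r3: "\<bar>r3\<bar> \<le> Lfy * (norm b)\<^sup>2"
    unfolding r3_def b_def
    by (rule lipschitz_gradient_remainder[OF grad_fy])
       (use fy_lipschitz[of x _ x y] constants_nonneg in auto)
  have "\<bar>r2\<bar> \<le> norm a * norm (fx x y' - fx x y)" unfolding r2_def by (rule Cauchy_Schwarz_ineq2)
  also have "\<dots> \<le> norm a * (Lfx * (Lstar * norm a))"
    using fx_lipschitz[of x y' x y] mult_left_mono[OF b constants_nonneg(1)]
    by (intro mult_left_mono) (auto simp: b_def)
  finally have r2: "\<bar>r2\<bar> \<le> Lfx * Lstar * (norm a)\<^sup>2" by (simp add: power2_eq_square mult_ac)
  have R1: "norm R1 \<le> Lgxy * (norm a)\<^sup>2"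
    unfolding R1_def a_def
  proof (rule lipschitz_derivative_remainder[OF hess_gxy])
    show "norm (transpose (gxy z y') *v h - transpose (gxy x y') *v h)
        \<le> Lgxy * norm (z - x) * norm h" for z h
    proof -
      have "transpose (gxy z y') *v h - transpose (gxy x y') *v h
          = transpose (gxy z y' - gxy x y') *v h"
        by (simp add: vector_matrix_mult_diff_rdistrib)
      also have "norm \<dots> \<le> spectral_norm (gxy z y' - gxy x y') * norm h" by (rule norm_transpose_mult_le)
      also have "\<dots> \<le> Lgxy * norm (z - x) * norm h"
        using gxy_lipschitz[of z y' x y'] by (intro mult_right_mono) auto
      finally show ?thesis .
    qed
  qed (rule constants_nonneg)
  have R3: "norm R3 \<le> Lgyy * (norm b)\<^sup>2"
    unfolding R3_def b_def
  proof (rule lipschitz_derivative_remainder[OF hess_gyy])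
    show "norm (gyy x z *v h - gyy x y *v h) \<le> Lgyy * norm (z - y) * norm h" for z h
      using norm_mult_vec_le[OF gyy_lipschitz[of x z x y], of h "norm h"]
      by (simp add: matrix_vector_mult_diff_rdistrib)
  qed (rule constants_nonneg)
  have "norm R2 \<le> spectral_norm (gxy x y' - gxy x y) * norm a"
    unfolding R2_def by (rule norm_transpose_mult_le)
  also have "\<dots> \<le> Lgxy * (Lstar * norm a) * norm a"
    using gxy_lipschitz[of x y' x y] mult_left_mono[OF b constants_nonneg(4)]
    by (intro mult_right_mono) (auto simp: b_def)
  finally have R2: "norm R2 \<le> Lgxy * Lstar * (norm a)\<^sup>2" by (simp add: power2_eq_square mult_ac)
  \<comment> \<open>implicit differentiation of \<open>gy x (ystar x) = 0\<close>\<close>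
  have "gyy x y *v b = - (transpose (gxy x y) *v a) - (R1 + R2 + R3)"
    using inactive[of x] inactive[of x'] unfolding R1_def R2_def R3_def y_def y'_def
    by (simp add: vector_matrix_mult_diff_rdistrib algebra_simps)
  \<comment> \<open>Symmetry of the Hessian lets it act on \<open>b\<close>, where the stationarity
    equation is available, instead of on \<open>q\<close>.\<close>
  moreover have "b \<bullet> fy x y = (gyy x y *v b) \<bullet> q"
    using inner_transpose_mult[of b "gyy x y" q] by (simp only: gyy_sym q_def gyy_invq)
  ultimately have "b \<bullet> fy x y = - ((transpose (gxy x y) *v a) \<bullet> q) - (R1 + R2 + R3) \<bullet> q"
    by (simp only: inner_diff_left inner_minus_left)
  then have bfy: "b \<bullet> fy x y = - (a \<bullet> (gxy x y *v q)) - (R1 + R2 + R3) \<bullet> q"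
    by (simp only: inner_transpose_mult)
  have "F x' - F x - a \<bullet> DF x = r1 + r2 + r3 - (R1 + R2 + R3) \<bullet> q"
    using bfy unfolding r1_def r2_def r3_def DF_def \<Phi>_def bilevel_objective_def
      y_def[symmetric] y'_def[symmetric] q_def[symmetric]
    by (simp add: inner_diff_right)
  moreover have "\<bar>(R1 + R2 + R3) \<bullet> q\<bar>
      \<le> (Lgxy * (norm a)\<^sup>2 + Lgxy * Lstar * (norm a)\<^sup>2 + Lgyy * (Lstar * norm a)\<^sup>2) * (Cfy / lam)"
  proof -
    have "norm (R1 + R2 + R3)
        \<le> Lgxy * (norm a)\<^sup>2 + Lgxy * Lstar * (norm a)\<^sup>2 + Lgyy * (Lstar * norm a)\<^sup>2"
      using R3 mult_left_mono[OF b2 constants_nonneg(5)]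
      by (intro norm_triangle_le add_mono R1 R2) linarith
    moreover have "\<bar>(R1 + R2 + R3) \<bullet> q\<bar> \<le> norm (R1 + R2 + R3) * norm q" by (rule Cauchy_Schwarz_ineq2)
    moreover have "norm q \<le> Cfy / lam" unfolding q_def by (rule norm_invq_le)
    ultimately show ?thesis by (meson mult_mono norm_ge_zero order_trans)
  qed
  moreover have "\<bar>r3\<bar> \<le> Lfy * (Lstar * norm a)\<^sup>2"
    using r3 mult_left_mono[OF b2 constants_nonneg(2)] by linarith
  ultimately have "\<bar>F x' - F x - a \<bullet> DF x\<bar>
      \<le> Lfx * (norm a)\<^sup>2 + Lfx * Lstar * (norm a)\<^sup>2 + Lfy * (Lstar * norm a)\<^sup>2
      + (Lgxy * (norm a)\<^sup>2 + Lgxy * Lstar * (norm a)\<^sup>2 + Lgyy * (Lstar * norm a)\<^sup>2) * (Cfy / lam)"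
    using r1 r2 by linarith
  also have "\<dots> = KF * (norm a)\<^sup>2" unfolding KF_def by (simp add: power_mult_distrib algebra_simps)
  finally show ?thesis by (simp add: a_def)
qed

lemma objective_has_gradient: "GDERIV F x :> DF x"
  by (rule GDERIV_of_quadratic_remainder) (rule objective_quadratic_remainder)

lemma grad_objective: "grad F x = DF x"
  by (rule grad_eqI) (rule objective_has_gradient)

end

section \<open>Independent draws\<close>

lemma integrable_norm_of_square:
  fixes h :: "'a \<Rightarrow> 'b::{banach, second_countable_topology}"
  assumes "finite_measure M" "h \<in> borel_measurable M" "integrable M (\<lambda>w. (norm (h w))\<^sup>2)"
  shows "integrable M h"
proof (rule Bochner_Integration.integrable_bound[where f = "\<lambda>w. 1 + (norm (h w))\<^sup>2"])
  show "integrable M (\<lambda>w. 1 + (norm (h w))\<^sup>2)"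
    by (intro Bochner_Integration.integrable_add finite_measure.integrable_const assms)
  show "AE w in M. norm (h w) \<le> norm (1 + (norm (h w))\<^sup>2)"
  proof (rule AE_I2)
    fix w
    have "0 \<le> (norm (h w) - 1)\<^sup>2" by simp
    then have "2 * norm (h w) \<le> 1 + (norm (h w))\<^sup>2" by (simp add: power2_eq_square algebra_simps)
    moreover have "0 \<le> norm (h w)" by simp
    ultimately show "norm (h w) \<le> norm (1 + (norm (h w))\<^sup>2)" by (simp only: real_norm_def)
  qed
qed (use assms in auto)

locale smb_draws =
  fixes M :: "'w measure" and S :: "'s measure" and k :: "nat \<Rightarrow> nat"
    and \<xi> :: "oracle_call \<Rightarrow> 'w \<Rightarrow> 's" and p :: "nat \<Rightarrow> 'w \<Rightarrow> nat"
  assumes sampling: "smb_sampling M S k \<xi> p"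
    and k_pos: "\<And>t. 0 < k t"
begin

sublocale prob_space M
  using sampling by (simp add: smb_sampling_def)

lemma measurable_seed: "\<xi> c \<in> measurable M S"
  and distr_seed: "distr M S (\<xi> c) = S"
  and measurable_length: "p r \<in> measurable M (count_space UNIV)"
  and distr_length: "distr M (count_space UNIV) (p r) = measure_pmf (pmf_of_set {0..<k (r - 1)})"
  using sampling unfolding smb_sampling_def by blast+

lemma seed_in_space: "w \<in> space M \<Longrightarrow> \<xi> c w \<in> space S"
  by (rule measurable_space[OF measurable_seed])

section \<open>Events and sigma-algebras generated by groups of draws\<close>

definition draw_events :: "oracle_call + nat \<Rightarrow> 'w set set" where
  "draw_events = case_sum (\<lambda>c. {\<xi> c -` A \<inter> space M | A. A \<in> sets S})
                   (\<lambda>r. {p r -` A \<inter> space M | A. A \<in> UNIV})"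

text \<open>\<open>Inl\<close> indexes oracle seeds and \<open>Inr\<close> random lengths.
  Measurability with respect to \<open>draw_algebra J\<close> expresses that a quantity depends on
  the draws in \<open>J\<close> only; no conditional expectation is introduced.\<close>

definition draw_algebra :: "(oracle_call + nat) set \<Rightarrow> 'w measure" where
  "draw_algebra J = sigma (space M) (\<Union>j\<in>J. draw_events j)"

lemma draw_events_sets: "draw_events j \<subseteq> events"
  unfolding draw_events_def
  using measurable_seed measurable_length
  by (auto split: sum.split intro: measurable_sets)

lemma space_draw_algebra [simp]: "space (draw_algebra J) = space M"
  unfolding draw_algebra_def by (simp add: space_measure_of_conv)

lemma sets_draw_algebra: "sets (draw_algebra J) = sigma_sets (space M) (\<Union>j\<in>J. draw_events j)"
  unfolding draw_algebra_def
  using draw_events_sets sets.space_closed by (intro sets_measure_of) blast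

lemma draw_algebra_le: "sets (draw_algebra J) \<subseteq> events"
  unfolding sets_draw_algebra using draw_events_sets by (intro sets.sigma_sets_subset) auto

lemma draw_algebra_mono: "J \<subseteq> J' \<Longrightarrow> sets (draw_algebra J) \<subseteq> sets (draw_algebra J')"
  unfolding sets_draw_algebra by (intro sigma_sets_mono') auto

lemma measurable_draw_mono:
  "X \<in> measurable (draw_algebra J) N \<Longrightarrow> J \<subseteq> J' \<Longrightarrow> X \<in> measurable (draw_algebra J') N"
  using draw_algebra_mono[of J J'] by (auto simp: measurable_def)

lemma measurable_drawD:
  "X \<in> measurable (draw_algebra J) N \<Longrightarrow> X \<in> measurable M N"
  using draw_algebra_le[of J] by (auto simp: measurable_def)

lemma measurable_draw_seed: "Inl c \<in> J \<Longrightarrow> \<xi> c \<in> measurable (draw_algebra J) S"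
  using measurable_space[OF measurable_seed]
  by (intro measurableI, simp, unfold sets_draw_algebra, intro sigma_sets.Basic UN_I[of "Inl c"])
     (auto simp: draw_events_def)

lemma measurable_draw_length: "Inr r \<in> J \<Longrightarrow> p r \<in> measurable (draw_algebra J) (count_space UNIV)"
  by (intro measurableI, simp, unfold sets_draw_algebra, intro sigma_sets.Basic UN_I[of "Inr r"])
     (auto simp: draw_events_def)

text \<open>Preimages under one draw form an intersection-stable family, so independence of the
  families passes to the sigma-algebras generated by disjoint groups of them.\<close>

lemma indep_draw_algebras:
  assumes "J1 \<inter> J2 = {}"
  shows "indep_set (sets (draw_algebra J1)) (sets (draw_algebra J2))"
proof -
  have "indep_sets draw_events UNIV"
    using sampling unfolding smb_sampling_def draw_events_def by simp
  then have ind: "indep_sets draw_events (\<Union>b\<in>UNIV. case_bool J1 J2 b)"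
    by (rule indep_sets_mono_index[rotated]) simp
  have "indep_sets (\<lambda>b. sigma_sets (space M) (\<Union>j\<in>case_bool J1 J2 b. draw_events j)) UNIV"
  proof (rule indep_sets_collect_sigma[OF ind])
    show "disjoint_family (case_bool J1 J2)"
      using assms by (auto simp: disjoint_family_on_def split: bool.split)
    fix j
    have "Int_stable {X -` A \<inter> space M | A. A \<in> sets N}" for X :: "'w \<Rightarrow> 'b" and N
    proof (rule Int_stableI, clarsimp)
      fix A B assume "A \<in> sets N" "B \<in> sets N"
      then show "\<exists>C. X -` A \<inter> space M \<inter> (X -` B \<inter> space M) = X -` C \<inter> space M \<and> C \<in> sets N"
        by (intro exI[of _ "A \<inter> B"]) auto
    qed
    note Int_stable_vimage = this
    show "Int_stable (draw_events j)"
    proof (cases j)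
      case (Inl c)
      then show ?thesis using Int_stable_vimage[of "\<xi> c" S] by (simp add: draw_events_def)
    next
      case (Inr r)
      then show ?thesis
        using Int_stable_vimage[of "p r" "count_space UNIV"] by (simp add: draw_events_def)
    qed
  qed
  then show ?thesis
    unfolding indep_set_def sets_draw_algebra by (rule indep_sets_mono_sets) (auto split: bool.split)
qed

text \<open>Evaluating \<open>h (X \<omega>) \<omega>\<close>, where \<open>X\<close> and the second argument of \<open>h\<close> use disjoint sets of draws, is
  integration against a product measure. The following lemmas are Fubini's theorem for it.\<close>

lemma distr_freeze:
  assumes X: "X \<in> measurable (draw_algebra J1) N" and J: "J1 \<inter> J2 = {}"
  shows "distr M (N \<Otimes>\<^sub>M draw_algebra J2) (\<lambda>w. (X w, w))
    = distr M N X \<Otimes>\<^sub>M distr M (draw_algebra J2) (\<lambda>w. w)"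
proof -
  have XM: "X \<in> measurable M N" using X by (rule measurable_drawD)
  \<comment> \<open>\<open>draw_algebra J2\<close> is coarser than \<open>M\<close>, so the identity
    is measurable and its distribution is the restriction of \<open>M\<close> to that
    sigma-algebra.\<close>
  have idM: "(\<lambda>w. w) \<in> measurable M (draw_algebra J2)"
    by (rule measurable_drawD[of _ J2]) simp
  interpret P: prob_space "distr M N X" by (rule prob_space_distr[OF XM])
  interpret Q: prob_space "distr M (draw_algebra J2) (\<lambda>w. w)" by (rule prob_space_distr[OF idM])
  have XI: "(\<lambda>w. (X w, w)) \<in> measurable M (N \<Otimes>\<^sub>M draw_algebra J2)" using XM idM by simp
  have "distr M N X \<Otimes>\<^sub>M distr M (draw_algebra J2) (\<lambda>w. w)
      = distr M (N \<Otimes>\<^sub>M draw_algebra J2) (\<lambda>w. (X w, w))"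
  proof (rule pair_measure_eqI)
    fix A B assume "A \<in> sets (distr M N X)" "B \<in> sets (distr M (draw_algebra J2) (\<lambda>w. w))"
    then have A: "A \<in> sets N" and B: "B \<in> sets (draw_algebra J2)" by simp_all
    have "X -` A \<inter> space M \<in> sets (draw_algebra J1)" using measurable_sets[OF X A] by simp
    then have "prob ((X -` A \<inter> space M) \<inter> B) = prob (X -` A \<inter> space M) * prob B"
      using indep_setD[OF indep_draw_algebras[OF J]] B by blast
    moreover have "(\<lambda>w. (X w, w)) -` (A \<times> B) \<inter> space M = (X -` A \<inter> space M) \<inter> B"
      using sets.sets_into_space[OF B] by auto
    moreover have "(\<lambda>w. w) -` B \<inter> space M = B"
      using sets.sets_into_space[OF B] by auto
    ultimately show "emeasure (distr M N X) A * emeasure (distr M (draw_algebra J2) (\<lambda>w. w)) B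
        = emeasure (distr M (N \<Otimes>\<^sub>M draw_algebra J2) (\<lambda>w. (X w, w))) (A \<times> B)"
      using A B by (simp add: emeasure_distr[OF XM] emeasure_distr[OF idM] emeasure_distr[OF XI]
          emeasure_eq_measure ennreal_mult)
  qed (simp_all add: P.sigma_finite_measure_axioms Q.sigma_finite_measure_axioms
        sets_pair_measure_cong[of "distr M N X" N "distr M (draw_algebra J2) (\<lambda>w. w)" "draw_algebra J2"])
  then show ?thesis by simp
qed

lemma freeze_nn_integral:
  fixes h :: "'n \<Rightarrow> 'w \<Rightarrow> ennreal"
  assumes X: "X \<in> measurable (draw_algebra J1) N" and J: "J1 \<inter> J2 = {}"
    and h: "case_prod h \<in> borel_measurable (N \<Otimes>\<^sub>M draw_algebra J2)"
  shows "(\<integral>\<^sup>+ w. h (X w) w \<partial>M) = (\<integral>\<^sup>+ w. (\<integral>\<^sup>+ w'. h (X w) w' \<partial>M) \<partial>M)"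
proof -
  let ?P = "distr M N X" and ?Q = "distr M (draw_algebra J2) (\<lambda>w. w)"
  have XM: "X \<in> measurable M N" using X by (rule measurable_drawD)
  have idM: "(\<lambda>w. w) \<in> measurable M (draw_algebra J2)"
    by (rule measurable_drawD[of _ J2]) simp
  interpret P: prob_space ?P by (rule prob_space_distr[OF XM])
  interpret Q: prob_space ?Q by (rule prob_space_distr[OF idM])
  have sec: "h x \<in> borel_measurable (draw_algebra J2)" if "x \<in> space N" for x
    using measurable_Pair2[OF h that] by simp
  have hPQ: "case_prod h \<in> borel_measurable (?P \<Otimes>\<^sub>M ?Q)"
    using h by (simp cong: measurable_cong_sets add: sets_pair_measure_cong[of ?P N ?Q "draw_algebra J2"])
  have inner: "(\<lambda>x. \<integral>\<^sup>+ w'. h x w' \<partial>?Q) \<in> borel_measurable N"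
    using Q.borel_measurable_nn_integral_fst[OF hPQ] by simp
  have "(\<integral>\<^sup>+ w. h (X w) w \<partial>M) = (\<integral>\<^sup>+ z. case_prod h z \<partial>distr M (N \<Otimes>\<^sub>M draw_algebra J2) (\<lambda>w. (X w, w)))"
    using XM idM h by (subst nn_integral_distr) auto
  also have "\<dots> = (\<integral>\<^sup>+ x. (\<integral>\<^sup>+ w'. h x w' \<partial>?Q) \<partial>?P)"
    unfolding distr_freeze[OF X J] using Q.nn_integral_fst[OF hPQ] by simp
  also have "\<dots> = (\<integral>\<^sup>+ w. (\<integral>\<^sup>+ w'. h (X w) w' \<partial>?Q) \<partial>M)"
    by (rule nn_integral_distr[OF XM]) (simp add: inner)
  also have "\<dots> = (\<integral>\<^sup>+ w. (\<integral>\<^sup>+ w'. h (X w) w' \<partial>M) \<partial>M)"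
    using measurable_space[OF XM] sec by (intro nn_integral_cong nn_integral_distr[OF idM]) simp
  finally show ?thesis .
qed

lemma freeze_integral:
  fixes h :: "'n \<Rightarrow> 'w \<Rightarrow> 'b::{banach, second_countable_topology}"
  assumes X: "X \<in> measurable (draw_algebra J1) N" and J: "J1 \<inter> J2 = {}"
    and h: "case_prod h \<in> borel_measurable (N \<Otimes>\<^sub>M draw_algebra J2)"
    and int: "integrable M (\<lambda>w. h (X w) w)"
  shows "(LINT w|M. h (X w) w) = (LINT w|M. (LINT w'|M. h (X w) w'))"
proof -
  let ?P = "distr M N X" and ?Q = "distr M (draw_algebra J2) (\<lambda>w. w)"
  have XM: "X \<in> measurable M N" using X by (rule measurable_drawD)
  have idM: "(\<lambda>w. w) \<in> measurable M (draw_algebra J2)"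
    by (rule measurable_drawD[of _ J2]) simp
  have XI: "(\<lambda>w. (X w, w)) \<in> measurable M (N \<Otimes>\<^sub>M draw_algebra J2)" using XM idM by simp
  interpret P: prob_space ?P by (rule prob_space_distr[OF XM])
  interpret Q: prob_space ?Q by (rule prob_space_distr[OF idM])
  interpret PQ: pair_sigma_finite ?P ?Q ..
  have sec: "h x \<in> borel_measurable (draw_algebra J2)" if "x \<in> space N" for x
    using measurable_Pair2[OF h that] by simp
  have intPQ: "integrable (?P \<Otimes>\<^sub>M ?Q) (case_prod h)"
    unfolding distr_freeze[OF X J, symmetric] integrable_distr_eq[OF XI h] using int by simp
  have inner: "(\<lambda>x. LINT w'|?Q. h x w') \<in> borel_measurable N"
    using Q.borel_measurable_lebesgue_integral[of h ?P] borel_measurable_integrable[OF intPQ]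
    by simp
  have "(LINT w|M. h (X w) w) = (LINT z|distr M (N \<Otimes>\<^sub>M draw_algebra J2) (\<lambda>w. (X w, w)). case_prod h z)"
    by (subst integral_distr[OF XI h]) simp
  also have "\<dots> = (LINT x|?P. (LINT w'|?Q. h x w'))"
    unfolding distr_freeze[OF X J] using PQ.integral_fst'[OF intPQ] by simp
  also have "\<dots> = (LINT w|M. (LINT w'|?Q. h (X w) w'))"
    by (rule integral_distr[OF XM]) (simp add: inner)
  also have "\<dots> = (LINT w|M. (LINT w'|M. h (X w) w'))"
    using measurable_space[OF XM] sec
    by (intro Bochner_Integration.integral_cong refl integral_distr[OF idM]) simp
  finally show ?thesis .
qed

text \<open>For a nonnegative integrand Tonelli applies before integrability is known, and the
  sectionwise bound \<open>U\<close> then yields integrability of the composed quantity. This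
  carries second moments through nested products and from one iteration to the next.\<close>

lemma freeze_bound:
  fixes h :: "'n \<Rightarrow> 'w \<Rightarrow> real"
  assumes X: "X \<in> measurable (draw_algebra J1) N" and J: "J1 \<inter> J2 = {}"
    and h: "case_prod h \<in> borel_measurable (N \<Otimes>\<^sub>M draw_algebra J2)"
    and nonneg: "\<And>x w. 0 \<le> h x w"
    and sec: "\<And>x. x \<in> space N \<Longrightarrow> integrable M (h x)" "\<And>x. x \<in> space N \<Longrightarrow> (LINT w|M. h x w) \<le> U x"
    and U: "integrable M (\<lambda>w. U (X w))"
  shows "integrable M (\<lambda>w. h (X w) w)" "(LINT w|M. h (X w) w) \<le> (LINT w|M. U (X w))"
proof -
  have XM: "X \<in> measurable M N" using X by (rule measurable_drawD)
  have idM: "(\<lambda>w. w) \<in> measurable M (draw_algebra J2)"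
    by (rule measurable_drawD[of _ J2]) simp
  have XI: "(\<lambda>w. (X w, w)) \<in> measurable M (N \<Otimes>\<^sub>M draw_algebra J2)" using XM idM by simp
  have meas: "(\<lambda>w. h (X w) w) \<in> borel_measurable M"
    using measurable_compose[OF XI h] by simp
  have Unn: "0 \<le> U (X w)" if "w \<in> space M" for w
    using sec(2)[OF measurable_space[OF XM that]] nonneg
      Bochner_Integration.integral_nonneg[of M "h (X w)"] by (meson order_trans)
  have "(\<integral>\<^sup>+ w. ennreal (h (X w) w) \<partial>M) = (\<integral>\<^sup>+ w. (\<integral>\<^sup>+ w'. ennreal (h (X w) w') \<partial>M) \<partial>M)"
    using h by (intro freeze_nn_integral[OF X J, of "\<lambda>x w. ennreal (h x w)"])
      (simp add: case_prod_unfold)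
  also have "\<dots> \<le> (\<integral>\<^sup>+ w. ennreal (U (X w)) \<partial>M)"
    using sec nonneg measurable_space[OF XM]
    by (intro nn_integral_mono) (simp add: nn_integral_eq_integral ennreal_leI)
  also have "\<dots> = ennreal (LINT w|M. U (X w))"
    using Unn by (intro nn_integral_eq_integral U AE_I2)
  finally have le: "(\<integral>\<^sup>+ w. ennreal (h (X w) w) \<partial>M) \<le> ennreal (LINT w|M. U (X w))" .
  then show int: "integrable M (\<lambda>w. h (X w) w)"
    using meas nonneg by (intro integrableI_bounded) (auto intro: le_less_trans)
  have "ennreal (LINT w|M. h (X w) w) \<le> ennreal (LINT w|M. U (X w))"
    using le nn_integral_eq_integral[OF int] nonneg by simp
  moreover have "0 \<le> (LINT w|M. U (X w))" using Unn by (intro integral_nonneg_AE AE_I2)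
  ultimately show "(LINT w|M. h (X w) w) \<le> (LINT w|M. U (X w))" by simp
qed

section \<open>Expectations of a single draw\<close>

lemma seed_integrable:
  fixes \<phi> :: "'s \<Rightarrow> 'b::{banach, second_countable_topology}"
  assumes "integrable S \<phi>"
  shows "integrable M (\<lambda>w. \<phi> (\<xi> c w))"
  using assms integrable_distr[OF measurable_seed, of c \<phi>] by (simp add: distr_seed)

lemma seed_integral:
  fixes \<phi> :: "'s \<Rightarrow> 'b::{banach, second_countable_topology}"
  assumes "integrable S \<phi>"
  shows "(LINT w|M. \<phi> (\<xi> c w)) = (LINT s|S. \<phi> s)"
  using integral_distr[OF measurable_seed, of \<phi> c] assms by (simp add: distr_seed)

lemma length_integral:
  fixes \<phi> :: "nat \<Rightarrow> 'b::{banach, second_countable_topology}"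
  shows "integrable M (\<lambda>w. \<phi> (p r w))"
    "(LINT w|M. \<phi> (p r w)) = (1 / real (k (r - 1))) *\<^sub>R (\<Sum>n<k (r - 1). \<phi> n)"
proof -
  let ?P = "pmf_of_set {0..<k (r - 1)}"
  have ne: "{0..<k (r - 1)} \<noteq> {}" using k_pos by simp
  have "integrable (measure_pmf ?P) \<phi>"
    using ne by (intro integrable_measure_pmf_finite) simp
  then show "integrable M (\<lambda>w. \<phi> (p r w))"
    using integrable_distr[OF measurable_length, of r \<phi>] by (simp add: distr_length)
  have "(LINT w|M. \<phi> (p r w)) = (LINT n|?P. \<phi> n)"
    using integral_distr[OF measurable_length, of \<phi> r] by (simp add: distr_length)
  also have "\<dots> = (\<Sum>n\<in>{0..<k (r - 1)}. pmf ?P n *\<^sub>R \<phi> n)"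
    using ne by (intro integral_measure_pmf) auto
  also have "\<dots> = (\<Sum>n<k (r - 1). (1 / real (k (r - 1))) *\<^sub>R \<phi> n)"
    using ne by (intro sum.cong) auto
  finally show "(LINT w|M. \<phi> (p r w)) = (1 / real (k (r - 1))) *\<^sub>R (\<Sum>n<k (r - 1). \<phi> n)"
    by (simp add: scaleR_sum_right)
qed

end

section \<open>Stochastic oracles\<close>

lemma oracle_measurable:
  assumes "unbiased_oracle nrm S \<sigma> orc G" "s \<in> measurable Q S"
    "X \<in> borel_measurable Q" "Z \<in> borel_measurable Q"
  shows "(\<lambda>q. orc (s q) (X q) (Z q)) \<in> borel_measurable Q"
proof -
  have "(\<lambda>q. (s q, X q, Z q)) \<in> measurable Q (S \<Otimes>\<^sub>M borel \<Otimes>\<^sub>M borel)"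
    using assms by simp
  moreover have "(\<lambda>(s, x, y). orc s x y) \<in> borel_measurable (S \<Otimes>\<^sub>M borel \<Otimes>\<^sub>M borel)"
    using assms(1) by (simp add: unbiased_oracle_def)
  ultimately have "(\<lambda>q. (\<lambda>(s, x, y). orc s x y) (s q, X q, Z q)) \<in> borel_measurable Q"
    by (rule measurable_compose)
  then show ?thesis by simp
qed

lemma unbiased_oracleD:
  assumes "unbiased_oracle nrm S \<sigma> orc G"
  shows "integrable S (\<lambda>s. orc s x y)" "(LINT s|S. orc s x y) = G x y"
    "integrable S (\<lambda>s. (nrm (orc s x y - G x y))\<^sup>2)"
    "(LINT s|S. (nrm (orc s x y - G x y))\<^sup>2) \<le> \<sigma>\<^sup>2"
  using assms unfolding unbiased_oracle_def by blast+

lemma oracle_mult_mean: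
  fixes orc :: "'s \<Rightarrow> 'x::euclidean_space \<Rightarrow> 'y::euclidean_space \<Rightarrow> real^'n^'m"
  assumes "unbiased_oracle nrm S \<sigma> orc G"
  shows "integrable S (\<lambda>s. orc s x y *v v)" "(LINT s|S. orc s x y *v v) = G x y *v v"
proof -
  note lin = bounded_bilinear.bounded_linear_left[OF bounded_bilinear_mult_vec, of v]
  show "integrable S (\<lambda>s. orc s x y *v v)"
    by (rule integrable_bounded_linear[OF lin unbiased_oracleD(1)[OF assms]])
  show "(LINT s|S. orc s x y *v v) = G x y *v v"
    using integral_bounded_linear[OF lin unbiased_oracleD(1)[OF assms, of x y]]
    by (simp only: unbiased_oracleD(2)[OF assms])
qed

section \<open>Second moments and means of random vectors and matrices\<close>

lemma second_moment_le:
  fixes X :: "'a \<Rightarrow> 'b::euclidean_space"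
  assumes "prob_space S" and X: "X \<in> borel_measurable S"
    and int: "integrable S (\<lambda>s. (norm (X s - m))\<^sup>2)" and le: "(LINT s|S. (norm (X s - m))\<^sup>2) \<le> b"
  shows "integrable S (\<lambda>s. (norm (X s))\<^sup>2)" "(LINT s|S. (norm (X s))\<^sup>2) \<le> 2 * b + 2 * (norm m)\<^sup>2"
proof -
  interpret prob_space S by fact
  have sq: "(norm (X s))\<^sup>2 \<le> 2 * (norm (X s - m))\<^sup>2 + 2 * (norm m)\<^sup>2" for s
    using norm_add_sq_le[of "X s - m" m] by simp
  have I: "integrable S (\<lambda>s. 2 * (norm (X s - m))\<^sup>2 + 2 * (norm m)\<^sup>2)" using int by simp
  show I2: "integrable S (\<lambda>s. (norm (X s))\<^sup>2)"
    by (rule Bochner_Integration.integrable_bound[OF I]) (use X sq in auto)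
  have "(LINT s|S. (norm (X s))\<^sup>2) \<le> (LINT s|S. 2 * (norm (X s - m))\<^sup>2 + 2 * (norm m)\<^sup>2)"
    by (intro integral_mono I I2 sq)
  also have "\<dots> = 2 * (LINT s|S. (norm (X s - m))\<^sup>2) + 2 * (norm m)\<^sup>2"
    using int by (simp add: prob_space)
  finally show "(LINT s|S. (norm (X s))\<^sup>2) \<le> 2 * b + 2 * (norm m)\<^sup>2" using le by linarith
qed

lemma norm_add_scaleR_sq: "(norm (u + c *\<^sub>R d))\<^sup>2 = (norm u)\<^sup>2 + 2 * c * (u \<bullet> d) + c\<^sup>2 * (norm d)\<^sup>2"
  for u d :: "'a::real_inner"
  by (simp add: power2_norm_eq_inner inner_add_left inner_add_right inner_commute power2_eq_square[of c])

text \<open>The cross term integrates to zero because \<open>m\<close> is the mean, so the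
  fluctuation enters with the factor \<open>c\<^sup>2\<close> alone.\<close>

lemma bias_variance:
  fixes X :: "'a \<Rightarrow> 'b::euclidean_space"
  assumes "prob_space S" and int: "integrable S X" and int2: "integrable S (\<lambda>s. (norm (X s - m))\<^sup>2)"
    and m: "(LINT s|S. X s) = m"
  shows "integrable S (\<lambda>s. (norm (a + c *\<^sub>R X s))\<^sup>2)"
    "(LINT s|S. (norm (a + c *\<^sub>R X s))\<^sup>2)
        = (norm (a + c *\<^sub>R m))\<^sup>2 + c\<^sup>2 * (LINT s|S. (norm (X s - m))\<^sup>2)"
proof -
  interpret prob_space S by fact
  have eq: "(norm (a + c *\<^sub>R X s))\<^sup>2 = (norm (a + c *\<^sub>R m))\<^sup>2
      + 2 * c * ((a + c *\<^sub>R m) \<bullet> (X s - m)) + c\<^sup>2 * (norm (X s - m))\<^sup>2" for s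
  proof -
    have "a + c *\<^sub>R X s = (a + c *\<^sub>R m) + c *\<^sub>R (X s - m)" by (simp add: algebra_simps)
    also have "(norm \<dots>)\<^sup>2 = (norm (a + c *\<^sub>R m))\<^sup>2
        + 2 * c * ((a + c *\<^sub>R m) \<bullet> (X s - m)) + c\<^sup>2 * (norm (X s - m))\<^sup>2"
      by (rule norm_add_scaleR_sq)
    finally show ?thesis .
  qed
  have I: "integrable S (\<lambda>s. (a + c *\<^sub>R m) \<bullet> (X s - m))" using int by simp
  have "(LINT s|S. (a + c *\<^sub>R m) \<bullet> (X s - m)) = (a + c *\<^sub>R m) \<bullet> (LINT s|S. X s - m)"
    using int by (intro integral_inner_right) simp
  also have "\<dots> = 0" using int m by (simp add: prob_space)
  finally have Z: "(LINT s|S. (a + c *\<^sub>R m) \<bullet> (X s - m)) = 0" .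
  show "integrable S (\<lambda>s. (norm (a + c *\<^sub>R X s))\<^sup>2)"
    unfolding eq using I int2 by (intro Bochner_Integration.integrable_add integrable_mult_right) auto
  show "(LINT s|S. (norm (a + c *\<^sub>R X s))\<^sup>2)
      = (norm (a + c *\<^sub>R m))\<^sup>2 + c\<^sup>2 * (LINT s|S. (norm (X s - m))\<^sup>2)"
    unfolding eq using I int2 Z by (simp add: prob_space)
qed

lemma centered_second_moment:
  fixes X :: "'a \<Rightarrow> 'b::euclidean_space"
  assumes "prob_space S" and int: "integrable S X" and int2: "integrable S (\<lambda>s. (norm (X s))\<^sup>2)"
    and m: "(LINT s|S. X s) = m"
  shows "integrable S (\<lambda>s. (norm (X s - m))\<^sup>2)"
    "(LINT s|S. (norm (X s - m))\<^sup>2) = (LINT s|S. (norm (X s))\<^sup>2) - (norm m)\<^sup>2"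
proof -
  interpret prob_space S by fact
  have eq: "(norm (X s - m))\<^sup>2 = (norm (X s))\<^sup>2 - 2 * (m \<bullet> X s) + (norm m)\<^sup>2" for s
    by (simp add: power2_norm_eq_inner inner_commute algebra_simps)
  have Z: "(LINT s|S. m \<bullet> X s) = (norm m)\<^sup>2"
    using int m by (subst integral_inner_right) (auto simp: power2_norm_eq_inner)
  show "integrable S (\<lambda>s. (norm (X s - m))\<^sup>2)"
    unfolding eq using int int2 by simp
  show "(LINT s|S. (norm (X s - m))\<^sup>2) = (LINT s|S. (norm (X s))\<^sup>2) - (norm m)\<^sup>2"
    unfolding eq using int int2 Z by (simp add: prob_space)
qed

lemma norm_mean_sq_le:
  fixes X :: "'a \<Rightarrow> 'b::euclidean_space"
  assumes "prob_space S" "integrable S X" "integrable S (\<lambda>s. (norm (X s))\<^sup>2)"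
  shows "(norm (LINT s|S. X s))\<^sup>2 \<le> (LINT s|S. (norm (X s))\<^sup>2)"
proof -
  have "0 \<le> (LINT s|S. (norm (X s - (LINT s|S. X s)))\<^sup>2)" by simp
  then show ?thesis using centered_second_moment(2)[OF assms refl] by simp
qed

lemma mat_mult_vec: "mat c *v v = c *\<^sub>R v" for c :: real
  by (simp add: vec_eq_iff matrix_vector_mult_def mat_def if_distrib[of "\<lambda>b. b * _"] sum.delta cong: if_cong)

lemma psd_scaleR: "psd A \<Longrightarrow> 0 \<le> c \<Longrightarrow> psd (c *\<^sub>R A)"
  unfolding psd_def by (auto simp: transpose_scalar scaleR_matrix_vector_assoc[symmetric])

text \<open>Symmetry and nonnegativity of the quadratic form are conditions on bounded linear
  functionals of the matrix, and these commute with the integral. It transfers the bounds on the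
  Hessian oracle to the Hessian itself.\<close>

lemma psd_mean:
  fixes A :: "'s \<Rightarrow> real^'n^'n"
  assumes int: "integrable S A" and psd: "\<And>s. s \<in> space S \<Longrightarrow> psd (A s)"
  shows "psd (LINT s|S. A s)"
  unfolding psd_def
proof (intro conjI allI)
  have ent: "integrable S (\<lambda>s. A s $ i $ j)" "(LINT s|S. A s) $ i $ j = (LINT s|S. A s $ i $ j)" for i j
  proof -
    have lin: "bounded_linear (\<lambda>B :: real^'n^'n. B $ i $ j)"
      by (intro bounded_linear_compose[OF bounded_linear_vec_nth bounded_linear_vec_nth])
    show "integrable S (\<lambda>s. A s $ i $ j)" by (rule integrable_bounded_linear[OF lin int])
    show "(LINT s|S. A s) $ i $ j = (LINT s|S. A s $ i $ j)"
      by (rule integral_bounded_linear[OF lin int, symmetric])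
  qed
  have sym: "A s $ i $ j = A s $ j $ i" if "s \<in> space S" for s i j
  proof -
    have "transpose (A s) $ i $ j = A s $ j $ i" by (simp add: transpose_def)
    then show ?thesis using psd[OF that] by (simp add: psd_def)
  qed
  show "transpose (LINT s|S. A s) = (LINT s|S. A s)"
  proof (intro vec_eq_iff[THEN iffD2] allI)
    fix i j
    have "transpose (LINT s|S. A s) $ i $ j = (LINT s|S. A s $ j $ i)"
      by (simp add: transpose_def ent)
    also have "\<dots> = (LINT s|S. A s $ i $ j)" by (intro Bochner_Integration.integral_cong refl sym)
    finally show "transpose (LINT s|S. A s) $ i $ j = (LINT s|S. A s) $ i $ j" by (simp only: ent)
  qed
  fix v
  have lin: "bounded_linear (\<lambda>B :: real^'n^'n. v \<bullet> (B *v v))"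
    by (intro bounded_linear_compose[OF bounded_linear_inner_right]
        bounded_bilinear.bounded_linear_left[OF bounded_bilinear_mult_vec])
  have "v \<bullet> ((LINT s|S. A s) *v v) = (LINT s|S. v \<bullet> (A s *v v))"
    by (rule integral_bounded_linear[OF lin int, symmetric])
  also have "0 \<le> \<dots>" using psd by (intro Bochner_Integration.integral_nonneg) (auto simp: psd_def)
  finally show "0 \<le> v \<bullet> ((LINT s|S. A s) *v v)" .
qed

section \<open>The hypergradient estimator\<close>

text \<open>The product is only ever applied to a vector, and \<open>V\<close> stays general in the
  induction because peeling off the last factor replaces it by its image under that factor.\<close>

lemma neumann_prod_measurable:
  fixes V :: "'q \<Rightarrow> real^'e"
  assumes orc: "unbiased_oracle nrm S \<sigma> (orc :: 's \<Rightarrow> real^'d \<Rightarrow> real^'e \<Rightarrow> real^'e^'e) G"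
    and s: "\<And>i. i \<in> {1..n} \<Longrightarrow> s i \<in> measurable Q S"
    and X: "X \<in> borel_measurable Q" and Z: "Z \<in> borel_measurable Q" and V: "V \<in> borel_measurable Q"
  shows "(\<lambda>q. neumann_prod C (\<lambda>i. orc (s i q) (X q) (Z q)) n *v V q) \<in> borel_measurable Q"
  using s V
proof (induction n arbitrary: V)
  case (Suc n)
  have [measurable]: "(\<lambda>q. orc (s (Suc n) q) (X q) (Z q)) \<in> borel_measurable Q"
    by (rule oracle_measurable[OF orc _ X Z]) (simp add: Suc.prems)
  have "(\<lambda>q. neumann_prod C (\<lambda>i. orc (s i q) (X q) (Z q)) n
      *v ((mat 1 - (1 / C) *\<^sub>R orc (s (Suc n) q) (X q) (Z q)) *v V q)) \<in> borel_measurable Q"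
    using Suc.prems by (intro Suc.IH) auto
  then show ?case by (simp add: matrix_vector_mul_assoc)
qed simp

locale bilevel_oracles =
  bilevel f g Y fx fy gy gxy gyy lam Lfx Lfy Lgy Lgxy Lgyy Cfy Cgxy
  for f g :: "real^'d \<Rightarrow> real^'e \<Rightarrow> real"
    and Y :: "(real^'e) set"
    and fx :: "real^'d \<Rightarrow> real^'e \<Rightarrow> real^'d"
    and fy gy :: "real^'d \<Rightarrow> real^'e \<Rightarrow> real^'e"
    and gxy :: "real^'d \<Rightarrow> real^'e \<Rightarrow> real^'e^'d"
    and gyy :: "real^'d \<Rightarrow> real^'e \<Rightarrow> real^'e^'e"
    and lam Lfx Lfy Lgy Lgxy Lgyy Cfy Cgxy :: real +
  fixes S :: "'s measure" and Orc :: "('s, 'd, 'e) oracles" and \<sigma> C :: real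
  assumes S: "prob_space S"
    and orc_fx: "unbiased_oracle norm S \<sigma> (O_fx Orc) fx"
    and orc_fy: "unbiased_oracle norm S \<sigma> (O_fy Orc) fy"
    and orc_gy: "unbiased_oracle norm S \<sigma> (O_gy Orc) gy"
    and orc_gxy: "unbiased_oracle spectral_norm S \<sigma> (O_gxy Orc) gxy"
    and orc_gyy: "unbiased_oracle spectral_norm S \<sigma> (O_gyy Orc) gyy"
    and orc_gyy_bounds:
      "\<And>s x y. s \<in> space S \<Longrightarrow> psd (O_gyy Orc s x y) \<and> psd (mat C - O_gyy Orc s x y)"
begin

text \<open>Averaging the oracle bound puts \<open>gyy 0 0\<close> below \<open>C\<close>, strong
  convexity puts it above \<open>lam\<close>, and a unit vector compares the two. Hence
  \<open>\<rho>\<close> is nonnegative.\<close>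

lemma lam_le_C: "lam \<le> C"
proof -
  interpret S: prob_space S by (rule S)
  obtain v :: "real^'e" where v: "norm v = 1" using norm_Basis SOME_Basis by blast
  have "psd (LINT s|S. mat C - O_gyy Orc s 0 0)"
    using orc_gyy_bounds unbiased_oracleD(1)[OF orc_gyy] by (intro psd_mean) auto
  also have "(LINT s|S. mat C - O_gyy Orc s 0 0) = mat C - gyy 0 0"
    using unbiased_oracleD(1,2)[OF orc_gyy] by (simp add: S.prob_space)
  finally have "0 \<le> v \<bullet> ((mat C - gyy 0 0) *v v)" by (simp add: psd_def)
  also have "\<dots> = C * (norm v)\<^sup>2 - v \<bullet> (gyy 0 0 *v v)"
    by (simp add: matrix_vector_mult_diff_rdistrib inner_diff_right power2_norm_eq_inner
        mat_mult_vec)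
  finally show ?thesis using gyy_lower[of v 0 0] v by simp
qed

lemma C_pos: "0 < C" using lam_le_C lam_pos by linarith

definition \<rho> where "\<rho> = 1 - lam / C"

lemma \<rho>_bounds: "0 \<le> \<rho>" "\<rho> < 1"
  unfolding \<rho>_def using lam_le_C lam_pos C_pos by (auto simp: field_simps)

text \<open>Bound, per unit of \<open>k\<close>, on the second moment of the product of the three
  random parts of the estimator: the first bracket belongs to \<open>O_gxy\<close>, the numerator of
  the second to \<open>O_fy\<close>, and \<open>1 / (C * lam)\<close> to the random Neumann
  product.\<close>

definition moment_rate where
  "moment_rate = (2 * \<sigma>\<^sup>2 + 2 * Cgxy\<^sup>2) * ((2 * \<sigma>\<^sup>2 + 2 * Cfy\<^sup>2) / (C * lam))"

lemma moment_rate_nonneg: "0 \<le> moment_rate"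
  unfolding moment_rate_def using C_pos lam_pos by simp

end

locale smb_setup =
  bilevel_oracles f g Y fx fy gy gxy gyy lam Lfx Lfy Lgy Lgxy Lgyy Cfy Cgxy S Orc \<sigma> C +
  smb_draws M S k \<xi> p
  for f g :: "real^'d \<Rightarrow> real^'e \<Rightarrow> real"
    and Y fx fy gy gxy gyy lam Lfx Lfy Lgy Lgxy Lgyy Cfy Cgxy
    and S :: "'s measure" and Orc \<sigma> C
    and M :: "'w measure" and k \<xi> p
begin

section \<open>Random factors and their products, applied to a vector\<close>

definition factor where
  "factor r x y i w = mat 1 - (1 / C) *\<^sub>R O_gyy Orc (\<xi> (Call_gyy r i) w) x y"

text \<open>The matrix \<open>mat 1 - (1 / C) *\<^sub>R gyy x y\<close> as a map on vectors, so that
  its powers are written with \<open>^^\<close>.\<close>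

definition mean_factor where
  "mean_factor x y v = v - (1 / C) *\<^sub>R (gyy x y *v v)"

definition neumann where
  "neumann r x y n w v = neumann_prod C (\<lambda>i. O_gyy Orc (\<xi> (Call_gyy r i) w) x y) n *v v"

lemma neumann_simps [simp]:
  "neumann r x y 0 w v = v"
  "neumann r x y (Suc n) w v = neumann r x y n w (factor r x y (Suc n) w *v v)"
  unfolding neumann_def factor_def by (simp_all add: matrix_vector_mul_assoc)

lemma factor_mult: "factor r x y i w *v v = v - (1 / C) *\<^sub>R (O_gyy Orc (\<xi> (Call_gyy r i) w) x y *v v)"
  unfolding factor_def by (simp add: matrix_vector_mult_diff_rdistrib scaleR_matrix_vector_assoc)

lemma factor_mean:
  "integrable M (\<lambda>w. factor r x y i w *v v)" "(LINT w|M. factor r x y i w *v v) = mean_factor x y v"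
proof -
  have I: "integrable M (\<lambda>w. O_gyy Orc (\<xi> (Call_gyy r i) w) x y *v v)"
    by (rule seed_integrable[OF oracle_mult_mean(1)[OF orc_gyy]])
  show "integrable M (\<lambda>w. factor r x y i w *v v)" unfolding factor_mult using I by simp
  have "(LINT w|M. O_gyy Orc (\<xi> (Call_gyy r i) w) x y *v v) = gyy x y *v v"
    using seed_integral[OF oracle_mult_mean(1)[OF orc_gyy]] oracle_mult_mean(2)[OF orc_gyy] by metis
  then show "(LINT w|M. factor r x y i w *v v) = mean_factor x y v"
    unfolding factor_mult mean_factor_def using I by (simp add: prob_space)
qed

text \<open>Up to the scale \<open>1 / C\<close>, \<open>factor\<close> and its complement to the
  identity are the two matrices that the oracle bounds declare positive semidefinite.\<close>

lemma factor_contraction: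
  assumes "w \<in> space M"
  shows "(norm (factor r x y i w *v v))\<^sup>2 \<le> v \<bullet> (factor r x y i w *v v)"
    "norm (factor r x y i w *v v) \<le> norm v"
proof -
  let ?A = "O_gyy Orc (\<xi> (Call_gyy r i) w) x y" and ?B = "factor r x y i w"
  have A: "psd ?A" "psd (mat C - ?A)" using orc_gyy_bounds[OF seed_in_space[OF assms]] by auto
  have "?B = (1 / C) *\<^sub>R (mat C - ?A)"
    unfolding factor_def using C_pos by (simp add: vec_eq_iff mat_def field_simps)
  moreover have "mat 1 - ?B = (1 / C) *\<^sub>R ?A" unfolding factor_def by simp
  ultimately have "psd ?B" "psd (mat 1 - ?B)" using A C_pos by (auto intro!: psd_scaleR)
  then show 1: "(norm (?B *v v))\<^sup>2 \<le> v \<bullet> (?B *v v)" by (rule psd_contraction)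
  also have "\<dots> \<le> norm v * norm (?B *v v)" by (rule norm_cauchy_schwarz)
  finally have "norm (?B *v v) * norm (?B *v v) \<le> norm v * norm (?B *v v)"
    by (simp add: power2_eq_square)
  then show "norm (?B *v v) \<le> norm v"
    by (cases "?B *v v = 0") (simp_all del: mult_le_cancel_right add: mult_le_cancel_right_pos)
qed

lemma factor_measurable:
  "Inl (Call_gyy r i) \<in> J \<Longrightarrow> (\<lambda>w. factor r x y i w *v v) \<in> borel_measurable (draw_algebra J)"
  unfolding factor_def
  using oracle_measurable[OF orc_gyy measurable_draw_seed, of "Call_gyy r i" J "\<lambda>_. x" "\<lambda>_. y"]
  by (intro measurable_mult_vec) auto

text \<open>The pointwise bound \<open>v \<bullet> (factor r x y i w *v v)\<close> is linear in the
  random matrix, so its expectation involves the mean Hessian only. Strong convexity applies there,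
  although a single oracle answer need not be bounded below by \<open>lam\<close>.\<close>

lemma factor_second_moment:
  "integrable M (\<lambda>w. (norm (factor r x y i w *v v))\<^sup>2)"
  "(LINT w|M. (norm (factor r x y i w *v v))\<^sup>2) \<le> \<rho> * (norm v)\<^sup>2"
proof -
  have I: "integrable M (\<lambda>w. v \<bullet> (factor r x y i w *v v))" using factor_mean(1) by simp
  show I2: "integrable M (\<lambda>w. (norm (factor r x y i w *v v))\<^sup>2)"
  proof (rule Bochner_Integration.integrable_bound[OF I])
    show "(\<lambda>w. (norm (factor r x y i w *v v))\<^sup>2) \<in> borel_measurable M"
      using factor_mean(1)[THEN borel_measurable_integrable] by simp
    show "AE w in M. norm ((norm (factor r x y i w *v v))\<^sup>2) \<le> norm (v \<bullet> (factor r x y i w *v v))"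
      using factor_contraction(1) by (intro AE_I2) (simp add: order_trans[OF _ abs_ge_self])
  qed
  have "(LINT w|M. (norm (factor r x y i w *v v))\<^sup>2) \<le> (LINT w|M. v \<bullet> (factor r x y i w *v v))"
    by (intro integral_mono I I2 factor_contraction(1))
  also have "\<dots> = v \<bullet> mean_factor x y v" using factor_mean by (simp add: integral_inner_right)
  also have "\<dots> = (norm v)\<^sup>2 - (1 / C) * (v \<bullet> (gyy x y *v v))"
    by (simp add: mean_factor_def inner_diff_right power2_norm_eq_inner)
  also have "\<dots> \<le> (norm v)\<^sup>2 - (1 / C) * (lam * (norm v)\<^sup>2)"
    using gyy_lower[of v x y] C_pos by (intro diff_left_mono mult_left_mono) auto
  also have "\<dots> = \<rho> * (norm v)\<^sup>2" unfolding \<rho>_def by (simp add: algebra_simps)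
  finally show "(LINT w|M. (norm (factor r x y i w *v v))\<^sup>2) \<le> \<rho> * (norm v)\<^sup>2" .
qed

lemma neumann_norm_le: "w \<in> space M \<Longrightarrow> norm (neumann r x y n w v) \<le> norm v"
  by (induction n arbitrary: v) (auto intro: order_trans factor_contraction)

lemma neumann_measurable:
  assumes "\<And>i. i \<in> {1..n} \<Longrightarrow> Inl (Call_gyy r i) \<in> J"
  shows "(\<lambda>(v, w). neumann r x y n w v) \<in> borel_measurable (borel \<Otimes>\<^sub>M draw_algebra J)"
  unfolding neumann_def case_prod_unfold
  by (rule neumann_prod_measurable[OF orc_gyy, of _ "\<lambda>i q. \<xi> (Call_gyy r i) (snd q)"])
     (auto intro!: measurable_compose[OF measurable_snd measurable_draw_seed] assms)

lemma neumann_measurable_section: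
  assumes "\<And>i. i \<in> {1..n} \<Longrightarrow> Inl (Call_gyy r i) \<in> J"
  shows "(\<lambda>w. neumann r x y n w v) \<in> borel_measurable (draw_algebra J)"
  using measurable_Pair2[OF neumann_measurable[OF assms], where x = v] by simp

lemma neumann_integrable: "integrable M (\<lambda>w. neumann r x y n w v)"
  "integrable M (\<lambda>w. (norm (neumann r x y n w v))\<^sup>2)"
proof -
  have [measurable]: "(\<lambda>w. neumann r x y n w v) \<in> borel_measurable M"
    by (rule measurable_drawD[OF neumann_measurable_section[where J = UNIV]]) simp
  show "integrable M (\<lambda>w. neumann r x y n w v)"
    by (rule integrable_const_bound[of _ "norm v"]) (auto intro: neumann_norm_le)
  show "integrable M (\<lambda>w. (norm (neumann r x y n w v))\<^sup>2)"
    by (rule integrable_const_bound[of _ "(norm v)\<^sup>2"]) (auto intro: power_mono neumann_norm_le)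
qed

lemma linear_mean_factor: "linear (mean_factor x y ^^ n)"
proof (induction n)
  case (Suc n)
  have "linear (mean_factor x y)"
    by (intro linearI) (simp_all add: mean_factor_def matrix_vector_right_distrib
        matrix_vector_mult_scaleR algebra_simps)
  then show ?case using linear_compose[OF Suc.IH] by (simp add: o_def comp_def)
qed (simp add: linear_iff)

text \<open>The factor with the largest index acts on \<open>v\<close> first and is independent of
  the others; freezing its output leaves a shorter product applied to a fixed vector. Hence the
  induction is for all \<open>v\<close>, and likewise for the second moment.\<close>

lemma neumann_mean: "(LINT w|M. neumann r x y n w v) = (mean_factor x y ^^ n) v"
proof (induction n arbitrary: v)
  case (Suc n)
  let ?X = "\<lambda>w. factor r x y (Suc n) w *v v"
  let ?J = "(\<lambda>i. Inl (Call_gyy r i)) ` {1..n} :: (oracle_call + nat) set"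
  have X: "?X \<in> borel_measurable (draw_algebra {Inl (Call_gyy r (Suc n))})"
    by (rule factor_measurable) simp
  have "(LINT w|M. neumann r x y n w (?X w)) = (LINT w|M. (LINT w'|M. neumann r x y n w' (?X w)))"
  proof (rule freeze_integral[OF X, of ?J])
    show "(\<lambda>(v, w). neumann r x y n w v) \<in> borel_measurable (borel \<Otimes>\<^sub>M draw_algebra ?J)"
      by (rule neumann_measurable) simp
    show "integrable M (\<lambda>w. neumann r x y n w (?X w))"
      using neumann_integrable(1)[of r x y "Suc n" v] by simp
  qed auto
  also have "\<dots> = (LINT w|M. (mean_factor x y ^^ n) (?X w))" by (simp only: Suc.IH)
  also have "\<dots> = (mean_factor x y ^^ n) (LINT w|M. ?X w)"
    by (rule integral_bounded_linear)
       (use linear_mean_factor linear_conv_bounded_linear factor_mean in blast)+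
  also have "\<dots> = (mean_factor x y ^^ Suc n) v" by (simp only: factor_mean funpow_Suc_right o_apply)
  finally show ?case by simp
qed (simp add: prob_space)

lemma neumann_second_moment: "(LINT w|M. (norm (neumann r x y n w v))\<^sup>2) \<le> \<rho> ^ n * (norm v)\<^sup>2"
proof (induction n arbitrary: v)
  case (Suc n)
  let ?X = "\<lambda>w. factor r x y (Suc n) w *v v"
  let ?J = "(\<lambda>i. Inl (Call_gyy r i)) ` {1..n} :: (oracle_call + nat) set"
  have X: "?X \<in> borel_measurable (draw_algebra {Inl (Call_gyy r (Suc n))})"
    by (rule factor_measurable) simp
  have "(LINT w|M. (norm (neumann r x y n w (?X w)))\<^sup>2) \<le> (LINT w|M. \<rho> ^ n * (norm (?X w))\<^sup>2)"
  proof (rule freeze_bound(2)[OF X, of ?J "\<lambda>v w. (norm (neumann r x y n w v))\<^sup>2"])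
    have [measurable]: "(\<lambda>(v, w). neumann r x y n w v) \<in> borel_measurable (borel \<Otimes>\<^sub>M draw_algebra ?J)"
      by (rule neumann_measurable) simp
    show "(\<lambda>(v, w). (norm (neumann r x y n w v))\<^sup>2) \<in> borel_measurable (borel \<Otimes>\<^sub>M draw_algebra ?J)"
      by measurable
  qed (use neumann_integrable(2) Suc.IH factor_second_moment(1) in auto)
  also have "\<dots> = \<rho> ^ n * (LINT w|M. (norm (?X w))\<^sup>2)" by simp
  also have "\<dots> \<le> \<rho> ^ n * (\<rho> * (norm v)\<^sup>2)"
    using \<rho>_bounds by (intro mult_left_mono factor_second_moment(2)) auto
  finally show ?case by (simp add: mult_ac)
qed (simp add: prob_space)

end

section \<open>The random-length estimate of the inverse Hessian\<close>

context smb_setup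
begin

definition inverse_estimate where
  "inverse_estimate r x y w v = smb_h Orc C (k (r - 1)) (\<lambda>c. \<xi> c w) (\<lambda>r. p r w) r x y *v v"

definition mean_inverse where
  "mean_inverse x y n v = (1 / C) *\<^sub>R (\<Sum>i<n. (mean_factor x y ^^ i) v)"

lemma inverse_estimate_eq:
  "inverse_estimate r x y w v = (real (k (r - 1)) / C) *\<^sub>R neumann r x y (p r w) w v"
  unfolding inverse_estimate_def smb_h_def neumann_def by (simp add: scaleR_matrix_vector_assoc)

text \<open>All indices of a round are included: the length of the product is random, and it is
  below \<open>k\<close> almost surely but not necessarily at every outcome.\<close>

definition gyy_draws :: "nat \<Rightarrow> (oracle_call + nat) set" where
  "gyy_draws r = range (\<lambda>i. Inl (Call_gyy r i))"

lemma neumann_length_measurable: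
  "(\<lambda>(n, w). neumann r x y n w v) \<in> borel_measurable (count_space UNIV \<Otimes>\<^sub>M draw_algebra (gyy_draws r))"
  by (rule measurable_pair_measure_countable1)
     (auto intro: neumann_measurable_section simp: gyy_draws_def)

lemma neumann_random_length_measurable:
  assumes "J \<supseteq> insert (Inr r) (gyy_draws r)"
  shows "(\<lambda>(v, w). neumann r x y (p r w) w v) \<in> borel_measurable (borel \<Otimes>\<^sub>M draw_algebra J)"
proof -
  have "(\<lambda>q. neumann r x y n (snd q) (fst q)) \<in> borel_measurable (borel \<Otimes>\<^sub>M draw_algebra J)" for n
    using neumann_measurable[of n r J x y] assms by (auto simp: case_prod_unfold gyy_draws_def)
  moreover have "(\<lambda>q. p r (snd q)) \<in> measurable (borel \<Otimes>\<^sub>M draw_algebra J) (count_space UNIV)"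
    using assms by (intro measurable_compose[OF measurable_snd measurable_draw_length]) auto
  ultimately show ?thesis
    unfolding case_prod_unfold by (rule measurable_compose_countable)
qed

lemma inverse_estimate_measurable:
  assumes "J \<supseteq> insert (Inr r) (gyy_draws r)"
  shows "(\<lambda>(v, w). inverse_estimate r x y w v) \<in> borel_measurable (borel \<Otimes>\<^sub>M draw_algebra J)"
  using neumann_random_length_measurable[OF assms, of x y]
  unfolding inverse_estimate_eq case_prod_unfold by simp

lemma inverse_estimate_measurable_section:
  assumes "J \<supseteq> insert (Inr r) (gyy_draws r)"
  shows "(\<lambda>w. inverse_estimate r x y w v) \<in> borel_measurable (draw_algebra J)"
  using measurable_Pair2[OF inverse_estimate_measurable[OF assms], where x = v] by simp

lemma inverse_estimate_norm_le:
  assumes "w \<in> space M"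
  shows "norm (inverse_estimate r x y w v) \<le> real (k (r - 1)) / C * norm v"
  unfolding inverse_estimate_eq
  using neumann_norm_le[OF assms, of r x y "p r w" v] C_pos
      by (simp add: mult_left_mono divide_right_mono)

lemma inverse_estimate_integrable:
  "integrable M (\<lambda>w. inverse_estimate r x y w v)"
  "integrable M (\<lambda>w. (norm (inverse_estimate r x y w v))\<^sup>2)"
proof -
  have [measurable]: "(\<lambda>w. inverse_estimate r x y w v) \<in> borel_measurable M"
    by (rule measurable_drawD[OF inverse_estimate_measurable_section[where J = UNIV]]) simp
  show "integrable M (\<lambda>w. inverse_estimate r x y w v)"
    by (rule integrable_const_bound[OF AE_I2[OF inverse_estimate_norm_le]]) simp_all
  show "integrable M (\<lambda>w. (norm (inverse_estimate r x y w v))\<^sup>2)"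
  proof (rule integrable_const_bound[OF AE_I2])
    fix w assume "w \<in> space M"
    then have "(norm (inverse_estimate r x y w v))\<^sup>2 \<le> (real (k (r - 1)) / C * norm v)\<^sup>2"
      by (intro power_mono inverse_estimate_norm_le) auto
    then show "norm ((norm (inverse_estimate r x y w v))\<^sup>2) \<le> (real (k (r - 1)) / C * norm v)\<^sup>2"
      by simp
  qed measurable
qed

text \<open>Freezing the length reduces to products of fixed length. The prefactor \<open>k\<close>
  in \<open>smb_h\<close> cancels the uniform weight \<open>1 / k\<close>, so one random term has
  the whole partial Neumann sum as its mean.\<close>

lemma inverse_estimate_mean:
  "(LINT w|M. inverse_estimate r x y w v) = mean_inverse x y (k (r - 1)) v"
proof -
  let ?k = "k (r - 1)"
  have "(LINT w|M. inverse_estimate r x y w v)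
      = (LINT w|M. (real ?k / C) *\<^sub>R neumann r x y (p r w) w v)"
    by (simp only: inverse_estimate_eq)
  also have "\<dots> = (LINT w|M. (LINT w'|M. (real ?k / C) *\<^sub>R neumann r x y (p r w) w' v))"
  proof (rule freeze_integral[OF measurable_draw_length[of r "{Inr r}"], of "gyy_draws r"])
    show "(\<lambda>(n, w). (real ?k / C) *\<^sub>R neumann r x y n w v)
        \<in> borel_measurable (count_space UNIV \<Otimes>\<^sub>M draw_algebra (gyy_draws r))"
      using neumann_length_measurable[of r x y v] unfolding case_prod_unfold by simp
    show "integrable M (\<lambda>w. (real ?k / C) *\<^sub>R neumann r x y (p r w) w v)"
      using inverse_estimate_integrable(1)[of r x y v] by (simp only: inverse_estimate_eq)
  qed (auto simp: gyy_draws_def)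
  also have "\<dots> = (LINT w|M. (real ?k / C) *\<^sub>R (mean_factor x y ^^ p r w) v)"
    by (simp add: neumann_mean)
  also have "\<dots> = (1 / real ?k) *\<^sub>R (\<Sum>n<?k. (real ?k / C) *\<^sub>R (mean_factor x y ^^ n) v)"
    by (rule length_integral(2))
  also have "\<dots> = mean_inverse x y ?k v"
    using k_pos[of "r - 1"] by (simp add: mean_inverse_def scaleR_sum_right[symmetric])
  finally show ?thesis .
qed

text \<open>The squared prefactor is of order \<open>k\<^sup>2\<close>, but averaging
  \<open>\<rho> ^ n\<close> over \<open>n < k\<close> gives a bounded geometric sum divided by
  \<open>k\<close>; what is left is linear in \<open>k\<close>.\<close>

lemma inverse_estimate_second_moment:
  "(LINT w|M. (norm (inverse_estimate r x y w v))\<^sup>2) \<le> real (k (r - 1)) / (C * lam) * (norm v)\<^sup>2"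
proof -
  let ?k = "k (r - 1)"
  define c where "c = (real ?k / C)\<^sup>2"
  have c: "0 \<le> c" by (simp add: c_def)
  have sq: "(norm (inverse_estimate r x y w v))\<^sup>2 = c * (norm (neumann r x y (p r w) w v))\<^sup>2" for w
    unfolding inverse_estimate_eq c_def by (simp only: norm_scaleR power_mult_distrib power2_abs)
  have "(LINT w|M. (norm (inverse_estimate r x y w v))\<^sup>2)
      = (LINT w|M. c * (norm (neumann r x y (p r w) w v))\<^sup>2)"
    by (simp only: sq)
  also have "\<dots> \<le> (LINT w|M. c * (\<rho> ^ p r w * (norm v)\<^sup>2))"
  proof (rule freeze_bound(2)[OF measurable_draw_length[of r "{Inr r}"], of "gyy_draws r"
        "\<lambda>n w. c * (norm (neumann r x y n w v))\<^sup>2" "\<lambda>n. c * (\<rho> ^ n * (norm v)\<^sup>2)"])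
    show "(\<lambda>(n, w). c * (norm (neumann r x y n w v))\<^sup>2)
        \<in> borel_measurable (count_space UNIV \<Otimes>\<^sub>M draw_algebra (gyy_draws r))"
      using neumann_length_measurable[of r x y v] unfolding case_prod_unfold by measurable
    show "integrable M (\<lambda>w. c * (norm (neumann r x y n w v))\<^sup>2)" for n
      using neumann_integrable(2) by simp
    show "(LINT w|M. c * (norm (neumann r x y n w v))\<^sup>2) \<le> c * (\<rho> ^ n * (norm v)\<^sup>2)" for n
      using neumann_second_moment c by (simp add: mult_left_mono)
    show "integrable M (\<lambda>w. c * (\<rho> ^ p r w * (norm v)\<^sup>2))" by (rule length_integral(1))
  qed (auto simp: gyy_draws_def c)
  also have "\<dots> = (1 / real ?k) * (\<Sum>n<?k. c * (\<rho> ^ n * (norm v)\<^sup>2))"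
    using length_integral(2)[of "\<lambda>n. c * (\<rho> ^ n * (norm v)\<^sup>2)" r] by (simp only: real_scaleR_def)
  also have "\<dots> = real ?k / C\<^sup>2 * (norm v)\<^sup>2 * (\<Sum>n<?k. \<rho> ^ n)"
  proof -
    have "(\<Sum>n<?k. c * (\<rho> ^ n * (norm v)\<^sup>2)) = c * (norm v)\<^sup>2 * (\<Sum>n<?k. \<rho> ^ n)"
      by (simp add: sum_distrib_left mult_ac)
    then have "(1 / real ?k) * (\<Sum>n<?k. c * (\<rho> ^ n * (norm v)\<^sup>2))
        = (1 / real ?k * c) * (norm v)\<^sup>2 * (\<Sum>n<?k. \<rho> ^ n)" by (simp only: mult.assoc)
    also have "1 / real ?k * c = real ?k / C\<^sup>2"
      using k_pos[of "r - 1"] by (simp add: c_def power2_eq_square)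
    finally show ?thesis .
  qed
  also have "\<dots> \<le> real ?k / C\<^sup>2 * (norm v)\<^sup>2 * (C / lam)"
  proof (intro mult_left_mono)
    have "(\<Sum>n<?k. \<rho> ^ n) = (1 - \<rho> ^ ?k) / (1 - \<rho>)"
      using \<rho>_bounds by (simp add: sum_gp_strict)
    also have "\<dots> \<le> 1 / (1 - \<rho>)" using \<rho>_bounds by (intro divide_right_mono) auto
    finally show "(\<Sum>n<?k. \<rho> ^ n) \<le> C / lam" by (simp add: \<rho>_def)
  qed simp
  also have "\<dots> = real ?k / (C * lam) * (norm v)\<^sup>2"
    using C_pos by (simp add: power2_eq_square)
  finally show ?thesis .
qed

lemma linear_mean_inverse: "linear (mean_inverse x y n)"
proof -
  have "linear (\<lambda>v. \<Sum>i<n. (mean_factor x y ^^ i) v)"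
    by (intro linear_compose_sum ballI linear_mean_factor)
  then show ?thesis
    unfolding mean_inverse_def by (rule linear_compose_scale_right)
qed

text \<open>Telescoping: \<open>(1 / C) *\<^sub>R fy x y\<close> is \<open>invq x y\<close> minus
  its image under \<open>mean_factor\<close>, so the partial sum misses the exact solution by one
  power of that map.\<close>

lemma mean_inverse_invq:
  "mean_inverse x y n (fy x y) = invq x y - (mean_factor x y ^^ n) (invq x y)"
proof (induction n)
  case (Suc n)
  have lin: "linear (mean_factor x y ^^ n)" by (rule linear_mean_factor)
  have "mean_factor x y (invq x y) = invq x y - (1 / C) *\<^sub>R fy x y"
    by (simp add: mean_factor_def gyy_invq)
  then have power: "(mean_factor x y ^^ Suc n) (invq x y)
      = (mean_factor x y ^^ n) (invq x y) - (1 / C) *\<^sub>R (mean_factor x y ^^ n) (fy x y)"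
    by (simp only: funpow_Suc_right o_apply linear_diff[OF lin] linear_scale[OF lin])
  have "mean_inverse x y (Suc n) (fy x y)
      = mean_inverse x y n (fy x y) + (1 / C) *\<^sub>R (mean_factor x y ^^ n) (fy x y)"
    by (simp add: mean_inverse_def scaleR_right_distrib)
  then show ?case unfolding Suc.IH power by simp
qed (simp add: mean_inverse_def)

text \<open>The power is the mean of a random product, so Jensen's inequality transfers the second
  moment bound to it. Round 0 merely supplies some draws.\<close>

lemma norm_mean_factor_power: "(norm ((mean_factor x y ^^ n) v))\<^sup>2 \<le> \<rho> ^ n * (norm v)\<^sup>2"
  using norm_mean_sq_le[OF prob_space_axioms neumann_integrable, of 0 x y n v]
    neumann_second_moment[of 0 x y n v]
  by (simp add: neumann_mean)

section \<open>Mean, bias and variance of the whole estimate\<close>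

abbreviation estimate where
  "estimate r x y w \<equiv> smb_estimate Orc C (k (r - 1)) (\<lambda>c. \<xi> c w) (\<lambda>r. p r w) r x y"

definition mean_estimate where
  "mean_estimate n x y = fx x y - gxy x y *v mean_inverse x y n (fy x y)"

lemma estimate_bias:
  "(norm (mean_estimate n x y - \<Phi> x y))\<^sup>2 \<le> (Cgxy * (Cfy / lam))\<^sup>2 * \<rho> ^ n"
proof -
  let ?u = "(mean_factor x y ^^ n) (invq x y)"
  have "mean_estimate n x y - \<Phi> x y = gxy x y *v ?u"
    by (simp add: mean_estimate_def \<Phi>_def mean_inverse_invq matrix_vector_mult_diff_distrib)
  then have "norm (mean_estimate n x y - \<Phi> x y) \<le> Cgxy * norm ?u"
    using norm_mult_vec_le[OF bound_gxy[of x y] order_refl[of "norm ?u"]] by simp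
  then have "(norm (mean_estimate n x y - \<Phi> x y))\<^sup>2 \<le> (Cgxy * norm ?u)\<^sup>2"
    by (rule power_mono) simp
  also have "\<dots> = Cgxy\<^sup>2 * (norm ?u)\<^sup>2" by (rule power_mult_distrib)
  also have "\<dots> \<le> Cgxy\<^sup>2 * (\<rho> ^ n * (Cfy / lam)\<^sup>2)"
  proof (rule mult_left_mono)
    have "(norm ?u)\<^sup>2 \<le> \<rho> ^ n * (norm (invq x y))\<^sup>2" by (rule norm_mean_factor_power)
    also have "\<dots> \<le> \<rho> ^ n * (Cfy / lam)\<^sup>2"
      using \<rho>_bounds by (intro mult_left_mono power_mono norm_invq_le) auto
    finally show "(norm ?u)\<^sup>2 \<le> \<rho> ^ n * (Cfy / lam)\<^sup>2" .
  qed simp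
  finally show ?thesis by (simp only: power_mult_distrib mult_ac)
qed

text \<open>The random triple product is averaged in two stages: \<open>O_fy\<close> is frozen while
  the inverse estimate is averaged, and then \<open>correction\<close> is frozen while
  \<open>O_gxy\<close> is averaged.\<close>

definition correction where
  "correction r x y w = inverse_estimate r x y w (O_fy Orc (\<xi> (Call_fy r) w) x y)"

definition hessian_draws :: "nat \<Rightarrow> (oracle_call + nat) set" where
  "hessian_draws r = insert (Inl (Call_fy r)) (insert (Inr r) (gyy_draws r))"

lemma O_fy_moments:
  "(\<lambda>w. O_fy Orc (\<xi> (Call_fy r) w) x y) \<in> borel_measurable (draw_algebra {Inl (Call_fy r)})"
  "integrable M (\<lambda>w. O_fy Orc (\<xi> (Call_fy r) w) x y)"
  "(LINT w|M. O_fy Orc (\<xi> (Call_fy r) w) x y) = fy x y"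
  "integrable M (\<lambda>w. (norm (O_fy Orc (\<xi> (Call_fy r) w) x y))\<^sup>2)"
  "(LINT w|M. (norm (O_fy Orc (\<xi> (Call_fy r) w) x y))\<^sup>2) \<le> 2 * \<sigma>\<^sup>2 + 2 * Cfy\<^sup>2"
proof -
  note mom = second_moment_le[OF S borel_measurable_integrable[OF unbiased_oracleD(1)[OF orc_fy]]
      unbiased_oracleD(3,4)[OF orc_fy], of x y]
  show "(\<lambda>w. O_fy Orc (\<xi> (Call_fy r) w) x y) \<in> borel_measurable (draw_algebra {Inl (Call_fy r)})"
    by (rule oracle_measurable[OF orc_fy measurable_draw_seed]) auto
  show "integrable M (\<lambda>w. O_fy Orc (\<xi> (Call_fy r) w) x y)"
    by (rule seed_integrable[OF unbiased_oracleD(1)[OF orc_fy]])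
  show "(LINT w|M. O_fy Orc (\<xi> (Call_fy r) w) x y) = fy x y"
    using seed_integral[OF unbiased_oracleD(1)[OF orc_fy], of "Call_fy r" x y]
    by (simp only: unbiased_oracleD(2)[OF orc_fy])
  show "integrable M (\<lambda>w. (norm (O_fy Orc (\<xi> (Call_fy r) w) x y))\<^sup>2)"
    by (rule seed_integrable[OF mom(1)])
  have "(norm (fy x y))\<^sup>2 \<le> Cfy\<^sup>2" using bound_fy by (rule power_mono) simp
  then show "(LINT w|M. (norm (O_fy Orc (\<xi> (Call_fy r) w) x y))\<^sup>2) \<le> 2 * \<sigma>\<^sup>2 + 2 * Cfy\<^sup>2"
    using mom(2) unfolding seed_integral[OF mom(1)] by linarith
qed

lemma correction_moments:
  "correction r x y \<in> borel_measurable (draw_algebra (hessian_draws r))"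
  "integrable M (correction r x y)"
  "(LINT w|M. correction r x y w) = mean_inverse x y (k (r - 1)) (fy x y)"
  "integrable M (\<lambda>w. (norm (correction r x y w))\<^sup>2)"
  "(LINT w|M. (norm (correction r x y w))\<^sup>2) \<le> real (k (r - 1)) / (C * lam) * (2 * \<sigma>\<^sup>2 + 2 * Cfy\<^sup>2)"
proof -
  let ?X = "\<lambda>w. O_fy Orc (\<xi> (Call_fy r) w) x y"
  let ?J = "insert (Inr r) (gyy_draws r)"
  let ?c = "real (k (r - 1)) / (C * lam)"
  have c: "0 \<le> ?c" using C_pos lam_pos by simp
  have disj: "{Inl (Call_fy r)} \<inter> ?J = {}" by (auto simp: gyy_draws_def)
  show meas: "correction r x y \<in> borel_measurable (draw_algebra (hessian_draws r))"
  proof -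
    have "(\<lambda>w. (?X w, w))
        \<in> measurable (draw_algebra (hessian_draws r)) (borel \<Otimes>\<^sub>M draw_algebra (hessian_draws r))"
      using measurable_draw_mono[OF O_fy_moments(1)] by (auto simp: hessian_draws_def)
    moreover have "(\<lambda>(v, w). inverse_estimate r x y w v)
        \<in> borel_measurable (borel \<Otimes>\<^sub>M draw_algebra (hessian_draws r))"
      by (rule inverse_estimate_measurable) (auto simp: hessian_draws_def)
    ultimately have "(\<lambda>w. (\<lambda>(v, w). inverse_estimate r x y w v) (?X w, w))
        \<in> borel_measurable (draw_algebra (hessian_draws r))"
      by (rule measurable_compose)
    then show ?thesis by (simp add: correction_def[abs_def])
  qed
  have cp: "(\<lambda>(v, w). inverse_estimate r x y w v) \<in> borel_measurable (borel \<Otimes>\<^sub>M draw_algebra ?J)"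
    by (rule inverse_estimate_measurable) simp
  then have cp2: "(\<lambda>(v, w). (norm (inverse_estimate r x y w v))\<^sup>2)
      \<in> borel_measurable (borel \<Otimes>\<^sub>M draw_algebra ?J)"
    unfolding case_prod_unfold by measurable
  have I: "integrable M (\<lambda>w. ?c * (norm (?X w))\<^sup>2)" using O_fy_moments(4) by simp
  note bound = freeze_bound[OF O_fy_moments(1)[of r x y] disj cp2, of "\<lambda>v. ?c * (norm v)\<^sup>2",
      OF zero_le_power2 inverse_estimate_integrable(2) inverse_estimate_second_moment I]
  show int2: "integrable M (\<lambda>w. (norm (correction r x y w))\<^sup>2)"
    unfolding correction_def by (rule bound(1))
  have "(LINT w|M. (norm (correction r x y w))\<^sup>2) \<le> (LINT w|M. ?c * (norm (?X w))\<^sup>2)"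
    unfolding correction_def by (rule bound(2))
  also have "\<dots> = ?c * (LINT w|M. (norm (?X w))\<^sup>2)" by (rule integral_mult_right_zero)
  also have "\<dots> \<le> ?c * (2 * \<sigma>\<^sup>2 + 2 * Cfy\<^sup>2)" by (intro mult_left_mono O_fy_moments(5) c)
  finally show "(LINT w|M. (norm (correction r x y w))\<^sup>2) \<le> ?c * (2 * \<sigma>\<^sup>2 + 2 * Cfy\<^sup>2)" .
  show int: "integrable M (correction r x y)"
    by (rule integrable_norm_of_square[OF finite_measure_axioms measurable_drawD[OF meas] int2])
  have "(LINT w|M. correction r x y w) = (LINT w|M. (LINT w'|M. inverse_estimate r x y w' (?X w)))"
    using int unfolding correction_def[abs_def] by (rule freeze_integral[OF O_fy_moments(1) disj cp])
  also have "\<dots> = (LINT w|M. mean_inverse x y (k (r - 1)) (?X w))"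
    by (simp only: inverse_estimate_mean)
  also have "\<dots> = mean_inverse x y (k (r - 1)) (LINT w|M. ?X w)"
    by (rule integral_bounded_linear)
       (use linear_mean_inverse linear_conv_bounded_linear O_fy_moments(2) in blast)+
  finally show "(LINT w|M. correction r x y w) = mean_inverse x y (k (r - 1)) (fy x y)"
    by (simp only: O_fy_moments(3))
qed

lemma O_gxy_moments:
  "(\<lambda>(v, w). O_gxy Orc (\<xi> (Call_gxy r) w) x y *v v)
     \<in> borel_measurable (borel \<Otimes>\<^sub>M draw_algebra {Inl (Call_gxy r)})"
  "(LINT w|M. O_gxy Orc (\<xi> (Call_gxy r) w) x y *v v) = gxy x y *v v"
  "integrable M (\<lambda>w. (norm (O_gxy Orc (\<xi> (Call_gxy r) w) x y *v v))\<^sup>2)"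
  "(LINT w|M. (norm (O_gxy Orc (\<xi> (Call_gxy r) w) x y *v v))\<^sup>2) \<le> (2 * \<sigma>\<^sup>2 + 2 * Cgxy\<^sup>2) * (norm v)\<^sup>2"
proof -
  show "(\<lambda>(v, w). O_gxy Orc (\<xi> (Call_gxy r) w) x y *v v)
     \<in> borel_measurable (borel \<Otimes>\<^sub>M draw_algebra {Inl (Call_gxy r)})"
    unfolding case_prod_unfold
    by (intro measurable_mult_vec oracle_measurable[OF orc_gxy]
        measurable_compose[OF measurable_snd measurable_draw_seed]) auto
  show "(LINT w|M. O_gxy Orc (\<xi> (Call_gxy r) w) x y *v v) = gxy x y *v v"
    using seed_integral[OF oracle_mult_mean(1)[OF orc_gxy], of "Call_gxy r" x y v]
    by (simp only: oracle_mult_mean(2)[OF orc_gxy])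
  \<comment> \<open>The variance of this oracle is measured in the spectral norm, which is what
    controls its action on a fixed vector.\<close>
  have dom: "(norm (O_gxy Orc s x y *v v - gxy x y *v v))\<^sup>2
      \<le> (spectral_norm (O_gxy Orc s x y - gxy x y))\<^sup>2 * (norm v)\<^sup>2" for s
    unfolding matrix_vector_mult_diff_rdistrib[symmetric] power_mult_distrib[symmetric]
    by (intro power_mono norm_mult_vec_le_spectral) simp
  have I: "integrable S (\<lambda>s. (spectral_norm (O_gxy Orc s x y - gxy x y))\<^sup>2 * (norm v)\<^sup>2)"
    using unbiased_oracleD(3)[OF orc_gxy] by simp
  have m: "(\<lambda>s. O_gxy Orc s x y *v v) \<in> borel_measurable S"
    by (rule borel_measurable_integrable[OF oracle_mult_mean(1)[OF orc_gxy]])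
  have I2: "integrable S (\<lambda>s. (norm (O_gxy Orc s x y *v v - gxy x y *v v))\<^sup>2)"
    by (rule Bochner_Integration.integrable_bound[OF I]) (use dom m in auto)
  have "(LINT s|S. (norm (O_gxy Orc s x y *v v - gxy x y *v v))\<^sup>2)
      \<le> (LINT s|S. (spectral_norm (O_gxy Orc s x y - gxy x y))\<^sup>2 * (norm v)\<^sup>2)"
    by (intro integral_mono I I2 dom)
  also have "\<dots> \<le> \<sigma>\<^sup>2 * (norm v)\<^sup>2"
    using unbiased_oracleD(4)[OF orc_gxy] by (simp add: mult_right_mono)
  finally have le: "(LINT s|S. (norm (O_gxy Orc s x y *v v - gxy x y *v v))\<^sup>2) \<le> \<sigma>\<^sup>2 * (norm v)\<^sup>2" .
  note mom = second_moment_le[OF S m I2 le]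
  show "integrable M (\<lambda>w. (norm (O_gxy Orc (\<xi> (Call_gxy r) w) x y *v v))\<^sup>2)"
    by (rule seed_integrable[OF mom(1)])
  have "(norm (gxy x y *v v))\<^sup>2 \<le> (Cgxy * norm v)\<^sup>2"
    by (intro power_mono norm_mult_vec_le bound_gxy) auto
  then show "(LINT w|M. (norm (O_gxy Orc (\<xi> (Call_gxy r) w) x y *v v))\<^sup>2)
      \<le> (2 * \<sigma>\<^sup>2 + 2 * Cgxy\<^sup>2) * (norm v)\<^sup>2"
    using mom(2) unfolding seed_integral[OF mom(1)] by (simp add: power_mult_distrib algebra_simps)
qed

lemma product_moments:
  "integrable M (\<lambda>w. O_gxy Orc (\<xi> (Call_gxy r) w) x y *v correction r x y w)"
  "(LINT w|M. O_gxy Orc (\<xi> (Call_gxy r) w) x y *v correction r x y w)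
     = gxy x y *v mean_inverse x y (k (r - 1)) (fy x y)"
  "integrable M (\<lambda>w. (norm (O_gxy Orc (\<xi> (Call_gxy r) w) x y *v correction r x y w))\<^sup>2)"
  "(LINT w|M. (norm (O_gxy Orc (\<xi> (Call_gxy r) w) x y *v correction r x y w))\<^sup>2)
     \<le> moment_rate * real (k (r - 1))"
proof -
  let ?h = "\<lambda>v w. O_gxy Orc (\<xi> (Call_gxy r) w) x y *v v" and ?X = "correction r x y"
  let ?c = "2 * \<sigma>\<^sup>2 + 2 * Cgxy\<^sup>2"
  have disj: "hessian_draws r \<inter> {Inl (Call_gxy r)} = {}" by (auto simp: hessian_draws_def gyy_draws_def)
  have cp2: "(\<lambda>(v, w). (norm (?h v w))\<^sup>2)
      \<in> borel_measurable (borel \<Otimes>\<^sub>M draw_algebra {Inl (Call_gxy r)})"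
    using O_gxy_moments(1) unfolding case_prod_unfold by measurable
  have I: "integrable M (\<lambda>w. ?c * (norm (?X w))\<^sup>2)" using correction_moments(4) by simp
  note bound = freeze_bound[OF correction_moments(1)[of r x y] disj cp2, of "\<lambda>v. ?c * (norm v)\<^sup>2",
      OF zero_le_power2 O_gxy_moments(3,4) I]
  show int2: "integrable M (\<lambda>w. (norm (?h (?X w) w))\<^sup>2)" by (rule bound(1))
  have "(LINT w|M. (norm (?h (?X w) w))\<^sup>2) \<le> (LINT w|M. ?c * (norm (?X w))\<^sup>2)" by (rule bound(2))
  also have "\<dots> = ?c * (LINT w|M. (norm (?X w))\<^sup>2)" by (rule integral_mult_right_zero)
  also have "\<dots> \<le> ?c * (real (k (r - 1)) / (C * lam) * (2 * \<sigma>\<^sup>2 + 2 * Cfy\<^sup>2))"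
    by (intro mult_left_mono correction_moments(5)) simp
  finally show "(LINT w|M. (norm (?h (?X w) w))\<^sup>2) \<le> moment_rate * real (k (r - 1))"
    by (simp add: moment_rate_def mult_ac)
  have m: "(\<lambda>w. ?h (?X w) w) \<in> borel_measurable M"
    by (intro measurable_mult_vec measurable_drawD[OF correction_moments(1)]
        oracle_measurable[OF orc_gxy measurable_seed]) auto
  show int: "integrable M (\<lambda>w. ?h (?X w) w)"
    by (rule integrable_norm_of_square[OF finite_measure_axioms m int2])
  have "(LINT w|M. ?h (?X w) w) = (LINT w|M. (LINT w'|M. ?h (?X w) w'))"
    by (rule freeze_integral[OF correction_moments(1) disj O_gxy_moments(1) int])
  also have "\<dots> = (LINT w|M. gxy x y *v ?X w)" by (simp only: O_gxy_moments(2))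
  also have "\<dots> = gxy x y *v (LINT w|M. ?X w)"
    by (rule integral_bounded_linear[OF _ correction_moments(2)]) simp
  finally show "(LINT w|M. ?h (?X w) w) = gxy x y *v mean_inverse x y (k (r - 1)) (fy x y)"
    by (simp only: correction_moments(3))
qed

lemma estimate_eq:
  "estimate r x y w = O_fx Orc (\<xi> (Call_fx r) w) x y - O_gxy Orc (\<xi> (Call_gxy r) w) x y *v correction r x y w"
  unfolding smb_estimate_def correction_def inverse_estimate_def by simp

lemma estimate_moments:
  "integrable M (estimate r x y)"
  "(LINT w|M. estimate r x y w) = mean_estimate (k (r - 1)) x y"
  "integrable M (\<lambda>w. (norm (estimate r x y w - mean_estimate (k (r - 1)) x y))\<^sup>2)"
  "(LINT w|M. (norm (estimate r x y w - mean_estimate (k (r - 1)) x y))\<^sup>2)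
     \<le> 2 * \<sigma>\<^sup>2 + 2 * (moment_rate * real (k (r - 1)))"
proof -
  let ?f = "\<lambda>w. O_fx Orc (\<xi> (Call_fx r) w) x y"
  let ?W = "\<lambda>w. O_gxy Orc (\<xi> (Call_gxy r) w) x y *v correction r x y w"
  let ?m = "gxy x y *v mean_inverse x y (k (r - 1)) (fy x y)"
  have f: "integrable M ?f" "(LINT w|M. ?f w) = fx x y"
    using seed_integrable[OF unbiased_oracleD(1)[OF orc_fx], of "Call_fx r" x y]
      seed_integral[OF unbiased_oracleD(1)[OF orc_fx], of "Call_fx r" x y]
    by (simp_all only: unbiased_oracleD(2)[OF orc_fx])
  have f2: "integrable M (\<lambda>w. (norm (?f w - fx x y))\<^sup>2)"
      "(LINT w|M. (norm (?f w - fx x y))\<^sup>2) \<le> \<sigma>\<^sup>2"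
    using seed_integrable[OF unbiased_oracleD(3)[OF orc_fx], of "Call_fx r" x y]
      seed_integral[OF unbiased_oracleD(3)[OF orc_fx], of "Call_fx r" x y]
      unbiased_oracleD(4)[OF orc_fx, of x y] by simp_all
  show int: "integrable M (estimate r x y)"
    unfolding estimate_eq using f product_moments(1) by simp
  show "(LINT w|M. estimate r x y w) = mean_estimate (k (r - 1)) x y"
    unfolding estimate_eq mean_estimate_def using f product_moments(1,2) by simp
  note cent = centered_second_moment[OF prob_space_axioms product_moments(1,3,2), of r x y]
  have sq: "(norm (estimate r x y w - mean_estimate (k (r - 1)) x y))\<^sup>2
      \<le> 2 * (norm (?f w - fx x y))\<^sup>2 + 2 * (norm (?W w - ?m))\<^sup>2" for w
  proof -
    have "estimate r x y w - mean_estimate (k (r - 1)) x y = (?f w - fx x y) + - (?W w - ?m)"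
      unfolding estimate_eq mean_estimate_def by simp
    then show ?thesis using norm_add_sq_le[of "?f w - fx x y" "- (?W w - ?m)"]
      by (simp only: norm_minus_cancel)
  qed
  have I: "integrable M (\<lambda>w. 2 * (norm (?f w - fx x y))\<^sup>2 + 2 * (norm (?W w - ?m))\<^sup>2)"
    using f2(1) cent(1) by simp
  show I2: "integrable M (\<lambda>w. (norm (estimate r x y w - mean_estimate (k (r - 1)) x y))\<^sup>2)"
    by (rule Bochner_Integration.integrable_bound[OF I]) (use int sq in auto)
  have "(LINT w|M. (norm (estimate r x y w - mean_estimate (k (r - 1)) x y))\<^sup>2)
      \<le> (LINT w|M. 2 * (norm (?f w - fx x y))\<^sup>2 + 2 * (norm (?W w - ?m))\<^sup>2)"
    by (intro integral_mono I I2 sq)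
  also have "\<dots> = 2 * (LINT w|M. (norm (?f w - fx x y))\<^sup>2) + 2 * (LINT w|M. (norm (?W w - ?m))\<^sup>2)"
    using f2(1) cent(1) by simp
  \<comment> \<open>Centering only lowers the second moment, so the raw bound for the product also
    bounds its variance.\<close>
  also have "\<dots> \<le> 2 * \<sigma>\<^sup>2 + 2 * (moment_rate * real (k (r - 1)))"
    using f2(2) cent(2) product_moments(4)[of r x y] zero_le_power2[of "norm ?m"] by linarith
  finally show "(LINT w|M. (norm (estimate r x y w - mean_estimate (k (r - 1)) x y))\<^sup>2)
      \<le> 2 * \<sigma>\<^sup>2 + 2 * (moment_rate * real (k (r - 1)))" .
qed

end

section \<open>One iteration\<close>

lemma integrable_dominated:
  fixes f g :: "'a \<Rightarrow> real"
  assumes "integrable M g" "f \<in> borel_measurable M" "\<And>w. w \<in> space M \<Longrightarrow> 0 \<le> f w"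
    "\<And>w. w \<in> space M \<Longrightarrow> f w \<le> g w"
  shows "integrable M f"
  by (rule Bochner_Integration.integrable_bound[OF assms(1,2)])
     (use assms(3,4) in \<open>auto intro!: AE_I2 order_trans[OF _ abs_ge_self]\<close>)

text \<open>The weight \<open>2 * c\<close> on \<open>D\<close> turns its decay rate
  \<open>s / 2\<close> into \<open>c * s * D t\<close>: one half pays for the error term in the
  inequality for \<open>F\<close>, the other half stays in the sum. All terms in \<open>Z\<close>
  must fit into the \<open>c * s / 4 * Z t\<close> gained by \<open>F\<close>, which is the content
  of \<open>small\<close>. There \<open>1 / \<mu>\<close> stems from the weight on \<open>d\<close>,
  and the 1 next to it from the inequality for \<open>D\<close> referring to
  \<open>d (Suc t)\<close> instead of \<open>d t\<close>.\<close>

lemma potential_descent_sum: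
  fixes F D d Z G :: "nat \<Rightarrow> real"
  assumes nonneg: "\<And>t. 0 \<le> F t" "\<And>t. 0 \<le> D t" "\<And>t. 0 \<le> d t" "\<And>t. 0 \<le> Z t"
    and s: "0 < s" "s \<le> 1"
    and c: "0 < c" "0 < \<mu>" "0 \<le> \<kappa>" "0 \<le> \<nu>" "0 \<le> \<tau>"
    and F: "\<And>t. F (Suc t) + c * s / 2 * G t + c * s / 4 * Z t \<le> F t + c * s / 2 * D t"
    and d: "\<And>t. d (Suc t) \<le> (1 - \<mu> * s) * d t + \<kappa> * s * Z t + \<tau> * s\<^sup>2"
    and D: "\<And>t. D (Suc t) \<le> (1 - s / 2) * D t + \<alpha> * s * Z t + \<nu> * s * d (Suc t) + e * s\<^sup>2"
    and small: "2 * \<alpha> + 2 * \<kappa> * \<nu> * (1 / \<mu> + 1) \<le> 1 / 4"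
  shows "c * s / 2 * (\<Sum>t\<le>T. G t + D t) \<le> F 0 + 2 * c * D 0 + 2 * c * \<nu> / \<mu> * d 0
    + real (T + 1) * (s\<^sup>2 * (2 * c * e + 2 * c * \<nu> * (1 / \<mu> + 1) * \<tau>))"
proof -
  define B where "B = 2 * c * \<nu> / \<mu>"
  define E where "E = s\<^sup>2 * (2 * c * e + 2 * c * \<nu> * (1 / \<mu> + 1) * \<tau>)"
  define P where "P t = F t + 2 * c * D t + B * d t" for t
  have B: "0 \<le> B" "B * \<mu> = 2 * c * \<nu>" using c by (auto simp: B_def)
  \<comment> \<open>\<open>B\<close> is chosen so that the decay of \<open>B * d t\<close> absorbs the effect of \<open>d (Suc t)\<close> on \<open>D\<close>\<close>
  have step: "P (Suc t) + c * s / 2 * (G t + D t) \<le> P t + E" for t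
  proof -
    have 1: "2 * c * D (Suc t)
        \<le> 2 * c * ((1 - s / 2) * D t + \<alpha> * s * Z t + \<nu> * s * d (Suc t) + e * s\<^sup>2)"
      using c by (intro mult_left_mono D) auto
    have 2: "B * d (Suc t) \<le> B * ((1 - \<mu> * s) * d t + \<kappa> * s * Z t + \<tau> * s\<^sup>2)"
      using B by (intro mult_left_mono d)
    have Bd: "B * ((1 - \<mu> * s) * d t + \<kappa> * s * Z t + \<tau> * s\<^sup>2)
        = B * d t - (B * \<mu>) * s * d t + B * \<kappa> * s * Z t + B * \<tau> * s\<^sup>2"
      by (simp add: algebra_simps)
    have "s * (\<kappa> * Z t) \<le> \<kappa> * Z t" "0 \<le> \<mu> * s * d t"
      using s c nonneg by (auto intro!: mult_left_le_one_le)
    \<comment> \<open>A crude bound is enough: \<open>d (Suc t)\<close> enters the inequality for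
      \<open>D\<close> with another factor \<open>s\<close>, so \<open>\<tau> * s\<close> still ends
      at order \<open>s\<^sup>2\<close>.\<close>
    have "d (Suc t) \<le> d t + \<kappa> * Z t + \<tau> * s"
    proof -
      have "\<tau> * s * s \<le> \<tau> * s" using s c by (intro mult_right_le_one_le) auto
      then show ?thesis
        using d[of t] \<open>s * (\<kappa> * Z t) \<le> \<kappa> * Z t\<close> \<open>0 \<le> \<mu> * s * d t\<close>
        by (simp add: algebra_simps power2_eq_square)
    qed
    then have "2 * c * \<nu> * s * d (Suc t) \<le> 2 * c * \<nu> * s * (d t + \<kappa> * Z t + \<tau> * s)"
      using c s by (intro mult_left_mono) auto
    then have 3: "2 * c * \<nu> * s * d (Suc t)
        \<le> 2 * c * \<nu> * s * d t + 2 * c * \<nu> * \<kappa> * s * Z t + 2 * c * \<nu> * \<tau> * s\<^sup>2"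
      by (simp add: algebra_simps power2_eq_square)
    have "(c * s * Z t) * (2 * \<alpha> + 2 * \<kappa> * \<nu> * (1 / \<mu> + 1)) \<le> (c * s * Z t) * (1 / 4)"
      using c s nonneg by (intro mult_left_mono small) auto
    moreover have "(c * s * Z t) * (2 * \<alpha> + 2 * \<kappa> * \<nu> * (1 / \<mu> + 1))
        = 2 * c * \<alpha> * s * Z t + B * \<kappa> * s * Z t + 2 * c * \<nu> * \<kappa> * s * Z t"
      by (simp add: B_def algebra_simps)
    ultimately have 4: "2 * c * \<alpha> * s * Z t + B * \<kappa> * s * Z t + 2 * c * \<nu> * \<kappa> * s * Z t
        \<le> c * s / 4 * Z t"
      by simp
    have 5: "E = 2 * c * e * s\<^sup>2 + B * \<tau> * s\<^sup>2 + 2 * c * \<nu> * \<tau> * s\<^sup>2"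
      by (simp add: E_def B_def algebra_simps)
    have 6: "2 * c * ((1 - s / 2) * D t + \<alpha> * s * Z t + \<nu> * s * d (Suc t) + e * s\<^sup>2)
        = 2 * c * D t - c * s * D t + 2 * c * \<alpha> * s * Z t + 2 * c * \<nu> * s * d (Suc t) + 2 * c * e * s\<^sup>2"
      by (simp add: algebra_simps)
    have 7: "c * s / 2 * (G t + D t) = c * s / 2 * G t + c * s / 2 * D t" by (simp add: algebra_simps)
    have 8: "c * s / 2 * D t + c * s / 2 * D t = c * s * D t" by simp
    show ?thesis using 1 2 3 4 F[of t] 8 unfolding Bd B(2) 5 6 7 P_def by linarith
  qed
  have "P (Suc T) + c * s / 2 * (\<Sum>t\<le>T. G t + D t) \<le> P 0 + real (T + 1) * E" for T
  proof (induction T)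
    case 0
    then show ?case using step[of 0] by simp
  next
    case (Suc T)
    then show ?case using step[of "Suc T"] by (simp add: distrib_left distrib_right)
  qed
  moreover have "0 \<le> P (Suc T)" using nonneg B c by (simp add: P_def)
  ultimately show ?thesis by (smt (verit) P_def B_def E_def)
qed

section \<open>Draws ordered by rounds\<close>

primrec call_round :: "oracle_call \<Rightarrow> nat" where
  "call_round (Call_fx r) = r"
| "call_round (Call_fy r) = r"
| "call_round (Call_gy r) = r"
| "call_round (Call_gxy r) = r"
| "call_round (Call_gyy r i) = r"

text \<open>The information available after \<open>t\<close> iterations. The iterates are adapted to
  \<open>draw_algebra (past t)\<close>, and the draws of round \<open>Suc t\<close> are independent
  of it.\<close>

definition past :: "nat \<Rightarrow> (oracle_call + nat) set" where
  "past t = {j. case_sum call_round id j \<le> t}"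

lemma past_iff [simp]: "Inl c \<in> past t \<longleftrightarrow> call_round c \<le> t" "Inr r \<in> past t \<longleftrightarrow> r \<le> t"
  by (simp_all add: past_def)

lemma past_mono: "t \<le> t' \<Longrightarrow> past t \<subseteq> past t'"
  by (auto simp: past_def)

section \<open>Deterministic one-step inequalities\<close>

context bilevel
begin

lemma continuous_DF: "continuous_on UNIV DF"
  using DF_lipschitz LF_nonneg
  by (intro lipschitz_on_continuous_on[of LF] lipschitz_onI) (auto simp: dist_norm)

lemma continuous_ystar: "continuous_on UNIV ystar"
  using ystar_lipschitz Lstar_nonneg
  by (intro lipschitz_on_continuous_on[of Lstar] lipschitz_onI) (auto simp: dist_norm)

lemma continuous_objective: "continuous_on UNIV F"
  using objective_has_gradient unfolding gderiv_def
  by (meson continuous_at_imp_continuous_on has_derivative_continuous)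

lemma measurable_DF [measurable]: "DF \<in> borel_measurable borel"
  and measurable_ystar [measurable]: "ystar \<in> borel_measurable borel"
  and measurable_objective [measurable]: "F \<in> borel_measurable borel"
  using continuous_DF continuous_ystar continuous_objective
  by (auto intro: borel_measurable_continuous_onI)

lemma measurable_projection [measurable]: "closest_point Y \<in> borel_measurable borel"
  by (intro borel_measurable_continuous_onI continuous_on_closest_point Y)

text \<open>Polarization splits \<open>\<eta> * (z \<bullet> DF x)\<close> into squares. The
  quadratic remainder consumes half of the resulting \<open>\<eta> / 2 * (norm z)\<^sup>2\<close>;
  the other half is kept to pay for the moving reference points.\<close>

lemma descent_step:
  assumes "0 \<le> \<eta>" "KF * \<eta> \<le> 1 / 4"
  shows "F (x - \<eta> *\<^sub>R z) + \<eta> / 2 * (norm (DF x))\<^sup>2 + \<eta> / 4 * (norm z)\<^sup>2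
    \<le> F x + \<eta> / 2 * (norm (z - DF x))\<^sup>2"
proof -
  have "F (x - \<eta> *\<^sub>R z) \<le> F x - \<eta> * (z \<bullet> DF x) + KF * \<eta> * (\<eta> * (norm z)\<^sup>2)"
    using objective_quadratic_remainder[of "x - \<eta> *\<^sub>R z" x]
    by (simp add: power_mult_distrib power2_eq_square mult_ac)
  moreover have "KF * \<eta> * (\<eta> * (norm z)\<^sup>2) \<le> 1 / 4 * (\<eta> * (norm z)\<^sup>2)"
    using assms by (intro mult_right_mono) auto
  moreover have "\<eta> / 2 * (norm (z - DF x))\<^sup>2
      = \<eta> / 2 * (norm z)\<^sup>2 - \<eta> * (z \<bullet> DF x) + \<eta> / 2 * (norm (DF x))\<^sup>2"
    by (simp add: power2_norm_eq_inner inner_diff_left inner_diff_right inner_commute algebra_simps)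
  ultimately show ?thesis by linarith
qed

text \<open>Expanding the square gives the strong monotonicity gain twice. The bound on
  \<open>\<eta>\<close> spends one copy on the quadratic term, which Lipschitz continuity of
  \<open>gy\<close> and stationarity at \<open>ystar x\<close> control.\<close>

lemma gradient_step_contraction:
  assumes "0 \<le> \<eta>" "\<eta> * Lgy\<^sup>2 \<le> lam"
  shows "(norm (y - ystar x + (- \<eta>) *\<^sub>R gy x y))\<^sup>2 \<le> (1 - \<eta> * lam) * (norm (y - ystar x))\<^sup>2"
proof -
  let ?e = "y - ystar x"
  have mono: "lam * (norm ?e)\<^sup>2 \<le> ?e \<bullet> gy x y"
    using gy_monotone[of y "ystar x" x] by (simp add: inactive)
  have "norm (gy x y) \<le> Lgy * norm ?e"
    using gy_lipschitz[of x y x "ystar x"] by (simp add: inactive)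
  then have "(norm (gy x y))\<^sup>2 \<le> (Lgy * norm ?e)\<^sup>2" by (rule power_mono) simp
  then have "\<eta> * (\<eta> * (norm (gy x y))\<^sup>2) \<le> \<eta> * (\<eta> * (Lgy * norm ?e)\<^sup>2)"
    using assms(1) by (intro mult_left_mono) auto
  also have "\<dots> = \<eta> * ((\<eta> * Lgy\<^sup>2) * (norm ?e)\<^sup>2)" by (simp add: power_mult_distrib mult_ac)
  also have "\<dots> \<le> \<eta> * (lam * (norm ?e)\<^sup>2)"
    using assms by (intro mult_left_mono mult_right_mono) auto
  finally have sq: "\<eta>\<^sup>2 * (norm (gy x y))\<^sup>2 \<le> \<eta> * (lam * (norm ?e)\<^sup>2)"
    by (simp add: power2_eq_square mult_ac)
  have "\<eta> * (lam * (norm ?e)\<^sup>2) \<le> \<eta> * (?e \<bullet> gy x y)"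
    using mono assms(1) by (rule mult_left_mono)
  then show ?thesis
    unfolding norm_add_scaleR_sq using sq by (simp add: algebra_simps)
qed

lemma projection_contraction: "norm (closest_point Y u - ystar x) \<le> norm (u - ystar x)"
  using closest_point_lipschitz[OF Y, of u "ystar x"] closest_point_self[OF ystar_mem]
  by (simp add: dist_norm)

end

section \<open>One-step inequalities in mean along the iterates\<close>

context smb_setup
begin

definition estimate_draws :: "nat \<Rightarrow> (oracle_call + nat) set" where
  "estimate_draws r = insert (Inl (Call_fx r)) (insert (Inl (Call_gxy r)) (hessian_draws r))"

lemma estimate_draws_past: "estimate_draws r \<subseteq> past r" "past t \<inter> estimate_draws (Suc t) = {}"
  by (auto simp: estimate_draws_def hessian_draws_def gyy_draws_def)

text \<open>The outcome enters through a map \<open>T\<close> so that the lemma serves twice: with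
  the identity for the iterates themselves, and with \<open>snd\<close> on a product space where the
  state is frozen.\<close>

lemma estimate_measurable:
  assumes X: "X \<in> borel_measurable Q" and Z: "Z \<in> borel_measurable Q"
    and T: "T \<in> measurable Q (draw_algebra J)" and J: "estimate_draws r \<subseteq> J"
  shows "(\<lambda>q. estimate r (X q) (Z q) (T q)) \<in> borel_measurable Q"
proof -
  have seed: "(\<lambda>q. \<xi> c (T q)) \<in> measurable Q S" if "Inl c \<in> estimate_draws r" for c
    using that J by (intro measurable_compose[OF T measurable_draw_seed]) auto
  have len: "(\<lambda>q. p r (T q)) \<in> measurable Q (count_space UNIV)"
    using J by (intro measurable_compose[OF T measurable_draw_length])
      (auto simp: estimate_draws_def hessian_draws_def)
  have [measurable]: "(\<lambda>q. O_fx Orc (\<xi> (Call_fx r) (T q)) (X q) (Z q)) \<in> borel_measurable Q"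
    "(\<lambda>q. O_fy Orc (\<xi> (Call_fy r) (T q)) (X q) (Z q)) \<in> borel_measurable Q"
    "(\<lambda>q. O_gxy Orc (\<xi> (Call_gxy r) (T q)) (X q) (Z q)) \<in> borel_measurable Q"
    by (rule oracle_measurable[OF _ seed X Z], rule orc_fx orc_fy orc_gxy,
        simp add: estimate_draws_def hessian_draws_def)+
  have "(\<lambda>q. neumann_prod C (\<lambda>i. O_gyy Orc (\<xi> (Call_gyy r i) (T q)) (X q) (Z q)) n
      *v O_fy Orc (\<xi> (Call_fy r) (T q)) (X q) (Z q)) \<in> borel_measurable Q" for n
    by (rule neumann_prod_measurable[OF orc_gyy, of _ "\<lambda>i q. \<xi> (Call_gyy r i) (T q)"])
       (auto intro!: seed X Z simp: estimate_draws_def hessian_draws_def gyy_draws_def)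
  then have [measurable]: "(\<lambda>q. neumann_prod C (\<lambda>i. O_gyy Orc (\<xi> (Call_gyy r i) (T q)) (X q) (Z q)) (p r (T q))
      *v O_fy Orc (\<xi> (Call_fy r) (T q)) (X q) (Z q)) \<in> borel_measurable Q"
    using len by (rule measurable_compose_countable)
  show ?thesis
    unfolding smb_estimate_def smb_h_def scaleR_matrix_vector_assoc[symmetric]
    by measurable
qed

text \<open>\<open>b\<close> and \<open>V\<close> summarize what the recursions need to know about
  the lengths \<open>k t\<close>: a squared bias and a variance, uniform over rounds.\<close>

context
  fixes \<gamma> \<eta>x \<eta>y b V Fmin :: real and x0 :: "real^'d" and y0 :: "real^'e"
  assumes \<gamma>: "0 < \<gamma>" "\<gamma> \<le> 1" and \<eta>x: "0 < \<eta>x" "KF * \<eta>x \<le> 1 / 4"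
    and \<eta>y: "0 < \<eta>y" "\<eta>y * Lgy\<^sup>2 \<le> lam" "\<eta>y * lam \<le> 1"
    and bias_le: "\<And>t. (Cgxy * (Cfy / lam))\<^sup>2 * \<rho> ^ k t \<le> b"
    and variance_le: "\<And>t. 2 * \<sigma>\<^sup>2 + 2 * (moment_rate * real (k t)) \<le> V"
    and Fmin: "\<And>x. Fmin \<le> F x"
begin

abbreviation "xs t w \<equiv> smb_x Orc C Y (1 - \<gamma>) \<eta>x \<eta>y k x0 y0 (\<lambda>c. \<xi> c w) (\<lambda>r. p r w) t"
abbreviation "zs t w \<equiv> smb_z Orc C Y (1 - \<gamma>) \<eta>x \<eta>y k x0 y0 (\<lambda>c. \<xi> c w) (\<lambda>r. p r w) t"
abbreviation "ys t w \<equiv> fst (snd (smb Orc C Y (1 - \<gamma>) \<eta>x \<eta>y k x0 y0 (\<lambda>c. \<xi> c w) (\<lambda>r. p r w) t))"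

lemma zs_Suc: "zs (Suc t) w = (1 - \<gamma>) *\<^sub>R zs t w + \<gamma> *\<^sub>R estimate (Suc t) (xs t w) (ys t w) w"
  and xs_Suc: "xs (Suc t) w = xs t w - \<eta>x *\<^sub>R zs (Suc t) w"
  and ys_Suc: "ys (Suc t) w = closest_point Y (ys t w - \<eta>y *\<^sub>R O_gy Orc (\<xi> (Call_gy (Suc t)) w) (xs t w) (ys t w))"
  by (simp_all add: smb_x_def smb_z_def Let_def split: prod.split)

lemma iterates_0: "xs 0 w = x0" "ys 0 w = y0" "zs 0 w = estimate 0 x0 y0 w"
  by (simp_all add: smb_x_def smb_z_def)

lemma iterates_measurable:
  "xs t \<in> borel_measurable (draw_algebra (past t))"
  "ys t \<in> borel_measurable (draw_algebra (past t))"
  "zs t \<in> borel_measurable (draw_algebra (past t))"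
proof (induction t)
  case 0
  have "(\<lambda>w. estimate 0 x0 y0 w) \<in> borel_measurable (draw_algebra (past 0))"
    by (rule estimate_measurable[where T = "\<lambda>w. w" and J = "past 0"]) (auto simp: estimate_draws_past(1))
  then show "xs 0 \<in> borel_measurable (draw_algebra (past 0))"
    "ys 0 \<in> borel_measurable (draw_algebra (past 0))"
    "zs 0 \<in> borel_measurable (draw_algebra (past 0))"
    by (simp_all only: iterates_0) auto
next
  case (Suc t)
  note [measurable] = Suc.IH[THEN measurable_draw_mono[OF _ past_mono[of t "Suc t"]], simplified]
  have [measurable]: "(\<lambda>w. estimate (Suc t) (xs t w) (ys t w) w)
      \<in> borel_measurable (draw_algebra (past (Suc t)))"
    by (rule estimate_measurable[where T = "\<lambda>w. w" and J = "past (Suc t)"]) (auto simp: estimate_draws_past(1))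
  have [measurable]: "(\<lambda>w. O_gy Orc (\<xi> (Call_gy (Suc t)) w) (xs t w) (ys t w))
      \<in> borel_measurable (draw_algebra (past (Suc t)))"
    by (rule oracle_measurable[OF orc_gy measurable_draw_seed]) auto
  show z: "zs (Suc t) \<in> borel_measurable (draw_algebra (past (Suc t)))"
    unfolding zs_Suc by measurable
  then show "xs (Suc t) \<in> borel_measurable (draw_algebra (past (Suc t)))"
    unfolding xs_Suc by measurable
  show "ys (Suc t) \<in> borel_measurable (draw_algebra (past (Suc t)))"
    unfolding ys_Suc by measurable
qed

lemmas iterates_measurable' [measurable] = iterates_measurable[THEN measurable_drawD]

text \<open>The estimate of round \<open>t + 1\<close> is averaged out while the state after \<open>t\<close> steps is
  frozen; its variance enters only with the factor \<open>\<gamma>\<^sup>2\<close>.\<close>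

lemma tracking_error_step:
  assumes int: "integrable M (\<lambda>w. (norm (zs t w - DF (xs t w)))\<^sup>2)"
      "integrable M (\<lambda>w. (norm (ys t w - ystar (xs t w)))\<^sup>2)"
  shows "integrable M (\<lambda>w. (norm (zs (Suc t) w - DF (xs t w)))\<^sup>2)"
    "(LINT w|M. (norm (zs (Suc t) w - DF (xs t w)))\<^sup>2)
      \<le> (1 - \<gamma>) * (LINT w|M. (norm (zs t w - DF (xs t w)))\<^sup>2)
        + 2 * \<gamma> * L\<Phi>\<^sup>2 * (LINT w|M. (norm (ys t w - ystar (xs t w)))\<^sup>2) + 2 * \<gamma> * b + \<gamma>\<^sup>2 * V"
proof -
  let ?X = "\<lambda>w. (xs t w, ys t w, zs t w)"
  define h where "h = (\<lambda>(x, y, z) w. (norm (((1 - \<gamma>) *\<^sub>R z - DF x) + \<gamma> *\<^sub>R estimate (Suc t) x y w))\<^sup>2)"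
  define U where "U = (\<lambda>(x, y, z). (1 - \<gamma>) * (norm (z - DF x))\<^sup>2
      + 2 * \<gamma> * L\<Phi>\<^sup>2 * (norm (y - ystar x))\<^sup>2 + 2 * \<gamma> * b + \<gamma>\<^sup>2 * V)"
  have X: "?X \<in> measurable (draw_algebra (past t)) (borel \<Otimes>\<^sub>M borel \<Otimes>\<^sub>M borel)"
    using iterates_measurable[of t] by (intro measurable_Pair)
  have hm: "case_prod h \<in> borel_measurable ((borel \<Otimes>\<^sub>M borel \<Otimes>\<^sub>M borel) \<Otimes>\<^sub>M draw_algebra (estimate_draws (Suc t)))"
  proof -
    have [measurable]: "(\<lambda>q. estimate (Suc t) (fst (fst q)) (fst (snd (fst q))) (snd q))
        \<in> borel_measurable ((borel \<Otimes>\<^sub>M borel \<Otimes>\<^sub>M (borel :: (real^'d) measure)) \<Otimes>\<^sub>M draw_algebra (estimate_draws (Suc t)))"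
      by (rule estimate_measurable[where T = snd and J = "estimate_draws (Suc t)"]) auto
    show ?thesis unfolding h_def case_prod_unfold by measurable
  qed
  have sec: "integrable M (h q)" "(LINT w|M. h q w) \<le> U q" for q
  proof -
    obtain x y z where q: "q = (x, y, z)" by (cases q)
    let ?m = "mean_estimate (k (Suc t - 1)) x y"
    note bv = bias_variance[OF prob_space_axioms estimate_moments(1,3,2)[of "Suc t" x y],
        of "(1 - \<gamma>) *\<^sub>R z - DF x" \<gamma>]
    show "integrable M (h q)" unfolding q h_def prod.case by (rule bv(1))
    \<comment> \<open>Splitting \<open>DF x\<close> with the weights \<open>1 - \<gamma>\<close> and
      \<open>\<gamma>\<close> exhibits a convex combination, so the old error keeps exactly the
      factor \<open>1 - \<gamma>\<close>.\<close>
    have "(norm ((1 - \<gamma>) *\<^sub>R z - DF x + \<gamma> *\<^sub>R ?m))\<^sup>2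
        = (norm ((1 - \<gamma>) *\<^sub>R (z - DF x) + \<gamma> *\<^sub>R (?m - DF x)))\<^sup>2"
      by (rule arg_cong[of _ _ "\<lambda>v. (norm v)\<^sup>2"]) (simp add: algebra_simps)
    also have "\<dots> \<le> (1 - \<gamma>) * (norm (z - DF x))\<^sup>2 + \<gamma> * (norm (?m - DF x))\<^sup>2"
      using \<gamma> by (intro norm_convex_combination_sq_le) auto
    also have "\<dots> \<le> (1 - \<gamma>) * (norm (z - DF x))\<^sup>2 + \<gamma> * (2 * b + 2 * (L\<Phi> * norm (y - ystar x))\<^sup>2)"
    proof -
      \<comment> \<open>Two sources of bias: truncation of the Neumann series, and evaluation at
        \<open>y\<close> in place of \<open>ystar x\<close>.\<close>
      have "(norm (?m - DF x))\<^sup>2 \<le> 2 * (norm (?m - \<Phi> x y))\<^sup>2 + 2 * (norm (\<Phi> x y - DF x))\<^sup>2"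
        using norm_add_sq_le[of "?m - \<Phi> x y" "\<Phi> x y - DF x"] by simp
      moreover have "(norm (?m - \<Phi> x y))\<^sup>2 \<le> b"
        using estimate_bias[of "k (Suc t - 1)" x y] bias_le[of t] by simp
      moreover have "(norm (\<Phi> x y - DF x))\<^sup>2 \<le> (L\<Phi> * norm (y - ystar x))\<^sup>2"
        using \<Phi>_lipschitz[of x y x "ystar x"] by (intro power_mono) (auto simp: DF_def)
      ultimately show ?thesis using \<gamma> by (intro add_left_mono mult_left_mono) auto
    qed
    finally have "(norm ((1 - \<gamma>) *\<^sub>R z - DF x + \<gamma> *\<^sub>R ?m))\<^sup>2
      \<le> (1 - \<gamma>) * (norm (z - DF x))\<^sup>2 + \<gamma> * (2 * b + 2 * (L\<Phi> * norm (y - ystar x))\<^sup>2)" .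
    moreover have "\<gamma>\<^sup>2 * (LINT w|M. (norm (estimate (Suc t) x y w - ?m))\<^sup>2) \<le> \<gamma>\<^sup>2 * V"
      using estimate_moments(4)[of "Suc t" x y] variance_le[of t]
      by (intro mult_left_mono) auto
    ultimately show "(LINT w|M. h q w) \<le> U q"
      unfolding q h_def U_def prod.case bv(2) by (simp add: power_mult_distrib algebra_simps)
  qed
  have UI: "integrable M (\<lambda>w. U (?X w))" unfolding U_def prod.case using int by simp
  have hX: "h (?X w) w = (norm (zs (Suc t) w - DF (xs t w)))\<^sup>2" for w
    unfolding h_def zs_Suc prod.case by (simp add: algebra_simps)
  have nn: "0 \<le> h q w" for q w by (simp add: h_def case_prod_unfold)
  note fb = freeze_bound[OF X estimate_draws_past(2) hm nn sec UI]
  show "integrable M (\<lambda>w. (norm (zs (Suc t) w - DF (xs t w)))\<^sup>2)"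
    using fb(1) by (simp only: hX)
  have "(LINT w|M. U (?X w)) = (1 - \<gamma>) * (LINT w|M. (norm (zs t w - DF (xs t w)))\<^sup>2)
        + 2 * \<gamma> * L\<Phi>\<^sup>2 * (LINT w|M. (norm (ys t w - ystar (xs t w)))\<^sup>2) + 2 * \<gamma> * b + \<gamma>\<^sup>2 * V"
    unfolding U_def prod.case using int by (simp add: prob_space)
  then show "(LINT w|M. (norm (zs (Suc t) w - DF (xs t w)))\<^sup>2)
      \<le> (1 - \<gamma>) * (LINT w|M. (norm (zs t w - DF (xs t w)))\<^sup>2)
        + 2 * \<gamma> * L\<Phi>\<^sup>2 * (LINT w|M. (norm (ys t w - ystar (xs t w)))\<^sup>2) + 2 * \<gamma> * b + \<gamma>\<^sup>2 * V"
    using fb(2) by (simp only: hX)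
qed

text \<open>The reference point moves with the iterate, by \<open>\<eta>x\<close> times the
  momentum. Young's weight \<open>\<gamma> / 2\<close> is half the contraction rate of the averaging
  step, so half of the decay survives; the lower-level shift uses half of
  \<open>\<eta>y * lam\<close> for the same reason.\<close>

lemma tracking_error_shift:
  "(norm (zs (Suc t) w - DF (xs (Suc t) w)))\<^sup>2
    \<le> (1 + \<gamma> / 2) * (norm (zs (Suc t) w - DF (xs t w)))\<^sup>2 + (1
        + 2 / \<gamma>) * (LF * \<eta>x)\<^sup>2 * (norm (zs (Suc t) w))\<^sup>2"
proof -
  have "norm (DF (xs t w) - DF (xs (Suc t) w)) \<le> LF * norm (xs t w - xs (Suc t) w)"
    by (rule DF_lipschitz)
  also have "\<dots> = LF * \<eta>x * norm (zs (Suc t) w)" using \<eta>x by (simp add: xs_Suc)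
  finally have "(norm (DF (xs t w) - DF (xs (Suc t) w)))\<^sup>2 \<le> (LF * \<eta>x * norm (zs (Suc t) w))\<^sup>2"
    by (rule power_mono) simp
  then have "(1 + 2 / \<gamma>) * (norm (DF (xs t w) - DF (xs (Suc t) w)))\<^sup>2
      \<le> (1 + 2 / \<gamma>) * (LF * \<eta>x * norm (zs (Suc t) w))\<^sup>2"
    using \<gamma> by (intro mult_left_mono) auto
  then show ?thesis
    using norm_add_sq_young[of "\<gamma> / 2" "zs (Suc t) w - DF (xs t w)" "DF (xs t w) - DF (xs (Suc t) w)"] \<gamma>
    by (simp add: power_mult_distrib mult.assoc)
qed

lemma lower_level_shift:
  "(norm (ys (Suc t) w - ystar (xs (Suc t) w)))\<^sup>2
    \<le> (1 + \<eta>y * lam / 2) * (norm (ys (Suc t) w - ystar (xs t w)))\<^sup>2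
      + (1 + 2 / (\<eta>y * lam)) * (Lstar * \<eta>x)\<^sup>2 * (norm (zs (Suc t) w))\<^sup>2"
proof -
  have pos: "0 < \<eta>y * lam" using \<eta>y lam_pos by simp
  have "norm (ystar (xs t w) - ystar (xs (Suc t) w)) \<le> Lstar * norm (xs t w - xs (Suc t) w)"
    by (rule ystar_lipschitz)
  also have "\<dots> = Lstar * \<eta>x * norm (zs (Suc t) w)" using \<eta>x by (simp add: xs_Suc)
  finally have "(norm (ystar (xs t w) - ystar (xs (Suc t) w)))\<^sup>2 \<le> (Lstar * \<eta>x * norm (zs (Suc t) w))\<^sup>2"
    by (rule power_mono) simp
  then have "(1 + 2 / (\<eta>y * lam)) * (norm (ystar (xs t w) - ystar (xs (Suc t) w)))\<^sup>2
      \<le> (1 + 2 / (\<eta>y * lam)) * (Lstar * \<eta>x * norm (zs (Suc t) w))\<^sup>2"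
    using pos by (intro mult_left_mono) auto
  then show ?thesis
    using norm_add_sq_young[of "\<eta>y * lam / 2" "ys (Suc t) w - ystar (xs t w)" "ystar (xs t w) - ystar (xs (Suc t) w)"] pos
    by (simp add: power_mult_distrib mult.assoc)
qed

lemma lower_level_step:
  assumes int: "integrable M (\<lambda>w. (norm (ys t w - ystar (xs t w)))\<^sup>2)"
  shows "integrable M (\<lambda>w. (norm (ys (Suc t) w - ystar (xs t w)))\<^sup>2)"
    "(LINT w|M. (norm (ys (Suc t) w - ystar (xs t w)))\<^sup>2)
      \<le> (1 - \<eta>y * lam) * (LINT w|M. (norm (ys t w - ystar (xs t w)))\<^sup>2) + \<eta>y\<^sup>2 * \<sigma>\<^sup>2"
proof -
  let ?c = "Call_gy (Suc t)"
  let ?X = "\<lambda>w. (xs t w, ys t w)"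
  \<comment> \<open>The step before projection: it is affine in the oracle answer, as the
    bias-variance identity demands. The projection is put back at the end by
    nonexpansiveness.\<close>
  define h where "h = (\<lambda>(x, y) w. (norm ((y - ystar x) + (- \<eta>y) *\<^sub>R O_gy Orc (\<xi> ?c w) x y))\<^sup>2)"
  define U where "U = (\<lambda>(x, y). (1 - \<eta>y * lam) * (norm (y - ystar x))\<^sup>2 + \<eta>y\<^sup>2 * \<sigma>\<^sup>2)"
  have X: "?X \<in> measurable (draw_algebra (past t)) (borel \<Otimes>\<^sub>M borel)"
    using iterates_measurable[of t] by (intro measurable_Pair)
  have disj: "past t \<inter> {Inl ?c} = {}" by simp
  have hm: "case_prod h \<in> borel_measurable ((borel \<Otimes>\<^sub>M borel) \<Otimes>\<^sub>M draw_algebra {Inl ?c})"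
  proof -
    have [measurable]: "(\<lambda>q. O_gy Orc (\<xi> ?c (snd q)) (fst (fst q)) (snd (fst q)))
        \<in> borel_measurable ((borel \<Otimes>\<^sub>M borel) \<Otimes>\<^sub>M draw_algebra {Inl ?c})"
      by (rule oracle_measurable[OF orc_gy measurable_compose[OF measurable_snd measurable_draw_seed]]) auto
    show ?thesis unfolding h_def case_prod_unfold by measurable
  qed
  have sec: "integrable M (h q)" "(LINT w|M. h q w) \<le> U q" for q
  proof -
    obtain x y where q: "q = (x, y)" by (cases q)
    let ?G = "\<lambda>w. O_gy Orc (\<xi> ?c w) x y"
    have G: "integrable M ?G" "(LINT w|M. ?G w) = gy x y"
        "integrable M (\<lambda>w. (norm (?G w - gy x y))\<^sup>2)" "(LINT w|M. (norm (?G w - gy x y))\<^sup>2) \<le> \<sigma>\<^sup>2"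
      using seed_integrable[OF unbiased_oracleD(1)[OF orc_gy], of ?c x y]
        seed_integral[OF unbiased_oracleD(1)[OF orc_gy], of ?c x y]
        seed_integrable[OF unbiased_oracleD(3)[OF orc_gy], of ?c x y]
        seed_integral[OF unbiased_oracleD(3)[OF orc_gy], of ?c x y]
        unbiased_oracleD(4)[OF orc_gy, of x y]
      by (simp_all only: unbiased_oracleD(2)[OF orc_gy])
    note bv = bias_variance[OF prob_space_axioms G(1,3,2), of "y - ystar x" "- \<eta>y"]
    show "integrable M (h q)" unfolding q h_def prod.case by (rule bv(1))
    have "(norm (y - ystar x + (- \<eta>y) *\<^sub>R gy x y))\<^sup>2 \<le> (1 - \<eta>y * lam) * (norm (y - ystar x))\<^sup>2"
      using \<eta>y by (intro gradient_step_contraction) auto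
    moreover have "\<eta>y\<^sup>2 * (LINT w|M. (norm (?G w - gy x y))\<^sup>2) \<le> \<eta>y\<^sup>2 * \<sigma>\<^sup>2"
      using G(4) by (rule mult_left_mono) simp
    ultimately show "(LINT w|M. h q w) \<le> U q"
      unfolding q h_def U_def prod.case bv(2) by simp
  qed
  have UI: "integrable M (\<lambda>w. U (?X w))" unfolding U_def prod.case using int by simp
  have nn: "0 \<le> h q w" for q w by (simp add: h_def case_prod_unfold)
  note fb = freeze_bound[OF X disj hm nn sec UI]
  have le: "(norm (ys (Suc t) w - ystar (xs t w)))\<^sup>2 \<le> h (?X w) w" for w
    using projection_contraction[of "ys t w - \<eta>y *\<^sub>R O_gy Orc (\<xi> ?c w) (xs t w) (ys t w)" "xs t w"]
    unfolding h_def ys_Suc prod.case by (intro power_mono) (simp_all add: algebra_simps)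
  show I: "integrable M (\<lambda>w. (norm (ys (Suc t) w - ystar (xs t w)))\<^sup>2)"
    by (rule integrable_dominated[OF fb(1) _ zero_le_power2 le]) measurable
  have "(LINT w|M. (norm (ys (Suc t) w - ystar (xs t w)))\<^sup>2) \<le> (LINT w|M. h (?X w) w)"
    by (intro integral_mono I fb(1) le)
  also have "\<dots> \<le> (LINT w|M. U (?X w))" by (rule fb(2))
  also have "\<dots> = (1 - \<eta>y * lam) * (LINT w|M. (norm (ys t w - ystar (xs t w)))\<^sup>2) + \<eta>y\<^sup>2 * \<sigma>\<^sup>2"
    unfolding U_def prod.case using int by (simp add: prob_space)
  finally show "(LINT w|M. (norm (ys (Suc t) w - ystar (xs t w)))\<^sup>2)
      \<le> (1 - \<eta>y * lam) * (LINT w|M. (norm (ys t w - ystar (xs t w)))\<^sup>2) + \<eta>y\<^sup>2 * \<sigma>\<^sup>2" .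
qed

text \<open>The initial state is deterministic, so the bias-variance identity applies with weight 1
  and no freezing. The index \<open>0 - 1\<close> equals 0, so round 0 is governed by
  \<open>k 0\<close>.\<close>

lemma initial_tracking_error:
  "integrable M (\<lambda>w. (norm (zs 0 w - DF (xs 0 w)))\<^sup>2)"
  "(LINT w|M. (norm (zs 0 w - DF (xs 0 w)))\<^sup>2) \<le> 2 * b + 2 * L\<Phi>\<^sup>2 * (norm (y0 - ystar x0))\<^sup>2 + V"
proof -
  let ?m = "mean_estimate (k (0 - 1)) x0 y0"
  note bv = bias_variance[OF prob_space_axioms estimate_moments(1,3,2)[of 0 x0 y0], of "- DF x0" 1]
  have eq: "- DF x0 + 1 *\<^sub>R estimate 0 x0 y0 w = zs 0 w - DF (xs 0 w)" for w
    by (simp only: iterates_0) simp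
  show "integrable M (\<lambda>w. (norm (zs 0 w - DF (xs 0 w)))\<^sup>2)" using bv(1) unfolding eq .
  have "(norm (- DF x0 + 1 *\<^sub>R ?m))\<^sup>2 \<le> 2 * (norm (?m - \<Phi> x0 y0))\<^sup>2 + 2 * (norm (\<Phi> x0 y0 - DF x0))\<^sup>2"
    using norm_add_sq_le[of "?m - \<Phi> x0 y0" "\<Phi> x0 y0 - DF x0"] by simp
  moreover have "(norm (?m - \<Phi> x0 y0))\<^sup>2 \<le> b"
    using estimate_bias[of "k (0 - 1)" x0 y0] bias_le[of "0 - 1"] by (rule order_trans)
  moreover have "(norm (\<Phi> x0 y0 - DF x0))\<^sup>2 \<le> L\<Phi>\<^sup>2 * (norm (y0 - ystar x0))\<^sup>2"
    unfolding power_mult_distrib[symmetric]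
    using \<Phi>_lipschitz[of x0 y0 x0 "ystar x0"] by (intro power_mono) (auto simp: DF_def)
  moreover have "(LINT w|M. (norm (estimate 0 x0 y0 w - ?m))\<^sup>2) \<le> V"
    using estimate_moments(4)[of 0 x0 y0] variance_le[of "0 - 1"] by (rule order_trans)
  ultimately show "(LINT w|M. (norm (zs 0 w - DF (xs 0 w)))\<^sup>2)
      \<le> 2 * b + 2 * L\<Phi>\<^sup>2 * (norm (y0 - ystar x0))\<^sup>2 + V"
    using bv(2) unfolding eq by simp
qed

lemma objective_step:
  "F (xs (Suc t) w) - Fmin + \<eta>x / 2 * (norm (DF (xs t w)))\<^sup>2 + \<eta>x / 4 * (norm (zs (Suc t) w))\<^sup>2
    \<le> F (xs t w) - Fmin + \<eta>x / 2 * (norm (zs (Suc t) w - DF (xs t w)))\<^sup>2"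
  using descent_step[of \<eta>x "xs t w" "zs (Suc t) w"] \<eta>x unfolding xs_Suc by linarith

text \<open>Every term on the left of \<open>objective_step\<close> is nonnegative, hence integrable
  as soon as the right-hand side is. The second moments of gradient and momentum thus come from the
  descent of the objective, using its lower bound \<open>Fmin\<close>.\<close>

lemma integrable_successors:
  assumes z: "integrable M (\<lambda>w. (norm (zs t w - DF (xs t w)))\<^sup>2)"
    and y: "integrable M (\<lambda>w. (norm (ys t w - ystar (xs t w)))\<^sup>2)"
    and f: "integrable M (\<lambda>w. F (xs t w) - Fmin)"
  shows "integrable M (\<lambda>w. (norm (DF (xs t w)))\<^sup>2)"
    "integrable M (\<lambda>w. (norm (zs (Suc t) w))\<^sup>2)"
    "integrable M (\<lambda>w. F (xs (Suc t) w) - Fmin)"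
    "integrable M (\<lambda>w. (norm (zs (Suc t) w - DF (xs (Suc t) w)))\<^sup>2)"
    "integrable M (\<lambda>w. (norm (ys (Suc t) w - ystar (xs (Suc t) w)))\<^sup>2)"
proof -
  have I: "integrable M (\<lambda>w. F (xs t w) - Fmin + \<eta>x / 2 * (norm (zs (Suc t) w - DF (xs t w)))\<^sup>2)"
    using f tracking_error_step(1)[OF z y]
    by (intro Bochner_Integration.integrable_add integrable_mult_right)
  have nn: "0 \<le> F (xs t w) - Fmin" "0 \<le> \<eta>x / 2 * (norm (DF (xs t w)))\<^sup>2"
    "0 \<le> \<eta>x / 4 * (norm (zs (Suc t) w))\<^sup>2" for t w
    using Fmin \<eta>x by simp_all
  have "integrable M (\<lambda>w. \<eta>x / 2 * (norm (DF (xs t w)))\<^sup>2)"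
  proof (rule integrable_dominated[OF I])
    show "\<eta>x / 2 * (norm (DF (xs t w)))\<^sup>2
        \<le> F (xs t w) - Fmin + \<eta>x / 2 * (norm (zs (Suc t) w - DF (xs t w)))\<^sup>2" for w
      using objective_step[of w t] nn(1)[of w "Suc t"] nn(3)[of w t] by linarith
  qed (use nn in measurable)
  then show "integrable M (\<lambda>w. (norm (DF (xs t w)))\<^sup>2)"
    unfolding integrable_mult_left_iff using \<eta>x by simp
  have "integrable M (\<lambda>w. \<eta>x / 4 * (norm (zs (Suc t) w))\<^sup>2)"
  proof (rule integrable_dominated[OF I])
    show "\<eta>x / 4 * (norm (zs (Suc t) w))\<^sup>2
        \<le> F (xs t w) - Fmin + \<eta>x / 2 * (norm (zs (Suc t) w - DF (xs t w)))\<^sup>2" for w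
      using objective_step[of w t] nn(1)[of w "Suc t"] nn(2)[of w t] by linarith
  qed (use nn in measurable)
  then show Z: "integrable M (\<lambda>w. (norm (zs (Suc t) w))\<^sup>2)"
    unfolding integrable_mult_left_iff using \<eta>x by simp
  show "integrable M (\<lambda>w. F (xs (Suc t) w) - Fmin)"
  proof (rule integrable_dominated[OF I])
    show "F (xs (Suc t) w) - Fmin
        \<le> F (xs t w) - Fmin + \<eta>x / 2 * (norm (zs (Suc t) w - DF (xs t w)))\<^sup>2" for w
      using objective_step[of w t] nn(2,3)[of w t] by linarith
  qed (use nn in measurable)
  show "integrable M (\<lambda>w. (norm (zs (Suc t) w - DF (xs (Suc t) w)))\<^sup>2)"
    by (rule integrable_dominated[OF _ _ zero_le_power2 tracking_error_shift])
       (intro Bochner_Integration.integrable_add integrable_mult_right Z tracking_error_step(1)[OF z y], measurable)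
  show "integrable M (\<lambda>w. (norm (ys (Suc t) w - ystar (xs (Suc t) w)))\<^sup>2)"
    by (rule integrable_dominated[OF _ _ zero_le_power2 lower_level_shift])
       (intro Bochner_Integration.integrable_add integrable_mult_right Z lower_level_step(1)[OF y], measurable)
qed

lemma iterates_integrable:
  "integrable M (\<lambda>w. (norm (zs t w - DF (xs t w)))\<^sup>2)"
  "integrable M (\<lambda>w. (norm (ys t w - ystar (xs t w)))\<^sup>2)"
  "integrable M (\<lambda>w. F (xs t w) - Fmin)"
proof (induction t)
  case 0
  show "integrable M (\<lambda>w. (norm (zs 0 w - DF (xs 0 w)))\<^sup>2)" by (rule initial_tracking_error)
  show "integrable M (\<lambda>w. (norm (ys 0 w - ystar (xs 0 w)))\<^sup>2)"
    "integrable M (\<lambda>w. F (xs 0 w) - Fmin)" unfolding iterates_0 by simp_all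
next
  case (Suc t)
  from integrable_successors[OF Suc.IH]
  show "integrable M (\<lambda>w. (norm (zs (Suc t) w - DF (xs (Suc t) w)))\<^sup>2)"
    "integrable M (\<lambda>w. (norm (ys (Suc t) w - ystar (xs (Suc t) w)))\<^sup>2)"
    "integrable M (\<lambda>w. F (xs (Suc t) w) - Fmin)" by blast+
qed

lemmas gradient_integrable = integrable_successors(1)[OF iterates_integrable]
lemmas momentum_integrable = integrable_successors(2)[OF iterates_integrable]
lemmas error_integrable = tracking_error_step(1)[OF iterates_integrable(1,2)]

section \<open>Recursions for the expected quantities\<close>

abbreviation "mean_gap t \<equiv> LINT w|M. F (xs t w) - Fmin"
abbreviation "mean_error t \<equiv> LINT w|M. (norm (zs (Suc t) w - DF (xs t w)))\<^sup>2"
abbreviation "mean_lower t \<equiv> LINT w|M. (norm (ys t w - ystar (xs t w)))\<^sup>2"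
abbreviation "mean_momentum t \<equiv> LINT w|M. (norm (zs (Suc t) w))\<^sup>2"
abbreviation "mean_gradient t \<equiv> LINT w|M. (norm (DF (xs t w)))\<^sup>2"

lemma mean_gap_step:
  "mean_gap (Suc t) + \<eta>x / 2 * mean_gradient t + \<eta>x / 4 * mean_momentum t
    \<le> mean_gap t + \<eta>x / 2 * mean_error t"
proof -
  note int = iterates_integrable(3)[of t] iterates_integrable(3)[of "Suc t"] gradient_integrable[of t]
    momentum_integrable[of t] error_integrable[of t]
  have I1: "integrable M (\<lambda>w. (F (xs (Suc t) w) - Fmin) + \<eta>x / 2 * (norm (DF (xs t w)))\<^sup>2
      + \<eta>x / 4 * (norm (zs (Suc t) w))\<^sup>2)"
    by (intro Bochner_Integration.integrable_add integrable_mult_right int)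
  have I2: "integrable M (\<lambda>w. (F (xs t w) - Fmin) + \<eta>x / 2 * (norm (zs (Suc t) w - DF (xs t w)))\<^sup>2)"
    by (intro Bochner_Integration.integrable_add integrable_mult_right int)
  note le = integral_mono[OF I1 I2 objective_step]
  have "(LINT w|M. (F (xs (Suc t) w) - Fmin) + \<eta>x / 2 * (norm (DF (xs t w)))\<^sup>2
      + \<eta>x / 4 * (norm (zs (Suc t) w))\<^sup>2)
      = mean_gap (Suc t) + \<eta>x / 2 * mean_gradient t + \<eta>x / 4 * mean_momentum t"
    by (subst Bochner_Integration.integral_add Bochner_Integration.integral_add integral_mult_right_zero;
        (intro Bochner_Integration.integrable_add integrable_mult_right int)?)+ simp
  moreover have "(LINT w|M. (F (xs t w) - Fmin) + \<eta>x / 2 * (norm (zs (Suc t) w - DF (xs t w)))\<^sup>2)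
      = mean_gap t + \<eta>x / 2 * mean_error t"
    by (subst Bochner_Integration.integral_add; (intro Bochner_Integration.integrable_add integrable_mult_right int)?) simp
  ultimately show ?thesis using le by simp
qed

lemma mean_lower_step:
  "mean_lower (Suc t) \<le> (1 + \<eta>y * lam / 2) * ((1 - \<eta>y * lam) * mean_lower t + \<eta>y\<^sup>2 * \<sigma>\<^sup>2)
    + (1 + 2 / (\<eta>y * lam)) * (Lstar * \<eta>x)\<^sup>2 * mean_momentum t"
proof -
  note step = lower_level_step[OF iterates_integrable(2), of t]
  have I: "integrable M (\<lambda>w. (1 + \<eta>y * lam / 2) * (norm (ys (Suc t) w - ystar (xs t w)))\<^sup>2
      + (1 + 2 / (\<eta>y * lam)) * (Lstar * \<eta>x)\<^sup>2 * (norm (zs (Suc t) w))\<^sup>2)"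
    by (intro Bochner_Integration.integrable_add integrable_mult_right step(1) momentum_integrable)
  have "mean_lower (Suc t) \<le> (LINT w|M. (1 + \<eta>y * lam / 2) * (norm (ys (Suc t) w - ystar (xs t w)))\<^sup>2
      + (1 + 2 / (\<eta>y * lam)) * (Lstar * \<eta>x)\<^sup>2 * (norm (zs (Suc t) w))\<^sup>2)"
    by (intro integral_mono I iterates_integrable lower_level_shift)
  also have "\<dots> = (1 + \<eta>y * lam / 2) * (LINT w|M. (norm (ys (Suc t) w - ystar (xs t w)))\<^sup>2)
      + (1 + 2 / (\<eta>y * lam)) * (Lstar * \<eta>x)\<^sup>2 * mean_momentum t"
    by (subst Bochner_Integration.integral_add; (intro integrable_mult_right step(1) momentum_integrable)?) simp
  also have "\<dots> \<le> (1 + \<eta>y * lam / 2) * ((1 - \<eta>y * lam) * mean_lower t + \<eta>y\<^sup>2 * \<sigma>\<^sup>2)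
    + (1 + 2 / (\<eta>y * lam)) * (Lstar * \<eta>x)\<^sup>2 * mean_momentum t"
    using \<eta>y lam_pos by (intro add_right_mono mult_left_mono step(2)) simp
  finally show ?thesis .
qed

text \<open>\<open>mean_error\<close> compares a momentum with the gradient at the point where the
  newest estimate was taken. So the reference point is shifted first and the next estimate is
  averaged afterwards, which is why \<open>mean_lower\<close> appears at
  \<open>Suc t\<close>.\<close>

lemma mean_error_step:
  "mean_error (Suc t) \<le> (1 - \<gamma>) * ((1 + \<gamma> / 2) * mean_error t + (1
      + 2 / \<gamma>) * (LF * \<eta>x)\<^sup>2 * mean_momentum t)
    + 2 * \<gamma> * L\<Phi>\<^sup>2 * mean_lower (Suc t) + 2 * \<gamma> * b + \<gamma>\<^sup>2 * V"
proof -
  have I: "integrable M (\<lambda>w. (1 + \<gamma> / 2) * (norm (zs (Suc t) w - DF (xs t w)))\<^sup>2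
      + (1 + 2 / \<gamma>) * (LF * \<eta>x)\<^sup>2 * (norm (zs (Suc t) w))\<^sup>2)"
    by (intro Bochner_Integration.integrable_add integrable_mult_right error_integrable momentum_integrable)
  have "(LINT w|M. (norm (zs (Suc t) w - DF (xs (Suc t) w)))\<^sup>2)
      \<le> (LINT w|M. (1 + \<gamma> / 2) * (norm (zs (Suc t) w - DF (xs t w)))\<^sup>2
      + (1 + 2 / \<gamma>) * (LF * \<eta>x)\<^sup>2 * (norm (zs (Suc t) w))\<^sup>2)"
    by (intro integral_mono I iterates_integrable tracking_error_shift)
  also have "\<dots> = (1 + \<gamma> / 2) * mean_error t + (1 + 2 / \<gamma>) * (LF * \<eta>x)\<^sup>2 * mean_momentum t"
    by (subst Bochner_Integration.integral_add; (intro integrable_mult_right error_integrable momentum_integrable)?) simp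
  finally have "(1 - \<gamma>) * (LINT w|M. (norm (zs (Suc t) w - DF (xs (Suc t) w)))\<^sup>2)
      \<le> (1 - \<gamma>) * ((1 + \<gamma> / 2) * mean_error t + (1 + 2 / \<gamma>) * (LF * \<eta>x)\<^sup>2 * mean_momentum t)"
    using \<gamma> by (intro mult_left_mono) auto
  then show ?thesis using tracking_error_step(2)[OF iterates_integrable(1,2), of "Suc t"] by linarith
qed

text \<open>With all steps proportional to \<open>s\<close> the recursions take the form of
  \<open>potential_descent_sum\<close>. Its momentum coefficients \<open>\<alpha>\<close> and
  \<open>\<kappa>\<close> become quadratic in \<open>c\<close>, so for fixed \<open>c'\<close> the
  condition \<open>small\<close> is met by shrinking \<open>c\<close>. The threes bound factors such
  as \<open>1 + 2 / h\<close> by \<open>3 / h\<close> for \<open>h\<close> at most 1.\<close>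

lemma average_sum_bound:
  fixes s c c' c\<^sub>b :: real
  assumes par: "\<gamma> = s" "\<eta>x = c * s" "\<eta>y = c' * s" "b = c\<^sub>b * s\<^sup>2" and c\<^sub>b: "0 \<le> c\<^sub>b"
    and small: "2 * (3 * LF\<^sup>2 * c\<^sup>2)
        + 2 * (3 * Lstar\<^sup>2 * c\<^sup>2 / (c' * lam)) * (2 * L\<Phi>\<^sup>2) * (1 / (c' * lam / 2) + 1) \<le> 1 / 4"
  shows "c * s / 2 * (\<Sum>t\<le>T. mean_gradient t + mean_error t)
    \<le> F x0 - Fmin + 2 * c * (4 * c\<^sub>b + 4 * L\<Phi>\<^sup>2 * (norm (y0 - ystar x0))\<^sup>2 + 2 * V)
      + 2 * c * (2 * L\<Phi>\<^sup>2) / (c' * lam / 2) * (norm (y0 - ystar x0))\<^sup>2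
      + real (T + 1) * (s\<^sup>2 * (2 * c * (2 * c\<^sub>b + V) + 2 * c * (2 * L\<Phi>\<^sup>2) * (1 / (c' * lam / 2)
          + 1) * (2 * c'\<^sup>2 * \<sigma>\<^sup>2)))"
proof -
  have s: "0 < s" "s \<le> 1" using \<gamma> par by auto
  have c: "0 < c" "0 < c'" using \<eta>x \<eta>y s unfolding par by (auto simp: zero_less_mult_iff)
  define \<delta> where "\<delta> = (norm (y0 - ystar x0))\<^sup>2"
  have V: "0 \<le> V" using variance_le[of 0] moment_rate_nonneg
      by (smt (verit) mult_nonneg_nonneg of_nat_0_le_iff zero_le_power2)
  have b: "0 \<le> b" using par c\<^sub>b by simp
  have bc: "b \<le> c\<^sub>b" using par c\<^sub>b s by (simp add: mult_left_le power_le_one)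
  define h where "h = \<eta>y * lam"
  have h: "0 < h" "h \<le> 1" using \<eta>y lam_pos by (auto simp: h_def)
  have Z: "0 \<le> mean_momentum t" for t by simp
  have nn: "0 \<le> mean_gap t" for t using Fmin by (intro integral_nonneg_AE AE_I2) simp
  have lower: "mean_lower (Suc t) \<le> (1 - c' * lam / 2 * s) * mean_lower t
      + 3 * Lstar\<^sup>2 * c\<^sup>2 / (c' * lam) * s * mean_momentum t + 2 * c'\<^sup>2 * \<sigma>\<^sup>2 * s\<^sup>2" for t
  proof -
    have "(1 + h / 2) * (1 - h) \<le> 1 - h / 2" using h by (simp add: algebra_simps)
    then have "(1 + h / 2) * (1 - h) * mean_lower t \<le> (1 - h / 2) * mean_lower t"
      by (rule mult_right_mono) simp
    moreover have "(1 + h / 2) * (\<eta>y\<^sup>2 * \<sigma>\<^sup>2) \<le> 2 * (\<eta>y\<^sup>2 * \<sigma>\<^sup>2)"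
      using h by (intro mult_right_mono) auto
    moreover have "(1 + 2 / h) * (Lstar * \<eta>x)\<^sup>2 * mean_momentum t
        \<le> (3 / h) * (Lstar * \<eta>x)\<^sup>2 * mean_momentum t"
      using h by (intro mult_right_mono) (auto simp: field_simps)
    moreover have "(3 / h) * (Lstar * \<eta>x)\<^sup>2 = 3 * Lstar\<^sup>2 * c\<^sup>2 / (c' * lam) * s"
      unfolding h_def par using s c lam_pos
          by (simp add: power_mult_distrib power2_eq_square field_simps)
    moreover have "mean_lower (Suc t)
        \<le> (1 + h / 2) * (1 - h) * mean_lower t + (1 + h / 2) * (\<eta>y\<^sup>2 * \<sigma>\<^sup>2)
        + (1 + 2 / h) * (Lstar * \<eta>x)\<^sup>2 * mean_momentum t"
      using mean_lower_step[of t] unfolding h_def by (simp del: smb.simps add: distrib_left mult.assoc)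
    moreover have "1 - h / 2 = 1 - c' * lam / 2 * s" unfolding h_def par by simp
    moreover have "2 * (\<eta>y\<^sup>2 * \<sigma>\<^sup>2) = 2 * c'\<^sup>2 * \<sigma>\<^sup>2 * s\<^sup>2"
        unfolding par by (simp add: power_mult_distrib)
    ultimately show ?thesis by (smt (verit))
  qed
  \<comment> \<open>The bias term is cubic in \<open>s\<close>; one factor is given up through
    \<open>s \<le> 1\<close> to merge it with the variance.\<close>
  have sb: "2 * s * b + s\<^sup>2 * V \<le> (2 * c\<^sub>b + V) * s\<^sup>2"
  proof -
    have "s * (2 * (c\<^sub>b * s\<^sup>2)) \<le> 1 * (2 * (c\<^sub>b * s\<^sup>2))" using s c\<^sub>b by (intro mult_right_mono) auto
    then show ?thesis by (simp add: par algebra_simps)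
  qed
  have error: "mean_error (Suc t) \<le> (1 - s / 2) * mean_error t + 3 * LF\<^sup>2 * c\<^sup>2 * s * mean_momentum t
      + 2 * L\<Phi>\<^sup>2 * s * mean_lower (Suc t) + (2 * c\<^sub>b + V) * s\<^sup>2" for t
  proof -
    have regroup: "(1 - s) * ((1 + s / 2) * D + (1 + 2 / s) * q * m) + 2 * s * l * d + 2 * s * b
        + s\<^sup>2 * V
        = (1 - s) * (1 + s / 2) * D + (1 - s) * (1 + 2 / s) * (q * m) + 2 * l * s * d + (2 * s * b
            + s\<^sup>2 * V)"
      for D q m l d :: real
      by (simp add: algebra_simps)
    have "(1 - s) * (1 + s / 2) \<le> 1 - s / 2" using s by (simp add: algebra_simps)
    then have "(1 - s) * (1 + s / 2) * mean_error t \<le> (1 - s / 2) * mean_error t"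
      by (rule mult_right_mono) simp
    moreover have "(1 - s) * (1 + 2 / s) * ((LF * \<eta>x)\<^sup>2 * mean_momentum t)
        \<le> (3 / s) * ((LF * \<eta>x)\<^sup>2 * mean_momentum t)"
      using s by (intro mult_right_mono) (auto simp: field_simps)
    moreover have "(3 / s) * ((LF * \<eta>x)\<^sup>2 * mean_momentum t) = 3 * LF\<^sup>2 * c\<^sup>2 * s * mean_momentum t"
      unfolding par using s by (simp add: power_mult_distrib power2_eq_square field_simps)
    moreover have "mean_error (Suc t)
        \<le> (1 - s) * (1 + s / 2) * mean_error t + (1 - s) * (1 + 2 / s) * ((LF * \<eta>x)\<^sup>2 * mean_momentum t)
        + 2 * L\<Phi>\<^sup>2 * s * mean_lower (Suc t) + (2 * s * b + s\<^sup>2 * V)"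
      using mean_error_step[of t] unfolding par(1) regroup .
    ultimately show ?thesis using sb by linarith
  qed
  \<comment> \<open>\<open>mean_error 0\<close> already involves the momentum after one iteration,
    so the bound for the initial momentum passes through one tracking step, which doubles the
    constants.\<close>
  have D0: "mean_error 0 \<le> 4 * c\<^sub>b + 4 * L\<Phi>\<^sup>2 * \<delta> + 2 * V"
  proof -
    have "0 \<le> L\<Phi>\<^sup>2 * \<delta>" by (simp add: \<delta>_def)
    have "(1 - \<gamma>) * (LINT w|M. (norm (zs 0 w - DF (xs 0 w)))\<^sup>2) \<le> 1 * (2 * b + 2 * L\<Phi>\<^sup>2 * \<delta> + V)"
      using initial_tracking_error(2) \<gamma> b V unfolding \<delta>_def by (intro mult_mono) auto
    moreover have "2 * \<gamma> * L\<Phi>\<^sup>2 * mean_lower 0 \<le> 2 * L\<Phi>\<^sup>2 * \<delta>"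
    proof -
      have "mean_lower 0 = \<delta>" unfolding iterates_0 \<delta>_def by (simp add: prob_space)
      then show ?thesis using mult_right_mono[OF \<gamma>(2) \<open>0 \<le> L\<Phi>\<^sup>2 * \<delta>\<close>] by simp
    qed
    moreover have "2 * \<gamma> * b \<le> 2 * b" using \<gamma> b by (simp add: mult_left_le_one_le)
    moreover have "\<gamma>\<^sup>2 * V \<le> V" using \<gamma> V by (simp add: mult_left_le_one_le power_le_one)
    moreover have "e \<le> 4 * c\<^sub>b + 4 * l * \<delta> + 2 * V"
      if "r1 \<le> 1 * (2 * b + 2 * l * \<delta> + V)" "r2 \<le> 2 * l * \<delta>" "r3 \<le> 2 * b" "r4 \<le> V"
        "e \<le> r1 + r2 + r3 + r4" for e r1 r2 r3 r4 l :: real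
      using that bc by (simp add: mult.assoc)
    ultimately show ?thesis
      using tracking_error_step(2)[OF iterates_integrable(1,2), of 0] by blast
  qed
  have "c * s / 2 * (\<Sum>t\<le>T. mean_gradient t + mean_error t)
    \<le> mean_gap 0 + 2 * c * mean_error 0 + 2 * c * (2 * L\<Phi>\<^sup>2) / (c' * lam / 2) * mean_lower 0
      + real (T + 1) * (s\<^sup>2 * (2 * c * (2 * c\<^sub>b + V) + 2 * c * (2 * L\<Phi>\<^sup>2) * (1 / (c' * lam / 2)
          + 1) * (2 * c'\<^sup>2 * \<sigma>\<^sup>2)))"
  proof (rule potential_descent_sum[where F = "\<lambda>t. mean_gap t" and D = "\<lambda>t. mean_error t"
        and d = "\<lambda>t. mean_lower t" and Z = "\<lambda>t. mean_momentum t" and G = "\<lambda>t. mean_gradient t"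
        and s = s and c = c and \<mu> = "c' * lam / 2" and \<kappa> = "3 * Lstar\<^sup>2 * c\<^sup>2 / (c' * lam)"
        and \<alpha> = "3 * LF\<^sup>2 * c\<^sup>2" and \<nu> = "2 * L\<Phi>\<^sup>2" and \<tau> = "2 * c'\<^sup>2 * \<sigma>\<^sup>2" and e = "2 * c\<^sub>b + V"])
    show "mean_gap (Suc t) + c * s / 2 * mean_gradient t + c * s / 4 * mean_momentum t
        \<le> mean_gap t + c * s / 2 * mean_error t" for t
      using mean_gap_step[of t] unfolding par .
    show "0 \<le> mean_error t" "0 \<le> mean_lower t" for t by (rule integral_nonneg_AE, simp)+
  qed (rule nn Z s c lower error small | use c lam_pos in simp)+
  also have "mean_gap 0 = F x0 - Fmin" unfolding iterates_0 by (simp add: prob_space)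
  also have "mean_lower 0 = (norm (y0 - ystar x0))\<^sup>2" unfolding iterates_0 by (simp add: prob_space)
  also have "F x0 - Fmin + 2 * c * mean_error 0
      \<le> F x0 - Fmin + 2 * c * (4 * c\<^sub>b + 4 * L\<Phi>\<^sup>2 * (norm (y0 - ystar x0))\<^sup>2 + 2 * V)"
    using D0 c unfolding \<delta>_def by (intro add_left_mono mult_left_mono) auto
  finally show ?thesis by simp
qed

end

end

section \<open>The convergence rate\<close>

context bilevel_oracles
begin

text \<open>The largest ratio for which \<open>\<eta>y * Lgy\<^sup>2 \<le> lam\<close>, the
  requirement of the contraction, holds for every \<open>s\<close> up to 1.\<close>

definition lower_step where "lower_step = lam / Lgy\<^sup>2"

text \<open>The left side of \<open>small\<close> in \<open>average_sum_bound\<close> with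
  \<open>c\<^sup>2\<close> factored out.\<close>

definition step_ratio where
  "step_ratio = 2 * (3 * LF\<^sup>2)
      + 2 * (3 * Lstar\<^sup>2 / (lower_step * lam)) * (2 * L\<Phi>\<^sup>2) * (1 / (lower_step * lam / 2) + 1)"

text \<open>Meets the smoothness condition and the absorption condition at once; the summand 1 makes
  it at most 1, so \<open>step_ratio * upper_step \<le> 1 / 4\<close> survives another factor
  \<open>upper_step\<close>.\<close>

definition upper_step where "upper_step = 1 / (4 * (1 + KF + step_ratio))"

definition bias_const where "bias_const = (Cgxy * (Cfy / lam))\<^sup>2"

text \<open>What the bound amounts to with the estimator variance \<open>V\<close> set to 0;
  \<open>gap\<close> and \<open>\<delta>\<close> stand for the initial objective gap and squared
  lower-level error.\<close>

definition rate_const where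
  "rate_const gap \<delta> = gap + 2 * upper_step * (4 * bias_const + 4 * L\<Phi>\<^sup>2 * \<delta>)
    + 2 * upper_step * (2 * L\<Phi>\<^sup>2) / (lower_step * lam / 2) * \<delta>
    + (2 * upper_step * (2 * bias_const)
      + 2 * upper_step * (2 * L\<Phi>\<^sup>2) * (1 / (lower_step * lam / 2) + 1) * (2 * lower_step\<^sup>2 * \<sigma>\<^sup>2))"

lemma lower_step_pos: "0 < lower_step"
  unfolding lower_step_def using lam_pos lam_le_Lgy by simp

lemma lower_step_lam_le: "lower_step * lam \<le> 1"
  unfolding lower_step_def using lam_pos lam_le_Lgy mult_mono[of lam Lgy lam Lgy]
  by (simp add: power2_eq_square divide_le_eq)

lemma step_ratio_nonneg: "0 \<le> step_ratio"
  unfolding step_ratio_def using lower_step_pos lam_pos by simp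

lemma upper_step_pos: "0 < upper_step"
  unfolding upper_step_def using KF_nonneg step_ratio_nonneg by simp

lemma upper_step_le: "KF * upper_step \<le> 1 / 4" "step_ratio * upper_step\<^sup>2 \<le> 1 / 4"
proof -
  have pos: "0 < 1 + KF + step_ratio" using KF_nonneg step_ratio_nonneg by simp
  show "KF * upper_step \<le> 1 / 4"
    unfolding upper_step_def using pos step_ratio_nonneg by (simp add: field_simps)
  have "step_ratio * upper_step \<le> 1 / 4"
    unfolding upper_step_def using pos KF_nonneg by (simp add: field_simps)
  moreover have "upper_step \<le> 1"
    unfolding upper_step_def using KF_nonneg step_ratio_nonneg by (simp add: field_simps)
  ultimately have "(step_ratio * upper_step) * upper_step \<le> 1 / 4 * 1"
    using upper_step_pos by (intro mult_mono) auto
  then show "step_ratio * upper_step\<^sup>2 \<le> 1 / 4" by (simp add: power2_eq_square mult.assoc)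
qed

lemma rate_const_nonneg: "0 \<le> gap \<Longrightarrow> 0 \<le> \<delta> \<Longrightarrow> 0 \<le> rate_const gap \<delta>"
  unfolding rate_const_def bias_const_def
  using upper_step_pos lower_step_pos lam_pos by simp

end

lemma (in smb_setup) smb_rate:
  fixes x0 :: "real^'d" and y0 :: "real^'e" and T :: nat
  defines "s \<equiv> 1 / sqrt (real T)"
  assumes T: "2 \<le> T"
    and k_lower: "\<And>t. C / lam * ln (real T) \<le> real (k t)"
    and k_upper: "\<And>t. real (k t) \<le> c\<^sub>k * ln (real T)"
    and Fmin: "\<And>x. Fmin \<le> F x"
  defines "x \<equiv> \<lambda>t w. smb_x Orc C Y (1 - s) (upper_step * s) (lower_step * s) k x0 y0 (\<lambda>c. \<xi> c w) (\<lambda>r. p r w) t"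
    and "z \<equiv> \<lambda>t w. smb_z Orc C Y (1 - s) (upper_step * s) (lower_step * s) k x0 y0 (\<lambda>c. \<xi> c w) (\<lambda>r. p r w) t"
  defines "A \<equiv> \<lambda>w. 1 / real (T + 1) * (\<Sum>t\<le>T. (norm (DF (x t w)))\<^sup>2)"
    and "B \<equiv> \<lambda>w. 1 / real (T + 1) * (\<Sum>t\<le>T. (norm (z (Suc t) w - DF (x t w)))\<^sup>2)"
  shows "integrable M A" "integrable M B"
    "(LINT w|M. A w) + (LINT w|M. B w)
      \<le> 2 / upper_step * ((rate_const (F x0 - Fmin) ((norm (y0 - ystar x0))\<^sup>2)
          + 12 * upper_step * \<sigma>\<^sup>2) / ln 2
          + 12 * upper_step * moment_rate * c\<^sub>k) * (ln (real T) * s)"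
proof -
  define L where "L = ln (real T)"
  define c where "c = upper_step"
  define V where "V = 2 * \<sigma>\<^sup>2 + 2 * (moment_rate * (c\<^sub>k * L))"
  define R where "R = rate_const (F x0 - Fmin) ((norm (y0 - ystar x0))\<^sup>2)"
  have s: "0 < s" "s \<le> 1" and s2: "s\<^sup>2 = 1 / real T"
    unfolding s_def using T by (auto simp: power_divide)
  have c: "0 < c" unfolding c_def by (rule upper_step_pos)
  have L: "0 < ln (2::real)" "ln 2 \<le> L" using T by (auto simp: L_def)
  have \<eta>x: "0 < upper_step * s" "KF * (upper_step * s) \<le> 1 / 4"
    using upper_step_pos s mult_mono[OF upper_step_le(1) s(2)] by (auto simp: mult.assoc)
  have \<eta>y: "0 < lower_step * s" "lower_step * s * Lgy\<^sup>2 \<le> lam" "lower_step * s * lam \<le> 1"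
  proof -
    show "0 < lower_step * s" using lower_step_pos s by simp
    have "lower_step * s * Lgy\<^sup>2 = lam * s"
      unfolding lower_step_def using lam_pos lam_le_Lgy by (simp add: field_simps)
    then show "lower_step * s * Lgy\<^sup>2 \<le> lam" using mult_left_le[OF s(2), of lam] lam_pos by linarith
    show "lower_step * s * lam \<le> 1"
      using mult_mono[OF lower_step_lam_le s(2)] lower_step_pos lam_pos s by (simp add: mult_ac)
  qed
  have bias: "(Cgxy * (Cfy / lam))\<^sup>2 * \<rho> ^ k t \<le> bias_const * s\<^sup>2" for t
  proof -
    \<comment> \<open>From \<open>1 - u \<le> exp (- u)\<close>. The factor \<open>C / lam\<close>
      in the lower bound on the length is what makes the exponent reach
      \<open>- ln T\<close>.\<close>
    have "\<rho> ^ k t \<le> exp (- (lam / C)) ^ k t"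
      using \<rho>_bounds exp_ge_add_one_self[of "- (lam / C)"] by (intro power_mono) (auto simp: \<rho>_def)
    also have "\<dots> = exp (- (lam / C * real (k t)))"
        by (simp add: exp_of_nat_mult[symmetric] mult.commute)
    also have "\<dots> \<le> exp (- L)"
    proof -
      have "lam / C * (C / lam * L) \<le> lam / C * real (k t)"
        using k_lower[of t] lam_pos C_pos unfolding L_def by (intro mult_left_mono) auto
      then show ?thesis using lam_pos C_pos by simp
    qed
    also have "\<dots> = s\<^sup>2" using T by (simp add: s2 L_def exp_minus divide_inverse)
    finally show ?thesis unfolding bias_const_def by (rule mult_left_mono) simp
  qed
  have variance: "2 * \<sigma>\<^sup>2 + 2 * (moment_rate * real (k t)) \<le> V" for t
    unfolding V_def using mult_left_mono[OF k_upper moment_rate_nonneg, of t] by (simp add: L_def)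
  have V: "0 \<le> V"
    using variance[of 0] moment_rate_nonneg
        by (smt (verit) mult_nonneg_nonneg of_nat_0_le_iff zero_le_power2)
  have small: "2 * (3 * LF\<^sup>2 * upper_step\<^sup>2)
      + 2 * (3 * Lstar\<^sup>2 * upper_step\<^sup>2 / (lower_step * lam)) * (2 * L\<Phi>\<^sup>2)
      * (1 / (lower_step * lam / 2) + 1) \<le> 1 / 4"
    using upper_step_le(2) unfolding step_ratio_def by (simp add: algebra_simps)
  note hyps = s \<eta>x \<eta>y bias variance Fmin
  have int: "integrable M (\<lambda>w. (norm (DF (x t w)))\<^sup>2)" "integrable M (\<lambda>w. (norm (z (Suc t) w - DF (x t w)))\<^sup>2)" for t
    unfolding x_def z_def
    using gradient_integrable[OF hyps, of x0 y0 t] error_integrable[OF hyps, of x0 y0 t] by blast+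
  show "integrable M A" "integrable M B"
    unfolding A_def B_def by (intro integrable_mult_right Bochner_Integration.integrable_sum int)+
  define \<Sigma> where "\<Sigma> = (\<Sum>t\<le>T. (LINT w|M. (norm (DF (x t w)))\<^sup>2)
      + (LINT w|M. (norm (z (Suc t) w - DF (x t w)))\<^sup>2))"
  have sum: "(LINT w|M. A w) + (LINT w|M. B w) = \<Sigma> / real (T + 1)"
    unfolding A_def B_def \<Sigma>_def using int by (simp add: sum.distrib add_divide_distrib)
  define P where "P = F x0 - Fmin + 2 * c * (4 * bias_const + 4 * L\<Phi>\<^sup>2 * (norm (y0 - ystar x0))\<^sup>2
      + 2 * V)
      + 2 * c * (2 * L\<Phi>\<^sup>2) / (lower_step * lam / 2) * (norm (y0 - ystar x0))\<^sup>2"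
  define Q where "Q = 2 * c * (2 * bias_const + V)
      + 2 * c * (2 * L\<Phi>\<^sup>2) * (1 / (lower_step * lam / 2) + 1) * (2 * lower_step\<^sup>2 * \<sigma>\<^sup>2)"
  have "0 \<le> bias_const" by (simp add: bias_const_def)
  then have P: "0 \<le> P"
    unfolding P_def using Fmin[of x0] c V lower_step_pos lam_pos
    by (intro add_nonneg_nonneg mult_nonneg_nonneg divide_nonneg_nonneg) auto
  have "c * s / 2 * \<Sigma> \<le> P + real (T + 1) * (s\<^sup>2 * Q)"
    unfolding \<Sigma>_def P_def Q_def x_def z_def c_def
    by (rule average_sum_bound[OF hyps refl refl refl refl \<open>0 \<le> bias_const\<close> small])
  then have "c * s / 2 * \<Sigma> / real (T + 1) \<le> (P + real (T + 1) * (s\<^sup>2 * Q)) / real (T + 1)"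
    by (rule divide_right_mono) simp
  also have "\<dots> = P / real (T + 1) + s\<^sup>2 * Q" by (simp add: add_divide_distrib)
  also have "\<dots> \<le> s\<^sup>2 * P + s\<^sup>2 * Q"
  proof -
    have "P / real (T + 1) \<le> P / real T" using P T by (intro divide_left_mono) auto
    then show ?thesis by (simp add: s2)
  qed
  finally have "s * (c / 2 * (\<Sigma> / real (T + 1))) \<le> s * (s * (P + Q))"
    by (simp add: power2_eq_square algebra_simps)
  then have "c / 2 * (\<Sigma> / real (T + 1)) \<le> s * (P + Q)"
    using s by (simp only: mult_le_cancel_left_pos)
  then have "2 / c * (c / 2 * (\<Sigma> / real (T + 1))) \<le> 2 / c * (s * (P + Q))"
    using c by (intro mult_left_mono) auto
  moreover have "2 / c * (c / 2 * a) = a" for a using c by simp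
  ultimately have main: "\<Sigma> / real (T + 1) \<le> 2 / c * (s * (P + Q))" by (simp only:)
  \<comment> \<open>\<open>V\<close> occurs in \<open>P\<close> with coefficient
    \<open>4 * c\<close> and in \<open>Q\<close> with \<open>2 * c\<close>; inserting its definition
    produces the twelves.\<close>
  have PQ: "P + Q = (R + 12 * c * \<sigma>\<^sup>2) + 12 * c * moment_rate * c\<^sub>k * L"
    unfolding P_def Q_def R_def V_def rate_const_def c_def by (simp add: algebra_simps)
  have "0 \<le> R + 12 * c * \<sigma>\<^sup>2"
    unfolding R_def using rate_const_nonneg Fmin[of x0] c by simp
  \<comment> \<open>The part free of \<open>L\<close> is charged to the logarithm through
    \<open>ln 2 \<le> L\<close>, so that one rate covers both parts.\<close>
  then have "(R + 12 * c * \<sigma>\<^sup>2) * 1 \<le> (R + 12 * c * \<sigma>\<^sup>2) * (L / ln 2)"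
    using L by (intro mult_left_mono) auto
  then have "P + Q \<le> ((R + 12 * c * \<sigma>\<^sup>2) / ln 2 + 12 * c * moment_rate * c\<^sub>k) * L"
    unfolding PQ by (simp add: add_divide_distrib algebra_simps)
  then have "2 / c * (s * (P + Q))
      \<le> 2 / c * (s * (((R + 12 * c * \<sigma>\<^sup>2) / ln 2 + 12 * c * moment_rate * c\<^sub>k) * L))"
    using s c by (intro mult_left_mono) auto
  also have "\<dots> = 2 / c * ((R + 12 * c * \<sigma>\<^sup>2) / ln 2 + 12 * c * moment_rate * c\<^sub>k) * (L * s)"
    by (simp only: mult_ac)
  finally show "(LINT w|M. A w) + (LINT w|M. B w)
      \<le> 2 / upper_step * ((rate_const (F x0 - Fmin) ((norm (y0 - ystar x0))\<^sup>2)
          + 12 * upper_step * \<sigma>\<^sup>2) / ln 2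
          + 12 * upper_step * moment_rate * c\<^sub>k) * (ln (real T) * s)"
    using main unfolding sum c_def[symmetric] R_def[symmetric] L_def[symmetric]
        by (rule order_trans[rotated])
qed

text \<open>\<open>K\<close> is chosen after \<open>ck'\<close> but before \<open>T\<close>, the
  schedule \<open>k\<close> and the sampling space, so the bound is uniform over these. The lower
  bound on \<open>k t\<close> limits the bias, the upper bound the variance.\<close>

theorem theorem18:
  fixes f g :: "real^'d \<Rightarrow> real^'e \<Rightarrow> real"
    and Y :: "(real^'e) set"
    and fx :: "real^'d \<Rightarrow> real^'e \<Rightarrow> real^'d"
    and fy gy :: "real^'d \<Rightarrow> real^'e \<Rightarrow> real^'e"
    and gxy :: "real^'d \<Rightarrow> real^'e \<Rightarrow> real^'e^'d"
    and gyy :: "real^'d \<Rightarrow> real^'e \<Rightarrow> real^'e^'e"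
    and S :: "'s measure"
    and Orc :: "('s, 'd, 'e) oracles"
    and x0 :: "real^'d" and y0 :: "real^'e"
    and lam Lfx Lfy Lgy Lgxy Lgyy \<sigma> Cfy Cgxy Cgyy \<Delta>F :: real
    and F :: "real^'d \<Rightarrow> real" and xmin :: "real^'d"
  assumes Y: "convex Y" "closed Y" "Y \<noteq> {}"
    and F_def: "F = bilevel_objective f g Y"
    and F_min: "is_arg_min F (\<lambda>_. True) xmin" and F_init: "F x0 - F xmin \<le> \<Delta>F"
    and strong: "lam > 0" "\<And>x. strongly_convex lam (g x)"
    and grad_fx: "\<And>x y. GDERIV (\<lambda>x. f x y) x :> fx x y"
    and grad_fy: "\<And>x y. GDERIV (\<lambda>y. f x y) y :> fy x y"
    and grad_gy: "\<And>x y. GDERIV (\<lambda>y. g x y) y :> gy x y"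
    and hess_gxy: "\<And>x y. ((\<lambda>x. gy x y) has_derivative (*v) (transpose (gxy x y))) (at x)"
    and hess_gyy: "\<And>x y. ((\<lambda>y. gy x y) has_derivative (*v) (gyy x y)) (at y)"
    and inactive: "\<And>x. gy x (lower_argmin g Y x) = 0"
    and lip_fx: "Lfx-lipschitz_on UNIV (\<lambda>(x, y). fx x y)"
    and lip_fy: "Lfy-lipschitz_on UNIV (\<lambda>(x, y). fy x y)"
    and lip_gy: "Lgy-lipschitz_on UNIV (\<lambda>(x, y). gy x y)"
    and lip_gxy: "spectral_lipschitz Lgxy gxy"
    and lip_gyy: "spectral_lipschitz Lgyy gyy"
    and S: "prob_space S"
    and orc_fx: "unbiased_oracle norm S \<sigma> (O_fx Orc) fx"
    and orc_fy: "unbiased_oracle norm S \<sigma> (O_fy Orc) fy"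
    and orc_gy: "unbiased_oracle norm S \<sigma> (O_gy Orc) gy"
    and orc_gxy: "unbiased_oracle spectral_norm S \<sigma> (O_gxy Orc) gxy"
    and orc_gyy: "unbiased_oracle spectral_norm S \<sigma> (O_gyy Orc) gyy"
    and orc_gyy_bounds:
      "\<And>s x y. s \<in> space S \<Longrightarrow> psd (O_gyy Orc s x y) \<and> psd (mat Cgyy - O_gyy Orc s x y)"
    and bound_fy: "\<And>x y. (norm (fy x y))\<^sup>2 \<le> Cfy\<^sup>2"
    and bound_gxy: "\<And>x y. (spectral_norm (gxy x y))\<^sup>2 \<le> Cgxy\<^sup>2"
  shows "\<exists>c\<gamma> cx cy ck. 0 < c\<gamma> \<and> c\<gamma> \<le> 1 \<and> 0 < cx \<and> 0 < cy \<and> 0 < ck \<and>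
    (\<forall>ck'. \<exists>K. \<forall>T::nat. T \<ge> 2 \<longrightarrow>
      (\<forall>k::nat \<Rightarrow> nat. (\<forall>t. ck * ln (real T) \<le> real (k t) \<and> real (k t) \<le> ck' * ln (real T)) \<longrightarrow>
        (\<forall>(M::'w measure) \<xi> p. smb_sampling M S k \<xi> p \<longrightarrow>
          (let \<gamma> = c\<gamma> / sqrt (real T); \<eta>x = cx / sqrt (real T); \<eta>y = cy / sqrt (real T);
               x = (\<lambda>t \<omega>. smb_x Orc Cgyy Y (1 - \<gamma>) \<eta>x \<eta>y k x0 y0 (\<lambda>c. \<xi> c \<omega>) (\<lambda>r. p r \<omega>) t);
               z = (\<lambda>t \<omega>. smb_z Orc Cgyy Y (1 - \<gamma>) \<eta>x \<eta>y k x0 y0 (\<lambda>c. \<xi> c \<omega>) (\<lambda>r. p r \<omega>) t);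
               \<Delta> = (\<lambda>t \<omega>. (norm (z (t + 1) \<omega> - grad F (x t \<omega>)))\<^sup>2);
               A = (\<lambda>\<omega>. 1 / real (T + 1) * (\<Sum>t=0..T. (norm (grad F (x t \<omega>)))\<^sup>2));
               B = (\<lambda>\<omega>. 1 / real (T + 1) * (\<Sum>t=0..T. \<Delta> t \<omega>))
           in integrable M A \<and> (LINT \<omega>|M. A \<omega>) \<le> K * (ln (real T) / sqrt (real T)) \<and>
              integrable M B \<and> (LINT \<omega>|M. B \<omega>) \<le> K * (ln (real T) / sqrt (real T))))))"
proof -
  \<comment> \<open>Symmetry of the Hessian is read off from its oracle, as a mean of symmetric
    matrices.\<close>
  have psd: "psd (gyy x y)" for x y
    using psd_mean[OF unbiased_oracleD(1)[OF orc_gyy], of x y] orc_gyy_bounds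
    by (simp add: unbiased_oracleD(2)[OF orc_gyy])
  \<comment> \<open>Bounds on squares leave the signs of \<open>Cfy\<close> and \<open>Cgxy\<close>
    open; absolute values turn them into bounds on norms.\<close>
  interpret bilevel_oracles f g Y fx fy gy gxy gyy lam Lfx Lfy Lgy Lgxy Lgyy "\<bar>Cfy\<bar>" "\<bar>Cgxy\<bar>" S Orc \<sigma> Cgyy
  proof (intro bilevel_oracles.intro bilevel_oracles_axioms.intro bilevel.intro)
    show "norm (fy x y) \<le> \<bar>Cfy\<bar>" for x y
      using bound_fy[of x y] by (simp add: abs_le_square_iff[symmetric])
    show "spectral_norm (gxy x y) \<le> \<bar>Cgxy\<bar>" for x y
      using bound_gxy[of x y] by (metis abs_le_square_iff abs_of_nonneg spectral_norm_nonneg)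
    show "transpose (gyy x y) = gyy x y" for x y using psd[of x y] by (simp add: psd_def)
  qed (fact assms)+
  have min: "F xmin \<le> F x" for x
    using F_min by (simp add: is_arg_min_linorder)
  define K where "K ck' = 2 / upper_step * ((rate_const (F x0 - F xmin) ((norm (y0 - ystar x0))\<^sup>2)
      + 12 * upper_step * \<sigma>\<^sup>2) / ln 2 + 12 * upper_step * moment_rate * ck')" for ck'
  show ?thesis
  proof (rule exI[of _ 1], rule exI[of _ upper_step], rule exI[of _ lower_step],
      rule exI[of _ "Cgyy / lam"], intro conjI allI, goal_cases)
    case (6 ck')
    show ?case
    proof (rule exI[of _ "K ck'"], intro allI impI)
      fix T :: nat and k :: "nat \<Rightarrow> nat" and M :: "'w measure" and \<xi> p
      assume T: "2 \<le> T"
        and k: "\<forall>t. Cgyy / lam * ln (real T) \<le> real (k t) \<and> real (k t) \<le> ck' * ln (real T)"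
        and sampling: "smb_sampling M S k \<xi> p"
      \<comment> \<open>The uniform law of the length needs a nonempty support; the logarithmic
        lower bound provides it as \<open>T\<close> is at least 2.\<close>
      have "0 < Cgyy / lam * ln (real T)" using T C_pos lam_pos by simp
      then have "0 < k t" for t using k[rule_format, of t] by linarith
      then interpret smb_setup f g Y fx fy gy gxy gyy lam Lfx Lfy Lgy Lgxy Lgyy "\<bar>Cfy\<bar>" "\<bar>Cgxy\<bar>" S Orc \<sigma> Cgyy M k \<xi> p
        using sampling by unfold_locales
      have k_lower: "Cgyy / lam * ln (real T) \<le> real (k t)"
        and k_upper: "real (k t) \<le> ck' * ln (real T)" for t
        using k by blast+
      have Fmin: "F xmin \<le> bilevel_objective f g Y x" for x
        using min by (simp add: F_def)
      define s where "s = 1 / sqrt (real T)"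
      define x where "x t w = smb_x Orc Cgyy Y (1 - s) (upper_step * s) (lower_step * s) k x0 y0 (\<lambda>c. \<xi> c w) (\<lambda>r. p r w) t"
        for t w
      define z where "z t w = smb_z Orc Cgyy Y (1 - s) (upper_step * s) (lower_step * s) k x0 y0 (\<lambda>c. \<xi> c w) (\<lambda>r. p r w) t"
        for t w
      define A where "A w = 1 / real (T + 1) * (\<Sum>t\<le>T. (norm (DF (x t w)))\<^sup>2)" for w
      define B where "B w = 1 / real (T + 1) * (\<Sum>t\<le>T. (norm (z (Suc t) w - DF (x t w)))\<^sup>2)" for w
      have grad: "grad F = DF" using grad_objective by (auto simp: F_def)
      have rate: "integrable M A" "integrable M B" "(LINT w|M. A w) + (LINT w|M. B w)
          \<le> K ck' * (ln (real T) * s)"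
        unfolding A_def[abs_def] B_def[abs_def] x_def z_def s_def K_def F_def
        using smb_rate[OF T k_lower k_upper Fmin, of x0 y0] unfolding F_def by blast+
      \<comment> \<open>Both averages are nonnegative, so the bound on their sum holds for
        either.\<close>
      have "0 \<le> (LINT w|M. A w)" "0 \<le> (LINT w|M. B w)"
        unfolding A_def B_def by (intro Bochner_Integration.integral_nonneg mult_nonneg_nonneg sum_nonneg; simp)+
      then have "(LINT w|M. A w) \<le> K ck' * (ln (real T) * s)" "(LINT w|M. B w)
          \<le> K ck' * (ln (real T) * s)"
        using rate(3) by linarith+
      then show "let \<gamma> = 1 / sqrt (real T); \<eta>x = upper_step / sqrt (real T); \<eta>y
          = lower_step / sqrt (real T);
               x = (\<lambda>t \<omega>. smb_x Orc Cgyy Y (1 - \<gamma>) \<eta>x \<eta>y k x0 y0 (\<lambda>c. \<xi> c \<omega>) (\<lambda>r. p r \<omega>) t);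
               z = (\<lambda>t \<omega>. smb_z Orc Cgyy Y (1 - \<gamma>) \<eta>x \<eta>y k x0 y0 (\<lambda>c. \<xi> c \<omega>) (\<lambda>r. p r \<omega>) t);
               \<Delta> = (\<lambda>t \<omega>. (norm (z (t + 1) \<omega> - grad F (x t \<omega>)))\<^sup>2);
               A = (\<lambda>\<omega>. 1 / real (T + 1) * (\<Sum>t=0..T. (norm (grad F (x t \<omega>)))\<^sup>2));
               B = (\<lambda>\<omega>. 1 / real (T + 1) * (\<Sum>t=0..T. \<Delta> t \<omega>))
           in integrable M A \<and> (LINT \<omega>|M. A \<omega>) \<le> K ck' * (ln (real T) / sqrt (real T)) \<and>
              integrable M B \<and> (LINT \<omega>|M. B \<omega>) \<le> K ck' * (ln (real T) / sqrt (real T))"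
        using rate(1,2) unfolding Let_def grad A_def[abs_def] B_def[abs_def] x_def z_def s_def
        by (simp add: atLeast0AtMost)
    qed
  qed (use upper_step_pos lower_step_pos C_pos lam_pos in auto)
qed

end
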